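(* Let $\Gamma$ be a nonelementary discrete subgroup of $\mathrm{SU}(n,1)$ whose trace field is contained in $\mathbb R$. Then $\Gamma$ is conjugate either to a subgroup of $\mathrm{S}(\mathrm{U}(n-m)\oplus\mathrm{O}(m,1))$ for some $m\ge 2$, or to a subgroup of $\mathrm{SU}(n-1)\oplus\mathrm{SU}(1,1)$.
   Context: $\mathrm{SU}(n,1)$ is the group of complex $(n+1)\times(n+1)$ matrices of determinant $1$ preserving the Hermitian form $w^*I_{n,1}z$, $I_{n,1}=\mathrm{diag}(1,\dots,1,-1)$, acting on complex hyperbolic space $\mathbf H^n_{\mathbb C}$; nonelementary means the limit set in $\partial\mathbf H^n_{\mathbb C}$ has more than two points. The trace field is the field generated over $\mathbb Q$ by the traces of the elements of $\Gamma$. $A\oplus B$ is the block diagonal matrix with blocks $A$ (acting on the first coordinates) and $B$ (acting on the last coordinates); $\mathrm{O}(m,1)$ is the group of real matrices preserving $\mathrm{diag}(1,\dots,1,-1)$; $\mathrm{S}(\mathrm{U}(n-m)\oplus\mathrm{O}(m,1))$ denotes the block diagonal matrices $A\oplus B$ with $A\in\mathrm{U}(n-m)$, $B\in\mathrm{O}(m,1)$ and determinant $1$. *)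

theory Defs
  imports Complex_Main "Jordan_Normal_Form.Matrix" "Jordan_Normal_Form.Determinant"
begin

definition adj :: "complex mat \<Rightarrow> complex mat" where
  "adj A = mat (dim_col A) (dim_row A) (\<lambda>(i,j). cnj (A $$ (j,i)))"

definition Ipq :: "nat \<Rightarrow> 'a::ring_1 mat" where
  "Ipq p = mat (p+1) (p+1) (\<lambda>(i,j). if i = j then (if i = p then -1 else 1) else 0)"

definition SU_n1 :: "nat \<Rightarrow> complex mat set" where
  "SU_n1 n = {g. g \<in> carrier_mat (n+1) (n+1) \<and> det g = 1 \<and> adj g * Ipq n * g = Ipq n}"

definition U :: "nat \<Rightarrow> complex mat set" where
  "U k = {g. g \<in> carrier_mat k k \<and> adj g * g = 1\<^sub>m k}"

definition SU :: "nat \<Rightarrow> complex mat set" where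
  "SU k = {g. g \<in> U k \<and> det g = 1}"

definition O_m1 :: "nat \<Rightarrow> complex mat set" where
  "O_m1 m = {map_mat complex_of_real B | B. B \<in> carrier_mat (m+1) (m+1) \<and>
              transpose_mat B * Ipq m * B = (Ipq m :: real mat)}"

definition block_diag :: "complex mat \<Rightarrow> complex mat \<Rightarrow> complex mat" where
  "block_diag A B = four_block_mat A (0\<^sub>m (dim_row A) (dim_col B)) (0\<^sub>m (dim_row B) (dim_col A)) B"

definition S_U_O :: "nat \<Rightarrow> nat \<Rightarrow> complex mat set" where
  "S_U_O n m = {block_diag A B | A B. A \<in> U (n - m) \<and> B \<in> O_m1 m \<and> det (block_diag A B) = 1}"

definition SU_SU11 :: "nat \<Rightarrow> complex mat set" where
  "SU_SU11 n = {block_diag A B | A B. A \<in> SU (n - 1) \<and> B \<in> SU_n1 1}"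

(* Ball model of complex hyperbolic space: z = [w : 1], |w| < 1; boundary |w| = 1. *)
definition vnorm2 :: "complex vec \<Rightarrow> real" where
  "vnorm2 w = (\<Sum>i<dim_vec w. (cmod (w $ i))^2)"

definition act :: "complex mat \<Rightarrow> complex vec \<Rightarrow> complex vec" where
  "act g w = (let n = dim_vec w;
                  v = g *\<^sub>v vec (n+1) (\<lambda>i. if i < n then w $ i else 1)
              in vec n (\<lambda>i. v $ i / v $ n))"

definition limit_set :: "nat \<Rightarrow> complex mat set \<Rightarrow> complex vec set" where
  "limit_set n G = {\<xi>. \<xi> \<in> carrier_vec n \<and> vnorm2 \<xi> = 1 \<and>
      (\<exists>g::nat \<Rightarrow> complex mat. (\<forall>k. g k \<in> G) \<and>
          (\<forall>i<n. (\<lambda>k. act (g k) (0\<^sub>v n) $ i) \<longlonglongrightarrow> \<xi> $ i))}"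

definition nonelementary :: "nat \<Rightarrow> complex mat set \<Rightarrow> bool" where
  "nonelementary n G = (\<exists>a b c. a \<in> limit_set n G \<and> b \<in> limit_set n G \<and> c \<in> limit_set n G
                          \<and> a \<noteq> b \<and> a \<noteq> c \<and> b \<noteq> c)"

definition mat_dist :: "complex mat \<Rightarrow> complex mat \<Rightarrow> real" where
  "mat_dist A B = (\<Sum>i<dim_row A. \<Sum>j<dim_col A. cmod (A $$ (i,j) - B $$ (i,j)))"

definition discrete_mats :: "complex mat set \<Rightarrow> bool" where
  "discrete_mats G = (\<forall>g\<in>G. \<exists>e>0. \<forall>h\<in>G. h \<noteq> g \<longrightarrow> mat_dist g h \<ge> e)"

definition is_subgroup_of :: "complex mat set \<Rightarrow> nat \<Rightarrow> bool" where
  "is_subgroup_of G n = (G \<subseteq> SU_n1 n \<and> 1\<^sub>m (n+1) \<in> G \<and>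
       (\<forall>g\<in>G. \<forall>h\<in>G. g * h \<in> G) \<and>
       (\<forall>g\<in>G. \<exists>h\<in>G. g * h = 1\<^sub>m (n+1)))"

definition mtrace :: "complex mat \<Rightarrow> complex" where
  "mtrace A = (\<Sum>i<dim_row A. A $$ (i,i))"

definition trace_field :: "complex mat set \<Rightarrow> complex set" where
  "trace_field G = \<Inter>{F. mtrace ` G \<subseteq> F \<and> 0 \<in> F \<and> 1 \<in> F \<and>
       (\<forall>x\<in>F. \<forall>y\<in>F. x + y \<in> F \<and> x * y \<in> F \<and> -x \<in> F \<and> (x \<noteq> 0 \<longrightarrow> inverse x \<in> F))}"

definition conj_into :: "nat \<Rightarrow> complex mat set \<Rightarrow> complex mat set \<Rightarrow> bool" where
  "conj_into n G H = (\<exists>A\<in>SU_n1 n. \<forall>g\<in>G. \<exists>h\<in>H. A * g = h * A)"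

end

theory Submission
  imports Defs "HOL-Analysis.L2_Norm"
begin

text \<open>A sequence in \<open>\<Gamma>\<close> tending to a limit point, rescaled to norm one, subconverges to a rank one map
  \<open>x \<mapsto> \<langle>x, \<eta>\<rangle> p\<close> with \<open>p\<close> and \<open>\<eta>\<close> null, and real traces force
  \<open>\<langle>h \<eta>, \<eta>\<rangle> \<langle>h' p, p\<rangle>\<close> to be real for all \<open>h, h'\<close> in \<open>\<Gamma>\<close>. Discreteness enters only to show that \<open>\<Gamma>\<close> fixes no null
  line, so both factors are nonzero for suitable elements, and hence the numbers \<open>\<langle>g p, p\<rangle>\<close> are all real
  or all imaginary. Choose \<open>q\<close> on the line of some \<open>h p\<close> with \<open>\<langle>p, q\<rangle> = 1\<close>. If some \<open>g p\<close> is not in the plane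
  spanned by \<open>p\<close> and \<open>q\<close>, nullity of \<open>g p\<close> excludes the imaginary case; then the form is real on the real
  span of the orbit of \<open>p\<close>, and an orthonormal basis of this span, completed to one of the whole space, conjugates \<open>\<Gamma>\<close>
  into \<open>S(U(n-m) \<oplus> O(m,1))\<close>. If the orbit stays in the plane, the real case would make \<open>\<Gamma>\<close> permute the two
  null lines of a real Lorentzian plane, which is elementary, and in the imaginary case \<open>\<Gamma>\<close> acts on the
  plane by real matrices preserving an area form, hence with determinant one.\<close>

section \<open>The Hermitian form of signature (n,1)\<close>

text \<open>Conjugating h by g_k and then multiplying by h' is what separates the two limit vectors:
  rescaled traces of g_k h alone only show that the mixed numbers \<langle>h p, \<eta>\<rangle> are
  real, and these do not compare the orbit of p with itself. The separated product says nothing if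
  \<Gamma> keeps the line of p or that of \<eta>, since one factor then vanishes identically. More
  than two limit points do not exclude this: a loxodromic and a parabolic element may share a
  boundary fixed point and still produce infinitely many limit points. It is discreteness that
  forbids such a pair, because conjugates of one by powers of the other would stay bounded and yet
  be infinitely many. The rest leans on one fact: the orthogonal complement of a negative vector is
  positive definite. It makes a null residual vector vanish in the imaginary case, and it lets
  orthonormal systems be extended greedily, inside a real span as well as in the whole
  space.\<close>

definition sg :: "nat \<Rightarrow> nat \<Rightarrow> complex" where
  "sg n i = (if i = n then -1 else 1)"

definition herm :: "nat \<Rightarrow> complex vec \<Rightarrow> complex vec \<Rightarrow> complex" where
  "herm n x y = (\<Sum>i\<le>n. sg n i * x $ i * cnj (y $ i))"

text \<open>The adjoint with respect to \<^const>\<open>herm\<close>; on \<^term>\<open>SU_n1 n\<close> it is the inverse.\<close>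

definition hadj :: "nat \<Rightarrow> complex mat \<Rightarrow> complex mat" where
  "hadj n g = mat (Suc n) (Suc n) (\<lambda>(i,j). sg n i * sg n j * cnj (g $$ (j,i)))"

lemma sg_simps [simp]: "sg n i * sg n i = 1" "cnj (sg n i) = sg n i" "sg n n = -1" "sg n i \<noteq> 0"
  "sg n i * (sg n i * c) = c" "cmod (sg n i) = 1"
  by (auto simp: sg_def)

lemma hadj_carrier [simp]: "hadj n g \<in> carrier_mat (Suc n) (Suc n)"
  by (simp add: hadj_def)

lemma Ipq_carrier [simp]: "Ipq n \<in> carrier_mat (Suc n) (Suc n)"
  by (simp add: Ipq_def)

lemma herm_split: "herm n x y = (\<Sum>i<n. x $ i * cnj (y $ i)) - x $ n * cnj (y $ n)"
proof -
  have *: "{..n} = insert n {..<n}" by auto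
  have "(\<Sum>i<n. sg n i * x $ i * cnj (y $ i)) = (\<Sum>i<n. x $ i * cnj (y $ i))"
    by (rule sum.cong) (auto simp: sg_def)
  then show ?thesis by (simp add: herm_def *)
qed

lemma herm_self: "herm n x x = complex_of_real ((\<Sum>i<n. (cmod (x $ i))\<^sup>2) - (cmod (x $ n))\<^sup>2)"
  unfolding herm_split by (simp flip: complex_norm_square)

lemma herm_add_left:
  assumes "x \<in> carrier_vec (Suc n)" "y \<in> carrier_vec (Suc n)"
  shows "herm n (x + y) z = herm n x z + herm n y z"
  using assms by (simp add: herm_def algebra_simps sum.distrib)

lemma herm_smult_left:
  assumes "x \<in> carrier_vec (Suc n)"
  shows "herm n (c \<cdot>\<^sub>v x) z = c * herm n x z"
  using assms by (simp add: herm_def algebra_simps sum_distrib_left)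

lemma herm_minus_left:
  assumes "x \<in> carrier_vec (Suc n)" "y \<in> carrier_vec (Suc n)"
  shows "herm n (x - y) z = herm n x z - herm n y z"
  using assms by (simp add: herm_def algebra_simps sum_subtractf)

lemma herm_cnj: "cnj (herm n x y) = herm n y x"
  by (simp add: herm_def mult_ac)

lemma herm_add_right:
  assumes "x \<in> carrier_vec (Suc n)" "y \<in> carrier_vec (Suc n)"
  shows "herm n z (x + y) = herm n z x + herm n z y"
  using herm_add_left[OF assms, of z] by (metis herm_cnj complex_cnj_add)

lemma herm_minus_right:
  assumes "x \<in> carrier_vec (Suc n)" "y \<in> carrier_vec (Suc n)"
  shows "herm n z (x - y) = herm n z x - herm n z y"
  using herm_minus_left[OF assms, of z] by (metis herm_cnj complex_cnj_diff)

lemma herm_smult_right: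
  assumes "x \<in> carrier_vec (Suc n)"
  shows "herm n z (c \<cdot>\<^sub>v x) = cnj c * herm n z x"
  using herm_smult_left[OF assms, of c z] by (metis herm_cnj complex_cnj_mult)

lemmas herm_lin = herm_add_left herm_add_right herm_minus_left herm_minus_right
  herm_smult_left herm_smult_right

lemma herm_zero [simp]: "herm n (0\<^sub>v (Suc n)) z = 0" "herm n z (0\<^sub>v (Suc n)) = 0"
  by (simp_all add: herm_def)

lemma herm_unit:
  assumes "i \<le> n"
  shows "herm n (unit_vec (Suc n) i) z = sg n i * cnj (z $ i)"
  using assms by (simp add: herm_def unit_vec_def if_distrib if_distribR sum.delta cong: if_cong)

lemma mat_vec_index:
  assumes "g \<in> carrier_mat (Suc n) (Suc n)" "x \<in> carrier_vec (Suc n)" "i \<le> n"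
  shows "(g *\<^sub>v x) $ i = (\<Sum>j\<le>n. g $$ (i,j) * x $ j)"
  using assms by (auto simp: scalar_prod_def atLeast0LessThan lessThan_Suc_atMost intro!: sum.cong)

lemma mat_mult_index:
  assumes "A \<in> carrier_mat (Suc n) (Suc n)" "B \<in> carrier_mat (Suc n) (Suc n)" "i \<le> n" "j \<le> n"
  shows "(A * B) $$ (i,j) = (\<Sum>k\<le>n. A $$ (i,k) * B $$ (k,j))"
  using assms by (auto simp: scalar_prod_def atLeast0LessThan lessThan_Suc_atMost intro!: sum.cong)

lemma herm_hadj:
  assumes g: "g \<in> carrier_mat (Suc n) (Suc n)" and x: "x \<in> carrier_vec (Suc n)" and y: "y \<in> carrier_vec (Suc n)"
  shows "herm n (g *\<^sub>v x) y = herm n x (hadj n g *\<^sub>v y)"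
proof -
  have "herm n (g *\<^sub>v x) y = (\<Sum>i\<le>n. \<Sum>j\<le>n. sg n i * (g $$ (i,j) * x $ j) * cnj (y $ i))"
    unfolding herm_def
    by (rule sum.cong[OF refl]) (simp add: mat_vec_index[OF g x] sum_distrib_left sum_distrib_right)
  also have "\<dots> = (\<Sum>j\<le>n. \<Sum>i\<le>n. sg n i * (g $$ (i,j) * x $ j) * cnj (y $ i))"
    by (rule sum.swap)
  also have "\<dots> = herm n x (hadj n g *\<^sub>v y)"
    unfolding herm_def
  proof (rule sum.cong[OF refl])
    fix j assume "j \<in> {..n}"
    then have j: "j \<le> n" by simp
    have "sg n j * x $ j * cnj ((hadj n g *\<^sub>v y) $ j)
        = (\<Sum>i\<le>n. sg n j * x $ j * cnj (hadj n g $$ (j,i) * y $ i))"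
      using j mat_vec_index[OF hadj_carrier y j] by (simp add: sum_distrib_left)
    also have "\<dots> = (\<Sum>i\<le>n. sg n i * (g $$ (i,j) * x $ j) * cnj (y $ i))"
      using j by (intro sum.cong[OF refl]) (auto simp: hadj_def mult_ac)
    finally show "(\<Sum>i\<le>n. sg n i * (g $$ (i,j) * x $ j) * cnj (y $ i))
        = sg n j * x $ j * cnj ((hadj n g *\<^sub>v y) $ j)" by simp
  qed
  finally show ?thesis .
qed

lemma adj_Ipq_index:
  assumes g: "g \<in> carrier_mat (Suc n) (Suc n)" and i: "i \<le> n" and j: "j \<le> n"
  shows "(adj g * Ipq n * g) $$ (i,j) = (\<Sum>k\<le>n. sg n k * cnj (g $$ (k,i)) * g $$ (k,j))"
proof -
  have 1: "(adj g * Ipq n) $$ (i,k) = sg n k * cnj (g $$ (k,i))" if "k \<le> n" for k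
  proof -
    have "(adj g * Ipq n) $$ (i,k) = (\<Sum>l\<le>n. cnj (g $$ (l,i)) * (if l = k then sg n k else 0))"
      using g i that by (auto simp: adj_def Ipq_def sg_def scalar_prod_def atLeast0LessThan lessThan_Suc_atMost intro!: sum.cong)
    also have "\<dots> = sg n k * cnj (g $$ (k,i))"
      using that by (simp add: if_distrib sum.delta' mult.commute cong: if_cong)
    finally show ?thesis .
  qed
  have c: "adj g * Ipq n \<in> carrier_mat (Suc n) (Suc n)"
    using g by (auto simp: adj_def Ipq_def)
  have "(adj g * Ipq n * g) $$ (i,j) = (\<Sum>k\<le>n. (adj g * Ipq n) $$ (i,k) * g $$ (k,j))"
    by (rule mat_mult_index[OF c g i j])
  then show ?thesis using 1 by simp
qed

lemma Ipq_index: "i \<le> n \<Longrightarrow> j \<le> n \<Longrightarrow> Ipq n $$ (i,j) = (if i = j then sg n i else 0)"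
  by (auto simp: Ipq_def sg_def)

lemma hadj_mult_index:
  assumes g: "g \<in> carrier_mat (Suc n) (Suc n)" and i: "i \<le> n" and j: "j \<le> n"
  shows "(hadj n g * g) $$ (i,j) = sg n i * (\<Sum>k\<le>n. sg n k * cnj (g $$ (k,i)) * g $$ (k,j))"
  using g i j by (auto simp: hadj_def scalar_prod_def atLeast0LessThan lessThan_Suc_atMost sum_distrib_left mult_ac intro!: sum.cong)

text \<open>\<open>hadj n g\<close> is I adj(g) I with I = I_{n,1}, and I is its own inverse.
  Multiplying the invariance equation by I on the left therefore turns it into a left inverse of g,
  and conversely.\<close>

lemma adj_Ipq_iff:
  assumes g: "g \<in> carrier_mat (Suc n) (Suc n)"
  shows "adj g * Ipq n * g = Ipq n \<longleftrightarrow> hadj n g * g = 1\<^sub>m (Suc n)"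
proof
  assume *: "adj g * Ipq n * g = Ipq n"
  show "hadj n g * g = 1\<^sub>m (Suc n)"
  proof (rule eq_matI)
    fix i j assume "i < dim_row (1\<^sub>m (Suc n) :: complex mat)" "j < dim_col (1\<^sub>m (Suc n) :: complex mat)"
    then have ij: "i \<le> n" "j \<le> n" by auto
    show "(hadj n g * g) $$ (i,j) = 1\<^sub>m (Suc n) $$ (i,j)"
      unfolding hadj_mult_index[OF g ij] adj_Ipq_index[OF g ij, symmetric] * Ipq_index[OF ij]
      using ij by auto
  qed (use g in \<open>auto simp: hadj_def\<close>)
next
  assume *: "hadj n g * g = 1\<^sub>m (Suc n)"
  show "adj g * Ipq n * g = Ipq n"
  proof (rule eq_matI)
    fix i j assume "i < dim_row (Ipq n :: complex mat)" "j < dim_col (Ipq n :: complex mat)"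
    then have ij: "i \<le> n" "j \<le> n" by (auto simp: Ipq_def)
    have "sg n i * (sg n i * (\<Sum>k\<le>n. sg n k * cnj (g $$ (k,i)) * g $$ (k,j))) = sg n i * 1\<^sub>m (Suc n) $$ (i,j)"
      using hadj_mult_index[OF g ij] * by simp
    then show "(adj g * Ipq n * g) $$ (i,j) = Ipq n $$ (i,j)"
      unfolding adj_Ipq_index[OF g ij] Ipq_index[OF ij] using ij by (auto split: if_splits)
  qed (use g in \<open>auto simp: adj_def Ipq_def\<close>)
qed

section \<open>The adjoint as group inverse\<close>

lemma SU_n1_carrier: "g \<in> SU_n1 n \<Longrightarrow> g \<in> carrier_mat (Suc n) (Suc n)"
  by (simp add: SU_n1_def)

lemma hadj_left_inverse: "g \<in> SU_n1 n \<Longrightarrow> hadj n g * g = 1\<^sub>m (Suc n)"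
  by (simp add: SU_n1_def flip: adj_Ipq_iff)

lemma hadj_right_inverse: "g \<in> SU_n1 n \<Longrightarrow> g * hadj n g = 1\<^sub>m (Suc n)"
  by (rule mat_mult_left_right_inverse[OF hadj_carrier]) (auto simp: hadj_left_inverse dest: SU_n1_carrier)

lemma hadj_hadj: "g \<in> carrier_mat (Suc n) (Suc n) \<Longrightarrow> hadj n (hadj n g) = g"
  by (rule eq_matI) (auto simp: hadj_def)

lemma mult_vec_carrier [simp]:
  "g \<in> SU_n1 n \<Longrightarrow> x \<in> carrier_vec (Suc n) \<Longrightarrow> g *\<^sub>v x \<in> carrier_vec (Suc n)"
  by (rule mult_mat_vec_carrier[OF SU_n1_carrier])

lemma hadj_vec_inverse:
  assumes "g \<in> SU_n1 n" "x \<in> carrier_vec (Suc n)"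
  shows "hadj n g *\<^sub>v (g *\<^sub>v x) = x" "g *\<^sub>v (hadj n g *\<^sub>v x) = x"
  using assoc_mult_mat_vec[OF hadj_carrier SU_n1_carrier[OF assms(1)] assms(2), of g]
    assoc_mult_mat_vec[OF SU_n1_carrier[OF assms(1)] hadj_carrier assms(2), of g]
  unfolding hadj_left_inverse[OF assms(1)] hadj_right_inverse[OF assms(1)] one_mult_mat_vec[OF assms(2)]
  by simp_all

lemma herm_invariant:
  assumes "g \<in> SU_n1 n" "x \<in> carrier_vec (Suc n)" "y \<in> carrier_vec (Suc n)"
  shows "herm n (g *\<^sub>v x) (g *\<^sub>v y) = herm n x y"
  using assms by (simp add: herm_hadj SU_n1_carrier hadj_vec_inverse)

lemma det_adj:
  assumes "A \<in> carrier_mat k k"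
  shows "det (adj A) = cnj (det A)"
proof -
  interpret comm_ring_hom cnj by unfold_locales auto
  have "adj A = transpose_mat (map_mat cnj A)"
    using assms by (intro eq_matI) (auto simp: adj_def)
  then show ?thesis using assms det_transpose[of "map_mat cnj A" k] by simp
qed

lemma det_Ipq_nonzero: "det (Ipq n :: complex mat) \<noteq> 0"
proof -
  have "(Ipq n :: complex mat) * Ipq n = 1\<^sub>m (Suc n)"
  proof (rule eq_matI)
    fix i j assume "i < dim_row (1\<^sub>m (Suc n) :: complex mat)" "j < dim_col (1\<^sub>m (Suc n) :: complex mat)"
    then have ij: "i \<le> n" "j \<le> n" by auto
    have "((Ipq n :: complex mat) * Ipq n) $$ (i,j) = (\<Sum>k\<le>n. if k = i then (if i = j then 1 else 0) else 0)"
      unfolding mat_mult_index[OF Ipq_carrier Ipq_carrier ij]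
      using ij by (intro sum.cong[OF refl]) (auto simp: Ipq_def)
    then show "((Ipq n :: complex mat) * Ipq n) $$ (i,j) = 1\<^sub>m (Suc n) $$ (i,j)"
      using ij by simp
  qed (auto simp: Ipq_def)
  then have "det (Ipq n :: complex mat) * det (Ipq n) = 1"
    using det_mult[OF Ipq_carrier Ipq_carrier, of n, where 'a = complex] by (metis det_one)
  then show ?thesis by auto
qed

text \<open>Determinants of the invariance equation cancel det I_{n,1} and leave |det B|^2 = 1. This
  serves matrices of orthonormal vectors, whose determinant is known only up to its phase.\<close>

lemma Ipq_preserving_det:
  assumes B: "B \<in> carrier_mat (Suc n) (Suc n)" "adj B * Ipq n * B = Ipq n"
  shows "cmod (det B) = 1"
proof -
  have a: "adj B \<in> carrier_mat (Suc n) (Suc n)" using B(1) by (auto simp: adj_def)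
  have "det (adj B * Ipq n * B) = det (adj B) * det (Ipq n) * det B"
    using det_mult[OF mult_carrier_mat[OF a Ipq_carrier] B(1)] det_mult[OF a Ipq_carrier] by simp
  then have "cnj (det B) * det B = 1"
    using B det_adj[OF B(1)] det_Ipq_nonzero[of n] by simp
  then have "(cmod (det B))\<^sup>2 = 1"
    by (metis complex_norm_square mult.commute of_real_eq_1_iff)
  then show ?thesis by (simp add: power2_eq_1_iff) (smt (verit) norm_ge_zero)
qed

lemma hadj_SU_n1:
  assumes "g \<in> SU_n1 n"
  shows "hadj n g \<in> SU_n1 n"
proof -
  have g: "g \<in> carrier_mat (Suc n) (Suc n)" "det g = 1" using assms by (auto simp: SU_n1_def)
  have "det (hadj n g) * det g = 1"
    using hadj_left_inverse[OF assms] det_mult[OF hadj_carrier g(1), of g] by simp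
  then have "det (hadj n g) = 1" using g by simp
  moreover have "hadj n (hadj n g) * hadj n g = 1\<^sub>m (Suc n)"
    using hadj_right_inverse[OF assms] by (simp only: hadj_hadj[OF g(1)])
  ultimately show ?thesis
    unfolding SU_n1_def using adj_Ipq_iff[OF hadj_carrier] by simp
qed

text \<open>\<open>is_subgroup_of\<close> supplies only some right inverse in \<open>G\<close>.
  Multiplying by \<open>hadj n g\<close> on the left identifies it with \<open>hadj n g\<close>, so
  closure under inverses becomes closure under an explicit formula.\<close>

lemma subgroup_facts:
  assumes "is_subgroup_of G n"
  shows "\<And>g. g \<in> G \<Longrightarrow> g \<in> SU_n1 n" "\<And>g h. g \<in> G \<Longrightarrow> h \<in> G \<Longrightarrow> g * h \<in> G"
    "\<And>g. g \<in> G \<Longrightarrow> hadj n g \<in> G" "1\<^sub>m (Suc n) \<in> G"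
proof -
  show 1: "g \<in> SU_n1 n" if "g \<in> G" for g using assms that by (auto simp: is_subgroup_of_def)
  show "g * h \<in> G" if "g \<in> G" "h \<in> G" for g h using assms that by (auto simp: is_subgroup_of_def)
  show "1\<^sub>m (Suc n) \<in> G" using assms by (auto simp: is_subgroup_of_def)
  show "hadj n g \<in> G" if g: "g \<in> G" for g
  proof -
    obtain h where h: "h \<in> G" "g * h = 1\<^sub>m (Suc n)"
      using assms g by (auto simp: is_subgroup_of_def)
    have "hadj n g = hadj n g * (g * h)" unfolding h(2) by (metis hadj_carrier right_mult_one_mat)
    also have "\<dots> = hadj n g * g * h"
      by (rule assoc_mult_mat[symmetric, OF hadj_carrier SU_n1_carrier[OF 1[OF g]] SU_n1_carrier[OF 1[OF h(1)]]])
    also have "\<dots> = h"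
      unfolding hadj_left_inverse[OF 1[OF g]] using SU_n1_carrier[OF 1[OF h(1)]] by simp
    finally show ?thesis using h by simp
  qed
qed

section \<open>Cauchy-Schwarz estimates and null vectors\<close>

lemma Cauchy_Schwarz_complex_sum:
  fixes f g :: "nat \<Rightarrow> complex"
  shows "cmod (\<Sum>i<m. f i * cnj (g i)) \<le> sqrt (\<Sum>i<m. (cmod (f i))\<^sup>2) * sqrt (\<Sum>i<m. (cmod (g i))\<^sup>2)"
proof -
  have "cmod (\<Sum>i<m. f i * cnj (g i)) \<le> (\<Sum>i<m. cmod (f i) * cmod (g i))"
    by (rule order_trans[OF norm_sum]) (simp add: norm_mult)
  also have "\<dots> \<le> sqrt (\<Sum>i<m. (cmod (f i))\<^sup>2) * sqrt (\<Sum>i<m. (cmod (g i))\<^sup>2)"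
    using L2_set_mult_ineq[of "\<lambda>i. cmod (f i)" "\<lambda>i. cmod (g i)" "{..<m}"] by (simp add: L2_set_def)
  finally show ?thesis .
qed

text \<open>Let a, b be the moduli of the last coordinates and A, B the Euclidean norms of the
  others. Since A is at most a, ordinary Cauchy-Schwarz gives a (b - B) \<le> |\<langle>x,
  z\<rangle>|, and s = (b - B) (b + B) is at most 2 b (b - B). The estimate is used in this form to
  bound last coordinates of moving vectors by pairings that stay bounded.\<close>

lemma reverse_Cauchy_Schwarz:
  assumes x: "Re (herm n x x) \<le> 0" and z: "Re (herm n z z) = - s" and s: "s > 0"
  shows "cmod (x $ n) * s \<le> 2 * cmod (z $ n) * cmod (herm n x z)"
proof -
  define a b where "a = cmod (x $ n)" and "b = cmod (z $ n)"
  define A B where "A = sqrt (\<Sum>i<n. (cmod (x $ i))\<^sup>2)" and "B = sqrt (\<Sum>i<n. (cmod (z $ i))\<^sup>2)"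
  have nn: "a \<ge> 0" "b \<ge> 0" "A \<ge> 0" "B \<ge> 0" by (auto simp: a_def b_def A_def B_def intro!: sum_nonneg)
  have A2: "A\<^sup>2 = (\<Sum>i<n. (cmod (x $ i))\<^sup>2)" and B2: "B\<^sup>2 = (\<Sum>i<n. (cmod (z $ i))\<^sup>2)"
    by (auto simp: A_def B_def intro!: real_sqrt_pow2 sum_nonneg)
  have "A\<^sup>2 \<le> a\<^sup>2" using x A2 by (simp add: herm_self a_def)
  then have Aa: "A \<le> a" using nn by (simp add: power2_le_iff_abs_le)
  have sB: "b\<^sup>2 - B\<^sup>2 = s" using z B2 by (simp add: herm_self b_def)
  then have "B\<^sup>2 < b\<^sup>2" using s by simp
  then have Bb: "B < b" using nn by (simp add: power_less_imp_less_base)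
  have "a * b = cmod (x $ n * cnj (z $ n))" by (simp add: a_def b_def norm_mult)
  also have "\<dots> \<le> cmod (\<Sum>i<n. x $ i * cnj (z $ i)) + cmod (herm n x z)"
    using norm_triangle_ineq4[of "\<Sum>i<n. x $ i * cnj (z $ i)" "herm n x z"] by (simp add: herm_split)
  also have "cmod (\<Sum>i<n. x $ i * cnj (z $ i)) \<le> A * B"
    unfolding A_def B_def by (rule Cauchy_Schwarz_complex_sum)
  finally have "a * b \<le> A * B + cmod (herm n x z)" by simp
  moreover have "A * B \<le> a * B" using Aa nn by (simp add: mult_right_mono)
  ultimately have 1: "a * (b - B) \<le> cmod (herm n x z)" by (simp add: algebra_simps)
  have "a * s = a * (b - B) * (b + B)" using sB by (simp add: power2_eq_square algebra_simps)
  also have "\<dots> \<le> a * (b - B) * (2 * b)" using Bb nn by (intro mult_left_mono mult_nonneg_nonneg) auto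
  also have "\<dots> \<le> cmod (herm n x z) * (2 * b)" using 1 nn by (intro mult_right_mono) auto
  finally show ?thesis by (simp add: a_def b_def mult_ac)
qed

lemma herm_last_zero:
  assumes x: "x \<in> carrier_vec (Suc n)" and "x $ n = 0" "Re (herm n x x) \<le> 0"
  shows "x = 0\<^sub>v (Suc n)"
proof -
  have "(\<Sum>i<n. (cmod (x $ i))\<^sup>2) \<le> 0" using assms by (simp add: herm_self)
  then have "(\<Sum>i<n. (cmod (x $ i))\<^sup>2) = 0" by (simp add: antisym sum_nonneg)
  then have "\<forall>i\<in>{..<n}. (cmod (x $ i))\<^sup>2 = 0" by (subst (asm) sum_nonneg_eq_0_iff) auto
  then have "x $ i = 0" if "i < Suc n" for i using that assms(2) by (cases "i = n") auto
  then show ?thesis using x by (intro eq_vecI) auto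
qed

text \<open>With \<langle>x, z\<rangle> = 0 the preceding estimate forces the last coordinate of x
  to vanish, and on the hyperplane where it vanishes the form is Euclidean.\<close>

lemma orth_negative_positive:
  assumes x: "x \<in> carrier_vec (Suc n)" and z: "Re (herm n z z) < 0" and "herm n x z = 0" "Re (herm n x x) \<le> 0"
  shows "x = 0\<^sub>v (Suc n)"
proof -
  have "cmod (x $ n) * (- Re (herm n z z)) \<le> 0"
    using reverse_Cauchy_Schwarz[OF assms(4), of z "- Re (herm n z z)"] assms by simp
  then have "cmod (x $ n) \<le> 0" using z by (subst (asm) mult_le_0_iff) auto
  then show ?thesis using herm_last_zero[OF x _ assms(4)] by simp
qed

text \<open>The difference of the two sides is null, because x and y span a totally isotropic space,
  and its last coordinate cancels; hence it is zero. The statement avoids division so that it also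
  covers zero vectors, which can occur among the columns of a limit matrix.\<close>

lemma null_orth_proportional:
  assumes x: "x \<in> carrier_vec (Suc n)" "herm n x x = 0" and y: "y \<in> carrier_vec (Suc n)" "herm n y y = 0"
    and xy: "herm n x y = 0"
  shows "y $ n \<cdot>\<^sub>v x = x $ n \<cdot>\<^sub>v y"
proof -
  let ?v = "y $ n \<cdot>\<^sub>v x - x $ n \<cdot>\<^sub>v y"
  have yx: "herm n y x = 0" using xy by (metis herm_cnj complex_cnj_zero)
  have "herm n ?v ?v = 0"
    using x y xy yx by (simp add: herm_lin)
  moreover have "?v $ n = 0" using x y by simp
  ultimately have v0: "?v = 0\<^sub>v (Suc n)" using x y by (intro herm_last_zero) auto
  show ?thesis
  proof (rule eq_vecI)
    fix i assume "i < dim_vec (x $ n \<cdot>\<^sub>v y)"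
    then have "?v $ i = 0" "i < Suc n" using v0 y by auto
    then show "(y $ n \<cdot>\<^sub>v x) $ i = (x $ n \<cdot>\<^sub>v y) $ i" using x y by simp
  qed (use x y in auto)
qed

lemma null_last_nonzero:
  assumes "x \<in> carrier_vec (Suc n)" "herm n x x = 0" "x \<noteq> 0\<^sub>v (Suc n)"
  shows "x $ n \<noteq> 0"
  using herm_last_zero[OF assms(1)] assms by auto

lemma null_orth_multiple:
  assumes x: "x \<in> carrier_vec (Suc n)" "herm n x x = 0"
    and y: "y \<in> carrier_vec (Suc n)" "herm n y y = 0" "y \<noteq> 0\<^sub>v (Suc n)"
    and xy: "herm n x y = 0"
  shows "\<exists>c. x = c \<cdot>\<^sub>v y"
proof -
  have "inverse (y $ n) \<cdot>\<^sub>v (y $ n \<cdot>\<^sub>v x) = inverse (y $ n) \<cdot>\<^sub>v (x $ n \<cdot>\<^sub>v y)"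
    using null_orth_proportional[OF x y(1,2) xy] by simp
  then have "x = (inverse (y $ n) * x $ n) \<cdot>\<^sub>v y"
    using null_last_nonzero[OF y] by (simp add: smult_smult_assoc)
  then show ?thesis by blast
qed

section \<open>Control of a matrix by its corner entry\<close>

lemma mat_unit_vec_index:
  fixes g :: "complex mat"
  assumes "g \<in> carrier_mat (Suc n) (Suc n)" "i \<le> n" "j \<le> n"
  shows "(g *\<^sub>v unit_vec (Suc n) j) $ i = g $$ (i,j)"
proof -
  have "(g *\<^sub>v unit_vec (Suc n) j) $ i = (\<Sum>k\<le>n. if k = j then g $$ (i,k) else 0)"
    unfolding mat_vec_index[OF assms(1) unit_vec_carrier assms(2)]
    using assms(3) by (intro sum.cong) (auto simp: unit_vec_def)
  then show ?thesis using assms(3) by simp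
qed

lemma herm_unit_unit: "i \<le> n \<Longrightarrow> j \<le> n \<Longrightarrow>
    herm n (unit_vec (Suc n) i) (unit_vec (Suc n) j) = (if i = j then sg n i else 0)"
  by (auto simp: herm_unit)

lemma SU_n1_column:
  assumes g: "g \<in> SU_n1 n" and j: "j \<le> n"
  shows "(\<Sum>i<n. (cmod (g $$ (i,j)))\<^sup>2) = (cmod (g $$ (n,j)))\<^sup>2 + (if j = n then -1 else 1)"
proof -
  have "complex_of_real ((\<Sum>i<n. (cmod (g $$ (i,j)))\<^sup>2) - (cmod (g $$ (n,j)))\<^sup>2) = sg n j"
    using herm_invariant[OF g unit_vec_carrier unit_vec_carrier, of j j] herm_unit_unit[OF j j]
      mat_unit_vec_index[OF SU_n1_carrier[OF g] _ j]
    unfolding herm_self[of _ "g *\<^sub>v unit_vec (Suc n) j"] by simp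
  also have "sg n j = complex_of_real (if j = n then -1 else 1)" by (simp add: sg_def)
  finally show ?thesis unfolding of_real_eq_iff by linarith
qed

text \<open>The norm of each column bounds its entries by its bottom entry; the same bound for the
  inverse, whose entries have the moduli of the transposed ones, bounds the bottom row by the
  corner. A set of group elements is thus bounded as soon as |g(n,n)| is.\<close>

lemma SU_n1_entry_bound:
  assumes g: "g \<in> SU_n1 n" and i: "i \<le> n" and j: "j \<le> n"
  shows "cmod (g $$ (i,j)) \<le> 1 + cmod (g $$ (n,n))"
proof -
  have col: "(cmod (h $$ (k,l)))\<^sup>2 \<le> (cmod (h $$ (n,l)))\<^sup>2 + (if l = n then -1 else 1)"
    if "h \<in> SU_n1 n" "k < n" "l \<le> n" for h k l
    unfolding SU_n1_column[OF that(1,3), symmetric] using that(2) by (intro member_le_sum) auto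
  have cl: "cmod (hadj n g $$ (k,l)) = cmod (g $$ (l,k))" if "k \<le> n" "l \<le> n" for k l
    using that by (simp add: hadj_def norm_mult)
  have row: "(cmod (g $$ (n,l)))\<^sup>2 \<le> (cmod (g $$ (n,n)))\<^sup>2" if "l \<le> n" for l
    using col[OF hadj_SU_n1[OF g], of l n] cl[of l n] cl[of n n] that
    by (cases "l = n") (auto simp del: abs_le_square_iff power2_le_iff_abs_le power_mono_iff)
  have "(cmod (g $$ (i,j)))\<^sup>2 \<le> (cmod (g $$ (n,n)))\<^sup>2 + 1"
  proof (cases "i = n")
    case True then show ?thesis using row[OF j] by (simp only: add_increasing2)
  next
    case False
    then have "(cmod (g $$ (i,j)))\<^sup>2 \<le> (cmod (g $$ (n,j)))\<^sup>2 + 1"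
      using col[OF g _ j, of i] i by (auto split: if_splits)
    then show ?thesis using row[OF j] by linarith
  qed
  also have "\<dots> \<le> (1 + cmod (g $$ (n,n)))\<^sup>2" by (simp add: power2_eq_square algebra_simps)
  finally show ?thesis by (simp add: power2_le_iff_abs_le)
qed

section \<open>Convergent subsequences of bounded families\<close>

lemma Bseq_convergent_subseq_real:
  fixes f :: "nat \<Rightarrow> real"
  assumes "Bseq f"
  shows "\<exists>r. strict_mono r \<and> convergent (\<lambda>k. f (r k))"
proof -
  obtain r where r: "strict_mono r" "monoseq (\<lambda>k. f (r k))" using seq_monosub by auto
  have "Bseq (\<lambda>k. f (r k))" using assms by (rule Bseq_subseq)
  then show ?thesis using r Bseq_monoseq_convergent by blast
qed

lemma convergent_subseq:
  "convergent f \<Longrightarrow> strict_mono r \<Longrightarrow> convergent (\<lambda>k. f (r k))"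
  using convergent_subseq_convergent[of f r] by (simp add: o_def)

lemma Bseq_convergent_subseq_complex:
  fixes f :: "nat \<Rightarrow> complex"
  assumes "Bseq f"
  shows "\<exists>r. strict_mono r \<and> convergent (\<lambda>k. f (r k))"
proof -
  from assms obtain K where K: "\<And>k. cmod (f k) \<le> K" by (auto simp: Bseq_def)
  have "Bseq (\<lambda>k. Re (f k))"
    by (rule BseqI'[of _ K]) (use K in \<open>auto intro: order_trans[OF abs_Re_le_cmod]\<close>)
  then obtain r where r: "strict_mono r" "convergent (\<lambda>k. Re (f (r k)))"
    using Bseq_convergent_subseq_real by blast
  have "Bseq (\<lambda>k. Im (f (r k)))"
    by (rule BseqI'[of _ K]) (use K in \<open>auto intro: order_trans[OF abs_Im_le_cmod]\<close>)
  then obtain s where s: "strict_mono s" "convergent (\<lambda>k. Im (f (r (s k))))"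
    using Bseq_convergent_subseq_real by blast
  have "convergent (\<lambda>k. Re (f (r (s k))))" using convergent_subseq[OF r(2) s(1)] .
  then obtain a b where "(\<lambda>k. Re (f (r (s k)))) \<longlonglongrightarrow> a" "(\<lambda>k. Im (f (r (s k)))) \<longlonglongrightarrow> b"
    using s(2) by (auto simp: convergent_def)
  from tendsto_Complex[OF this] have "convergent (\<lambda>k. f (r (s k)))" by (auto simp: convergent_def)
  moreover have "strict_mono (\<lambda>k. r (s k))" using r(1) s(1) by (simp add: strict_mono_def)
  ultimately show ?thesis by blast
qed

lemma finite_family_convergent_subseq:
  fixes f :: "nat \<Rightarrow> 'i \<Rightarrow> complex"
  assumes "finite I" "\<And>i. i \<in> I \<Longrightarrow> Bseq (\<lambda>k. f k i)"
  shows "\<exists>r. strict_mono r \<and> (\<forall>i\<in>I. convergent (\<lambda>k. f (r k) i))"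
  using assms
proof (induction I rule: finite_induct)
  case empty
  have "strict_mono (\<lambda>k::nat. k)" by (simp add: strict_mono_def)
  then show ?case by blast
next
  case (insert j I)
  then obtain r where r: "strict_mono r" "\<forall>i\<in>I. convergent (\<lambda>k. f (r k) i)" by auto
  have "Bseq (\<lambda>k. f (r k) j)" by (rule Bseq_subseq[of "\<lambda>k. f k j"]) (simp add: insert.prems)
  then obtain s where s: "strict_mono s" "convergent (\<lambda>k. f (r (s k)) j)"
    using Bseq_convergent_subseq_complex by blast
  have "\<forall>i\<in>insert j I. convergent (\<lambda>k. f (r (s k)) i)"
  proof
    fix i assume "i \<in> insert j I"
    then consider "i = j" | "i \<in> I" by blast
    then show "convergent (\<lambda>k. f (r (s k)) i)"
    proof cases
      case 1 then show ?thesis using s(2) by (simp only:)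
    next
      case 2
      then have "convergent (\<lambda>k. f (r k) i)" using r(2) by blast
      then show ?thesis by (rule convergent_subseq[OF _ s(1)])
    qed
  qed
  moreover have "strict_mono (\<lambda>k. r (s k))" using r(1) s(1) by (simp add: strict_mono_def)
  ultimately show ?case by (intro exI[of _ "\<lambda>k. r (s k)"] conjI)
qed

section \<open>Limit points and discreteness\<close>

text \<open>Homogeneous coordinates normalised to last coordinate 1, the vector to which
  \<open>act\<close> applies the matrix. Points of the unit sphere lift to null vectors.\<close>

definition affine_lift :: "nat \<Rightarrow> complex vec \<Rightarrow> complex vec" where
  "affine_lift n w = vec (Suc n) (\<lambda>i. if i < n then w $ i else 1)"

lemma affine_lift_carrier [simp]: "affine_lift n w \<in> carrier_vec (Suc n)"
  by (simp add: affine_lift_def)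

lemma affine_lift_last: "affine_lift n w $ n = 1"
  by (simp add: affine_lift_def)

lemma affine_lift_inj:
  assumes "v \<in> carrier_vec n" "w \<in> carrier_vec n" "affine_lift n v = affine_lift n w"
  shows "v = w"
proof (rule eq_vecI)
  fix i assume "i < dim_vec w"
  then have i: "i < n" using assms by simp
  have "affine_lift n v $ i = affine_lift n w $ i" using assms by simp
  then show "v $ i = w $ i" using i by (simp add: affine_lift_def)
qed (use assms in auto)

lemma SU_n1_last_entry:
  assumes g: "g \<in> SU_n1 n"
  shows "1 \<le> cmod (g $$ (n,n))" "g $$ (n,n) \<noteq> 0"
proof -
  have "0 \<le> (\<Sum>i<n. (cmod (g $$ (i,n)))\<^sup>2)" by (intro sum_nonneg) auto
  then have "1 \<le> (cmod (g $$ (n,n)))\<^sup>2" using SU_n1_column[OF g, of n] by simp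
  then show "1 \<le> cmod (g $$ (n,n))" by (metis abs_norm_cancel abs_square_le_1 linorder_le_cases one_power2 power_mono_iff norm_ge_zero pos2 zero_le_one)
  then show "g $$ (n,n) \<noteq> 0" by auto
qed

text \<open>The image of the origin under g has squared norm 1 - 1/|g(n,n)|^2, by the norm of the
  last column. Converging to a point of the unit sphere therefore forces |g(n,n)| to
  infinity.\<close>

lemma limit_point_sequence:
  assumes G: "\<And>g. g \<in> G \<Longrightarrow> g \<in> SU_n1 n" and xi: "\<xi> \<in> limit_set n G"
  obtains g where "\<And>k. g k \<in> G"
    "\<And>i. i \<le> n \<Longrightarrow> (\<lambda>k. g k $$ (i,n) / g k $$ (n,n)) \<longlonglongrightarrow> affine_lift n \<xi> $ i"
    "(\<lambda>k. inverse ((cmod (g k $$ (n,n)))\<^sup>2)) \<longlonglongrightarrow> 0"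
proof -
  obtain g where gG: "\<And>k. g k \<in> G"
    and lim: "\<And>i. i < n \<Longrightarrow> (\<lambda>k. act (g k) (0\<^sub>v n) $ i) \<longlonglongrightarrow> \<xi> $ i"
    using xi by (auto simp: limit_set_def)
  have xi': "\<xi> \<in> carrier_vec n" "vnorm2 \<xi> = 1" using xi by (auto simp: limit_set_def)
  have gS: "g k \<in> SU_n1 n" for k using gG G by blast
  note gc = SU_n1_carrier[OF gS]
  have base: "vec (n+1) (\<lambda>i. if i < n then 0\<^sub>v n $ i else 1) = (unit_vec (Suc n) n :: complex vec)"
    by (rule eq_vecI) (auto simp: unit_vec_def)
  have act: "act (g k) (0\<^sub>v n) $ i = g k $$ (i,n) / g k $$ (n,n)" if "i < n" for k i
    using that mat_unit_vec_index[OF gc, of i n] mat_unit_vec_index[OF gc, of n n]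
    by (simp add: act_def Let_def base[simplified])
  have lim': "(\<lambda>k. g k $$ (i,n) / g k $$ (n,n)) \<longlonglongrightarrow> affine_lift n \<xi> $ i" if "i \<le> n" for i
  proof (cases "i = n")
    case True
    then show ?thesis using SU_n1_last_entry(2)[OF gS] by (simp add: affine_lift_last)
  next
    case False
    then show ?thesis using that lim[of i] act[of i] by (simp add: affine_lift_def)
  qed
  have "(\<lambda>k. \<Sum>i<n. (cmod (g k $$ (i,n) / g k $$ (n,n)))\<^sup>2) \<longlonglongrightarrow> (\<Sum>i<n. (cmod (affine_lift n \<xi> $ i))\<^sup>2)"
    by (intro tendsto_intros lim') auto
  also have "(\<Sum>i<n. (cmod (affine_lift n \<xi> $ i))\<^sup>2) = 1"
    using xi' by (simp add: vnorm2_def affine_lift_def)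
  also have "(\<lambda>k. \<Sum>i<n. (cmod (g k $$ (i,n) / g k $$ (n,n)))\<^sup>2) = (\<lambda>k. 1 - inverse ((cmod (g k $$ (n,n)))\<^sup>2))"
  proof
    fix k
    have "(\<Sum>i<n. (cmod (g k $$ (i,n) / g k $$ (n,n)))\<^sup>2) = ((cmod (g k $$ (n,n)))\<^sup>2 - 1) / (cmod (g k $$ (n,n)))\<^sup>2"
      using SU_n1_column[OF gS, of n k] by (simp add: norm_divide power_divide sum_divide_distrib[symmetric])
    then show "(\<Sum>i<n. (cmod (g k $$ (i,n) / g k $$ (n,n)))\<^sup>2) = 1 - inverse ((cmod (g k $$ (n,n)))\<^sup>2)"
      using SU_n1_last_entry(2)[OF gS, of k] by (simp add: field_simps)
  qed
  finally have "(\<lambda>k. 1 - (1 - inverse ((cmod (g k $$ (n,n)))\<^sup>2))) \<longlonglongrightarrow> 1 - 1"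
    by (intro tendsto_diff tendsto_const)
  then have "(\<lambda>k. inverse ((cmod (g k $$ (n,n)))\<^sup>2)) \<longlonglongrightarrow> 0" by simp
  with gG lim' show ?thesis by (rule that)
qed

lemma affine_lift_null:
  assumes "\<xi> \<in> limit_set n G"
  shows "herm n (affine_lift n \<xi>) (affine_lift n \<xi>) = 0"
proof -
  have "(\<Sum>i<n. (cmod (affine_lift n \<xi> $ i))\<^sup>2) - (cmod (affine_lift n \<xi> $ n))\<^sup>2 = 0"
    using assms by (auto simp: affine_lift_def limit_set_def vnorm2_def)
  then show ?thesis unfolding herm_self by (simp only: of_real_0)
qed

lemma tendsto_herm_left:
  assumes "\<And>i. i \<le> n \<Longrightarrow> (\<lambda>k. x k $ i) \<longlonglongrightarrow> y $ i"
  shows "(\<lambda>k. herm n (x k) z) \<longlonglongrightarrow> herm n y z"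
  unfolding herm_def by (intro tendsto_intros assms) auto

text \<open>Along a sequence tending to a limit point the bounded product is divided by |g(n,n)|^2,
  so the lift of the limit point is orthogonal to p or to q, and being null it lies on one of these
  two lines. That leaves at most two limit points. The case p = q is allowed and is used for a group
  with a single fixed line.\<close>

lemma elementary_by_two_null_lines:
  assumes G: "\<And>g. g \<in> G \<Longrightarrow> g \<in> SU_n1 n" and ne: "nonelementary n G"
    and p: "p \<in> carrier_vec (Suc n)" "herm n p p = 0" "p \<noteq> 0\<^sub>v (Suc n)"
    and q: "q \<in> carrier_vec (Suc n)" "herm n q q = 0" "q \<noteq> 0\<^sub>v (Suc n)"
    and bound: "\<And>g. g \<in> G \<Longrightarrow> cmod (herm n (g *\<^sub>v unit_vec (Suc n) n) p) * cmod (herm n (g *\<^sub>v unit_vec (Suc n) n) q) \<le> C"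
  shows False
proof -
  have scale: "affine_lift n \<xi> = inverse (r $ n) \<cdot>\<^sub>v r"
    if xi: "\<xi> \<in> limit_set n G" and r: "r \<in> carrier_vec (Suc n)" "herm n r r = 0" "r \<noteq> 0\<^sub>v (Suc n)"
      and orth: "herm n (affine_lift n \<xi>) r = 0" for \<xi> r
  proof -
    have "inverse (r $ n) \<cdot>\<^sub>v (r $ n \<cdot>\<^sub>v affine_lift n \<xi>) = inverse (r $ n) \<cdot>\<^sub>v r"
      using null_orth_proportional[OF affine_lift_carrier affine_lift_null[OF xi] r(1,2) orth]
      by (simp add: affine_lift_last)
    then show ?thesis using null_last_nonzero[OF r] by (simp add: smult_smult_assoc)
  qed
  have key: "affine_lift n \<xi> = inverse (p $ n) \<cdot>\<^sub>v p \<or> affine_lift n \<xi> = inverse (q $ n) \<cdot>\<^sub>v q"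
    if xi: "\<xi> \<in> limit_set n G" for \<xi>
  proof -
    obtain g where g: "\<And>k. g k \<in> G"
      "\<And>i. i \<le> n \<Longrightarrow> (\<lambda>k. g k $$ (i,n) / g k $$ (n,n)) \<longlonglongrightarrow> affine_lift n \<xi> $ i"
      "(\<lambda>k. inverse ((cmod (g k $$ (n,n)))\<^sup>2)) \<longlonglongrightarrow> 0"
      using limit_point_sequence[OF G xi] by blast
    define e where "e = (unit_vec (Suc n) n :: complex vec)"
    \<comment> \<open>The lift of the image of the origin under g_k. It converges to the lift of
      \<xi>, while every pairing with it carries a factor of size 1/|g_k(n,n)|.\<close>
    define x where "x k = inverse (g k $$ (n,n)) \<cdot>\<^sub>v (g k *\<^sub>v e)" for k
    have gS: "g k \<in> SU_n1 n" for k using g(1) G by blast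
    have xi_lim: "(\<lambda>k. x k $ i) \<longlonglongrightarrow> affine_lift n \<xi> $ i" if "i \<le> n" for i
    proof -
      have "x k $ i = g k $$ (i,n) / g k $$ (n,n)" for k
        using mat_unit_vec_index[OF SU_n1_carrier[OF gS] that, of n k] that SU_n1_carrier[OF gS[of k]]
        by (simp add: x_def e_def divide_inverse)
      then show ?thesis using g(2)[OF that] by simp
    qed
    have hx: "herm n (x k) r = inverse (g k $$ (n,n)) * herm n (g k *\<^sub>v e) r" for k r
      unfolding x_def by (rule herm_smult_left) (simp add: e_def gS)
    have "(\<lambda>k. cmod (herm n (x k) p) * cmod (herm n (x k) q)) \<longlonglongrightarrow> cmod (herm n (affine_lift n \<xi>) p) * cmod (herm n (affine_lift n \<xi>) q)"
      by (intro tendsto_intros tendsto_herm_left xi_lim)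
    moreover have "(\<lambda>k. cmod (herm n (x k) p) * cmod (herm n (x k) q)) \<longlonglongrightarrow> 0"
    proof (rule tendsto_sandwich[of "\<lambda>_. 0"])
      show "(\<lambda>k. C * inverse ((cmod (g k $$ (n,n)))\<^sup>2)) \<longlonglongrightarrow> 0"
        using tendsto_mult[OF tendsto_const[of C] g(3)] by simp
      have "cmod (herm n (x k) p) * cmod (herm n (x k) q)
          = (cmod (herm n (g k *\<^sub>v e) p) * cmod (herm n (g k *\<^sub>v e) q)) * inverse ((cmod (g k $$ (n,n)))\<^sup>2)" for k
        by (simp add: hx norm_mult norm_inverse power2_eq_square)
      also have "\<dots> k \<le> C * inverse ((cmod (g k $$ (n,n)))\<^sup>2)" for k
        using bound[OF g(1)] unfolding e_def by (intro mult_right_mono) auto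
      finally show "\<forall>\<^sub>F k in sequentially. cmod (herm n (x k) p) * cmod (herm n (x k) q) \<le> C * inverse ((cmod (g k $$ (n,n)))\<^sup>2)"
        by simp
    qed auto
    ultimately have "cmod (herm n (affine_lift n \<xi>) p) * cmod (herm n (affine_lift n \<xi>) q) = 0"
      by (rule LIMSEQ_unique)
    then consider "herm n (affine_lift n \<xi>) p = 0" | "herm n (affine_lift n \<xi>) q = 0" by auto
    then show ?thesis using scale[OF xi p] scale[OF xi q] by cases auto
  qed
  obtain a b c where abc: "a \<in> limit_set n G" "b \<in> limit_set n G" "c \<in> limit_set n G" "a \<noteq> b" "a \<noteq> c" "b \<noteq> c"
    using ne by (auto simp: nonelementary_def)
  then have "a \<in> carrier_vec n" "b \<in> carrier_vec n" "c \<in> carrier_vec n" by (auto simp: limit_set_def)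
  then show False using key[OF abc(1)] key[OF abc(2)] key[OF abc(3)] abc(4-6) affine_lift_inj by metis
qed

lemma nonelementary_unbounded:
  assumes G: "\<And>g. g \<in> G \<Longrightarrow> g \<in> SU_n1 n" and ne: "nonelementary n G"
  obtains g where "\<And>k. g k \<in> G" "(\<lambda>k. inverse ((cmod (g k $$ (n,n)))\<^sup>2)) \<longlonglongrightarrow> 0"
proof -
  obtain \<xi> where "\<xi> \<in> limit_set n G" using ne by (auto simp: nonelementary_def)
  from limit_point_sequence[OF G this] that show ?thesis by blast
qed

section \<open>Discreteness and bounded sequences\<close>

lemma SU_n1_Bseq:
  assumes "\<And>k. g k \<in> SU_n1 n" "\<And>k. cmod (g k $$ (n,n)) \<le> C" "i \<le> n" "j \<le> n"
  shows "Bseq (\<lambda>k. g k $$ (i,j))"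
proof (rule BseqI')
  fix k show "cmod (g k $$ (i,j)) \<le> 1 + C"
    using SU_n1_entry_bound[OF assms(1,3,4), of k] assms(2)[of k] by linarith
qed

text \<open>\<open>discrete_mats\<close> separates elements of \<open>G\<close> from one another and
  says nothing about limits outside \<open>G\<close>. So a convergent subsequence is replaced by its
  consecutive quotients, which lie in \<open>G\<close> and tend to 1; separation at the identity
  alone makes them eventually equal to 1.\<close>

lemma discrete_bounded_sequence:
  assumes sub: "is_subgroup_of G n" and disc: "discrete_mats G"
    and x: "\<And>k. x k \<in> G" and bd: "\<And>k. cmod (x k $$ (n,n)) \<le> C"
  shows "\<exists>j k :: nat. j < k \<and> x j = x k"
proof -
  note G = subgroup_facts[OF sub]
  have xS: "x k \<in> SU_n1 n" for k using x G by blast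
  have "\<exists>r. strict_mono r \<and> (\<forall>i\<in>{..n} \<times> {..n}. convergent (\<lambda>k. x (r k) $$ i))"
    by (rule finite_family_convergent_subseq) (auto intro!: SU_n1_Bseq[OF xS bd])
  then obtain r where r: "strict_mono r" "\<And>i j. i \<le> n \<Longrightarrow> j \<le> n \<Longrightarrow> convergent (\<lambda>k. x (r k) $$ (i,j))" by auto
  define L where "L i j = lim (\<lambda>k. x (r k) $$ (i,j))" for i j
  have L: "(\<lambda>k. x (r k) $$ (i,j)) \<longlonglongrightarrow> L i j" if "i \<le> n" "j \<le> n" for i j
    using r(2)[OF that] by (simp add: L_def convergent_LIMSEQ_iff)
  define y where "y k = hadj n (x (r k)) * x (r (Suc k))" for k
  have prod: "(hadj n g * h) $$ (i,j) = (\<Sum>l\<le>n. sg n i * sg n l * cnj (g $$ (l,i)) * h $$ (l,j))"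
    if "h \<in> SU_n1 n" "i \<le> n" "j \<le> n" for g h i j
    unfolding mat_mult_index[OF hadj_carrier SU_n1_carrier[OF that(1)] that(2,3)]
    using that(2) by (intro sum.cong) (auto simp: hadj_def)
  have lim0: "(\<lambda>k. (hadj n (x (r k)) * x (r k)) $$ (i,j)) \<longlonglongrightarrow> (\<Sum>l\<le>n. sg n i * sg n l * cnj (L l i) * L l j)"
    if "i \<le> n" "j \<le> n" for i j
    unfolding prod[OF xS that] by (intro tendsto_intros L) (use that in auto)
  \<comment> \<open>Passing to the limit in hadj(g) g = 1 shows that the matrix of limits
    \<open>L\<close> is again an isometry, so the consecutive quotients do tend to 1.\<close>
  have one: "(\<Sum>l\<le>n. sg n i * sg n l * cnj (L l i) * L l j) = 1\<^sub>m (Suc n) $$ (i,j)" if "i \<le> n" "j \<le> n" for i j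
    using lim0[OF that] unfolding hadj_left_inverse[OF xS] by (simp add: LIMSEQ_const_iff)
  have lim1: "(\<lambda>k. y k $$ (i,j)) \<longlonglongrightarrow> 1\<^sub>m (Suc n) $$ (i,j)" if "i \<le> n" "j \<le> n" for i j
    unfolding y_def prod[OF xS that] one[OF that, symmetric]
    by (intro tendsto_intros L LIMSEQ_Suc[OF L]) (use that in auto)
  have "(\<lambda>k. \<Sum>i<Suc n. \<Sum>j<Suc n. cmod (1\<^sub>m (Suc n) $$ (i,j) - y k $$ (i,j))) \<longlonglongrightarrow>
      (\<Sum>i<Suc n. \<Sum>j<Suc n. cmod (1\<^sub>m (Suc n) $$ (i,j) - 1\<^sub>m (Suc n) $$ (i,j) :: complex))"
    by (intro tendsto_intros lim1) auto
  then have dist: "(\<lambda>k. mat_dist (1\<^sub>m (Suc n)) (y k)) \<longlonglongrightarrow> 0"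
    by (simp add: mat_dist_def del: sum.lessThan_Suc)
  obtain e where e: "e > 0" "\<And>h. h \<in> G \<Longrightarrow> h \<noteq> 1\<^sub>m (Suc n) \<Longrightarrow> e \<le> mat_dist (1\<^sub>m (Suc n)) h"
    using disc G(4) unfolding discrete_mats_def by metis
  have "\<forall>\<^sub>F k in sequentially. mat_dist (1\<^sub>m (Suc n)) (y k) < e"
    using order_tendstoD(2)[OF dist e(1)] .
  then obtain K where K: "\<And>k. k \<ge> K \<Longrightarrow> mat_dist (1\<^sub>m (Suc n)) (y k) < e"
    by (auto simp: eventually_sequentially)
  have same: "x (r (Suc k)) = x (r k)" if "k \<ge> K" for k
  proof -
    have "y k \<in> G" unfolding y_def by (rule G(2)[OF G(3)[OF x] x])
    then have y1: "y k = 1\<^sub>m (Suc n)" using e(2)[of "y k"] K[OF that] by fastforce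
    have "x (r k) * y k = (x (r k) * hadj n (x (r k))) * x (r (Suc k))"
      unfolding y_def
      by (rule assoc_mult_mat[symmetric, OF SU_n1_carrier[OF xS] hadj_carrier SU_n1_carrier[OF xS]])
    then show ?thesis
      using SU_n1_carrier[OF xS[of "r k"]] SU_n1_carrier[OF xS[of "r (Suc k)"]]
      unfolding hadj_right_inverse[OF xS] y1 by simp
  qed
  have "x (r K) = x (r (Suc K))" by (rule same[OF order_refl, symmetric])
  moreover have "r K < r (Suc K)" using r(1) by (simp add: strict_mono_def)
  ultimately show ?thesis by blast
qed

text \<open>\<open>adj_mat\<close> is the adjugate, not the conjugate transpose, so M maps
  \<open>?x\<close> to \<open>det M\<close> times the last unit vector e. Pairing with p gives det M
  \<langle>e, p\<rangle> = \<langle>M x, p\<rangle> = 0, and \<langle>e, p\<rangle> is nonzero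
  because the last coordinate of p is.\<close>

lemma adjoint_eigenvalue:
  assumes M: "M \<in> carrier_mat (Suc n) (Suc n)" and p: "p \<in> carrier_vec (Suc n)" "p $ n \<noteq> 0"
    and ker: "hadj n M *\<^sub>v p = 0\<^sub>v (Suc n)"
  shows "det M = 0"
proof -
  let ?e = "unit_vec (Suc n) n :: complex vec"
  let ?x = "adj_mat M *\<^sub>v ?e"
  have A: "adj_mat M \<in> carrier_mat (Suc n) (Suc n)" by (rule adj_mat(1)[OF M])
  have xc: "?x \<in> carrier_vec (Suc n)" by (rule mult_mat_vec_carrier[OF A unit_vec_carrier])
  have "M *\<^sub>v ?x = (M * adj_mat M) *\<^sub>v ?e"
    by (rule assoc_mult_mat_vec[symmetric, OF M A unit_vec_carrier])
  also have "\<dots> = det M \<cdot>\<^sub>v ?e"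
  proof (rule eq_vecI)
    fix i assume "i < dim_vec (det M \<cdot>\<^sub>v ?e)"
    then have i: "i \<le> n" by simp
    have "((det M \<cdot>\<^sub>m 1\<^sub>m (Suc n)) *\<^sub>v ?e) $ i = (det M \<cdot>\<^sub>m 1\<^sub>m (Suc n)) $$ (i,n)"
      by (rule mat_unit_vec_index[OF _ i order_refl]) simp
    then show "((M * adj_mat M) *\<^sub>v ?e) $ i = (det M \<cdot>\<^sub>v ?e) $ i"
      unfolding adj_mat(2)[OF M] using i by (simp add: unit_vec_def)
  qed (use M in auto)
  finally have "det M * herm n ?e p = herm n (M *\<^sub>v ?x) p"
    by (simp add: herm_smult_left)
  also have "\<dots> = 0" unfolding herm_hadj[OF M xc p(1)] ker by simp
  finally show ?thesis using p(2) by (simp add: herm_unit)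
qed

text \<open>The inverse of g is its adjoint and has eigenvalue \<open>inverse l\<close> at p, so the
  adjoint of g - inverse (cnj l) kills p and g has \<open>inverse (cnj l)\<close> as an eigenvalue.
  For |l| different from 1 this produces the second fixed line of a loxodromic element.\<close>

lemma dual_eigenvector:
  assumes g: "g \<in> SU_n1 n" and p: "p \<in> carrier_vec (Suc n)" "p $ n \<noteq> 0" and gp: "g *\<^sub>v p = l \<cdot>\<^sub>v p"
    and l: "l \<noteq> 0"
  obtains q where "q \<in> carrier_vec (Suc n)" "q \<noteq> 0\<^sub>v (Suc n)" "g *\<^sub>v q = inverse (cnj l) \<cdot>\<^sub>v q"
proof -
  note gc = SU_n1_carrier[OF g]
  let ?M = "mat (Suc n) (Suc n) (\<lambda>(i,j). g $$ (i,j) - (if i = j then inverse (cnj l) else 0))"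
  have M: "?M \<in> carrier_mat (Suc n) (Suc n)" by simp
  have shift: "(\<Sum>j\<le>n. (a j - (if i = j then c else 0)) * x j) = (\<Sum>j\<le>n. a j * x j) - c * x i"
    if "i \<le> n" for a x and c :: complex and i
  proof -
    have "(\<Sum>j\<le>n. (a j - (if i = j then c else 0)) * x j) = (\<Sum>j\<le>n. a j * x j - (if j = i then c * x i else 0))"
      by (rule sum.cong) (auto simp: algebra_simps)
    then show ?thesis using that by (simp add: sum_subtractf)
  qed
  have "hadj n g *\<^sub>v (g *\<^sub>v p) = l \<cdot>\<^sub>v (hadj n g *\<^sub>v p)"
    unfolding gp by (rule mult_mat_vec[OF hadj_carrier p(1)])
  then have "inverse l \<cdot>\<^sub>v p = inverse l \<cdot>\<^sub>v (l \<cdot>\<^sub>v (hadj n g *\<^sub>v p))"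
    using hadj_vec_inverse[OF g p(1)] by simp
  then have hp: "hadj n g *\<^sub>v p = inverse l \<cdot>\<^sub>v p"
    using l by (simp add: smult_smult_assoc)
  have "hadj n ?M *\<^sub>v p = 0\<^sub>v (Suc n)"
  proof (rule eq_vecI)
    fix i assume "i < dim_vec (0\<^sub>v (Suc n) :: complex vec)"
    then have i: "i \<le> n" by simp
    have "(hadj n ?M *\<^sub>v p) $ i = (\<Sum>j\<le>n. (hadj n g $$ (i,j) - (if i = j then inverse l else 0)) * p $ j)"
      unfolding mat_vec_index[OF hadj_carrier p(1) i]
      using i by (intro sum.cong[OF refl] arg_cong2[of _ _ _ _ "(*)"]) (auto simp: hadj_def algebra_simps)
    also have "\<dots> = 0"
      unfolding shift[OF i] mat_vec_index[OF hadj_carrier p(1) i, symmetric] hp using i p by simp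
    finally show "(hadj n ?M *\<^sub>v p) $ i = 0\<^sub>v (Suc n) $ i" using i by simp
  qed (simp add: hadj_def)
  then have "det ?M = 0" by (rule adjoint_eigenvalue[OF M p])
  then obtain q where q: "q \<in> carrier_vec (Suc n)" "q \<noteq> 0\<^sub>v (Suc n)" "?M *\<^sub>v q = 0\<^sub>v (Suc n)"
    using det_0_iff_vec_prod_zero_field[OF M] by blast
  have "g *\<^sub>v q = inverse (cnj l) \<cdot>\<^sub>v q"
  proof (rule eq_vecI)
    fix i assume "i < dim_vec (inverse (cnj l) \<cdot>\<^sub>v q)"
    then have i: "i \<le> n" using q by simp
    have "(\<Sum>j\<le>n. (g $$ (i,j) - (if i = j then inverse (cnj l) else 0)) * q $ j) = (?M *\<^sub>v q) $ i"
      unfolding mat_vec_index[OF M q(1) i] using i by (intro sum.cong) auto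
    also have "\<dots> = 0" using q(3) i by simp
    finally show "(g *\<^sub>v q) $ i = (inverse (cnj l) \<cdot>\<^sub>v q) $ i"
      unfolding shift[OF i] mat_vec_index[OF gc q(1) i, symmetric] using i q by simp
  qed (use gc q in auto)
  then show ?thesis using that q by blast
qed

text \<open>The inverse of g fixes or exchanges the lines of p and q, and invariance of \<langle>p,
  q\<rangle> forces |a| |b| = 1 for its two multipliers. The product of the two pairings is
  therefore unchanged, which supplies the constant for
  \<open>elementary_by_two_null_lines\<close>.\<close>

lemma herm_product_bound:
  assumes g: "g \<in> SU_n1 n" and p: "p \<in> carrier_vec (Suc n)" and q: "q \<in> carrier_vec (Suc n)"
    and pq: "herm n p q \<noteq> 0" and x: "x \<in> carrier_vec (Suc n)"
    and ev: "hadj n g *\<^sub>v p = a \<cdot>\<^sub>v p \<and> hadj n g *\<^sub>v q = b \<cdot>\<^sub>v q \<or> hadj n g *\<^sub>v p = a \<cdot>\<^sub>v q \<and> hadj n g *\<^sub>v q = b \<cdot>\<^sub>v p"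
  shows "cmod (herm n (g *\<^sub>v x) p) * cmod (herm n (g *\<^sub>v x) q) = cmod (herm n x p) * cmod (herm n x q)"
proof -
  have inv: "herm n (hadj n g *\<^sub>v p) (hadj n g *\<^sub>v q) = herm n p q"
    by (rule herm_invariant[OF hadj_SU_n1[OF g] p q])
  have nqp: "cmod (herm n q p) = cmod (herm n p q)" by (metis herm_cnj complex_mod_cnj)
  have "cmod a * cmod b * cmod (herm n p q) = cmod (herm n p q)"
    using ev
  proof
    assume *: "hadj n g *\<^sub>v p = a \<cdot>\<^sub>v p \<and> hadj n g *\<^sub>v q = b \<cdot>\<^sub>v q"
    have "cnj b * (a * herm n p q) = herm n p q"
      using inv unfolding conjunct1[OF *] conjunct2[OF *]
        herm_smult_left[OF p] herm_smult_right[OF q] .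
    from arg_cong[OF this, of cmod] show ?thesis by (simp add: norm_mult mult_ac)
  next
    assume *: "hadj n g *\<^sub>v p = a \<cdot>\<^sub>v q \<and> hadj n g *\<^sub>v q = b \<cdot>\<^sub>v p"
    have "cnj b * (a * herm n q p) = herm n p q"
      using inv unfolding conjunct1[OF *] conjunct2[OF *]
        herm_smult_left[OF q] herm_smult_right[OF p] .
    from arg_cong[OF this, of cmod] show ?thesis by (simp add: norm_mult mult_ac nqp)
  qed
  then have ab: "cmod a * cmod b = 1" using pq by simp
  have "cmod (herm n (g *\<^sub>v x) p) * cmod (herm n (g *\<^sub>v x) q)
      = (cmod a * cmod b) * (cmod (herm n x p) * cmod (herm n x q))"
    using ev unfolding herm_hadj[OF SU_n1_carrier[OF g] x p] herm_hadj[OF SU_n1_carrier[OF g] x q]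
    by (auto simp: herm_smult_right[OF p] herm_smult_right[OF q] norm_mult)
  then show ?thesis using ab by simp
qed

lemma mult_vec_nonzero:
  assumes g: "g \<in> SU_n1 n" and x: "x \<in> carrier_vec (Suc n)" "x \<noteq> 0\<^sub>v (Suc n)"
  shows "g *\<^sub>v x \<noteq> 0\<^sub>v (Suc n)"
proof
  assume "g *\<^sub>v x = 0\<^sub>v (Suc n)"
  then have "x = hadj n g *\<^sub>v 0\<^sub>v (Suc n)" using hadj_vec_inverse(1)[OF g x(1)] by simp
  also have "\<dots> = 0\<^sub>v (Suc n)" by (rule eq_vecI) (auto simp: hadj_def)
  finally show False using x(2) by simp
qed

lemma mult_vec_smult:
  "g \<in> SU_n1 n \<Longrightarrow> x \<in> carrier_vec (Suc n) \<Longrightarrow> g *\<^sub>v (c \<cdot>\<^sub>v x) = c \<cdot>\<^sub>v (g *\<^sub>v x)"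
  by (rule mult_mat_vec[OF SU_n1_carrier])

lemma mult_vec_add:
  "g \<in> SU_n1 n \<Longrightarrow> x \<in> carrier_vec (Suc n) \<Longrightarrow> y \<in> carrier_vec (Suc n) \<Longrightarrow>
    g *\<^sub>v (x + y) = g *\<^sub>v x + g *\<^sub>v y"
  by (rule mult_add_distrib_mat_vec[OF SU_n1_carrier])

lemma mult_mat_vec_assoc:
  "g \<in> SU_n1 n \<Longrightarrow> h \<in> SU_n1 n \<Longrightarrow> x \<in> carrier_vec (Suc n) \<Longrightarrow> (g * h) *\<^sub>v x = g *\<^sub>v (h *\<^sub>v x)"
  by (rule assoc_mult_mat_vec[OF SU_n1_carrier SU_n1_carrier])

text \<open>The conjugates \<open>g\<^bsup>-k\<^esup> h g\<^sup>k\<close> all scale \<open>p\<close> by the same factor and keep the image of \<open>q\<close>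
  bounded, so they move a negative vector a bounded distance and two of them coincide. Since
  \<open>\<langle>g\<^bsup>-k\<^esup> h g\<^sup>k q, q\<rangle>\<close> is strictly decreasing in modulus unless it is zero, \<open>h q\<close> is orthogonal to \<open>q\<close>.\<close>

lemma discrete_fixes_dual_line:
  assumes sub: "is_subgroup_of G n" and disc: "discrete_mats G"
    and p: "p \<in> carrier_vec (Suc n)" "herm n p p = 0"
    and q: "q \<in> carrier_vec (Suc n)" "herm n q q = 0" "q \<noteq> 0\<^sub>v (Suc n)"
    and pq: "herm n p q \<noteq> 0"
    and g: "g \<in> G" "g *\<^sub>v p = l \<cdot>\<^sub>v p" "g *\<^sub>v q = m \<cdot>\<^sub>v q" "cmod m < 1" "m \<noteq> 0" "m * cnj l = 1"
    and h: "h \<in> G" "h *\<^sub>v p = a \<cdot>\<^sub>v p"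
  shows "\<exists>b. h *\<^sub>v q = b \<cdot>\<^sub>v q"
proof -
  note G = subgroup_facts[OF sub]
  note gS = G(1)[OF g(1)] and gI = hadj_SU_n1[OF G(1)[OF g(1)]]
  define X where "X = rec_nat h (\<lambda>_ M. hadj n g * M * g)"
  have X0: "X 0 = h" and XSuc: "X (Suc k) = hadj n g * X k * g" for k by (simp_all add: X_def)
  have XG: "X k \<in> G" for k
    by (induction k) (simp_all add: X0 XSuc h(1) G(2) G(3) g(1))
  have XS: "X k \<in> SU_n1 n" for k by (rule G(1)[OF XG])
  have app: "X (Suc k) *\<^sub>v x = hadj n g *\<^sub>v (X k *\<^sub>v (g *\<^sub>v x))" if x: "x \<in> carrier_vec (Suc n)" for k x
    unfolding XSuc
    using mult_mat_vec_assoc[OF G(1)[OF G(2)[OF G(3)[OF g(1)] XG]] gS x]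
      mult_mat_vec_assoc[OF gI XS mult_vec_carrier[OF gS x]] by (simp only:)
  have hgp: "l \<cdot>\<^sub>v (hadj n g *\<^sub>v p) = p"
    using hadj_vec_inverse(1)[OF gS p(1)] unfolding g(2) mult_vec_smult[OF gI p(1)] .
  have Xp: "X k *\<^sub>v p = a \<cdot>\<^sub>v p" for k
  proof (induction k)
    case (Suc k)
    have "X (Suc k) *\<^sub>v p = hadj n g *\<^sub>v (l \<cdot>\<^sub>v (a \<cdot>\<^sub>v p))"
      unfolding app[OF p(1)] g(2) mult_vec_smult[OF XS p(1)] Suc ..
    also have "\<dots> = a \<cdot>\<^sub>v (l \<cdot>\<^sub>v (hadj n g *\<^sub>v p))"
      using p(1) by (simp add: mult_vec_smult[OF gI] smult_smult_assoc mult.commute)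
    finally show ?case unfolding hgp .
  qed (simp add: X0 h(2))
  define y where "y k = X k *\<^sub>v q" for k
  have yc: "y k \<in> carrier_vec (Suc n)" for k unfolding y_def using XS q(1) by simp
  have ynull: "herm n (y k) (y k) = 0" for k
    unfolding y_def herm_invariant[OF XS q(1) q(1)] by (rule q(2))
  have ySuc: "y (Suc k) = m \<cdot>\<^sub>v (hadj n g *\<^sub>v y k)" for k
    unfolding y_def app[OF q(1)] g(3) mult_vec_smult[OF XS q(1)]
    by (rule mult_vec_smult[OF gI mult_vec_carrier[OF XS q(1)]])
  have pair: "herm n (y (Suc k)) r = m * herm n (y k) (g *\<^sub>v r)" if "r \<in> carrier_vec (Suc n)" for k r
    unfolding ySuc herm_smult_left[OF mult_vec_carrier[OF gI yc]] herm_hadj[OF hadj_carrier yc that]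
      hadj_hadj[OF SU_n1_carrier[OF gS]] ..
  have yp: "herm n (y k) p = herm n (h *\<^sub>v q) p" for k
  proof (induction k)
    case (Suc k)
    have "herm n (y (Suc k)) p = m * cnj l * herm n (y k) p"
      unfolding pair[OF p(1)] g(2) herm_smult_right[OF p(1)] by simp
    then show ?case using Suc g(6) by simp
  qed (simp add: y_def X0)
  have yq: "herm n (y k) q = ((cmod m)\<^sup>2) ^ k * herm n (h *\<^sub>v q) q" for k
  proof (induction k)
    case (Suc k)
    have "herm n (y (Suc k)) q = (m * cnj m) * herm n (y k) q"
      unfolding pair[OF q(1)] g(3) herm_smult_right[OF q(1)] by simp
    then show ?case using Suc by (simp flip: complex_norm_square)
  qed (simp add: y_def X0)
  \<comment> \<open>With this coefficient z = p + c q is negative: as p and q are null, \<langle>z,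
    z\<rangle> is twice the real part of cnj c \<langle>p, q\<rangle>, that is -2 |\<langle>p,
    q\<rangle>|^2.\<close>
  define c where "c = - herm n p q"
  define z where "z = p + c \<cdot>\<^sub>v q"
  define s where "s = 2 * (cmod (herm n p q))\<^sup>2"
  have s: "s > 0" using pq by (simp add: s_def)
  have zc: "z \<in> carrier_vec (Suc n)" using p q by (simp add: z_def)
  have qp: "herm n q p = cnj (herm n p q)" by (simp add: herm_cnj)
  have zz: "Re (herm n z z) = - s"
  proof -
    have "herm n z z = - 2 * (herm n p q * cnj (herm n p q))"
      using p q by (simp add: z_def herm_lin c_def qp)
    then show ?thesis by (simp add: s_def flip: complex_norm_square)
  qed
  have hz: "herm n x z = herm n x p + cnj c * herm n x q" for x
    using p q by (simp add: z_def herm_lin)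
  define C1 where "C1 = cmod (herm n (h *\<^sub>v q) p) + cmod c * cmod (herm n (h *\<^sub>v q) q)"
  have "cmod (herm n (y k) z) \<le> C1" for k
  proof -
    have "cmod (herm n (y k) q) \<le> cmod (herm n (h *\<^sub>v q) q)"
      unfolding yq norm_mult norm_power norm_of_real using g(4)
      by (intro mult_left_le_one_le) (auto intro!: power_le_one)
    then have "cmod (cnj c * herm n (y k) q) \<le> cmod c * cmod (herm n (h *\<^sub>v q) q)"
      by (simp add: norm_mult mult_left_mono)
    then show ?thesis unfolding hz C1_def using norm_triangle_ineq[of "herm n (y k) p" "cnj c * herm n (y k) q"] yp[of k] by simp
  qed
  then have "2 * cmod (z $ n) * cmod (herm n (y k) z) \<le> 2 * cmod (z $ n) * C1" for k
    by (intro mult_left_mono) auto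
  \<comment> \<open>The images of q are null and their pairings with the negative vector z are
    bounded, so \<open>reverse_Cauchy_Schwarz\<close> bounds their last coordinates.\<close>
  then have "cmod (y k $ n) * s \<le> 2 * cmod (z $ n) * C1" for k
    using order_trans[OF reverse_Cauchy_Schwarz[OF _ zz s, of "y k"]] by (simp add: ynull)
  then have yb: "cmod (y k $ n) \<le> 2 * cmod (z $ n) * C1 / s" for k
    using s by (simp add: pos_le_divide_eq)
  define C3 where "C3 = cmod (a * p $ n) + cmod c * (2 * cmod (z $ n) * C1 / s)"
  have Xz: "cmod ((X k *\<^sub>v z) $ n) \<le> C3" for k
  proof -
    have "X k *\<^sub>v z = a \<cdot>\<^sub>v p + c \<cdot>\<^sub>v y k"
      using mult_vec_add[OF XS p(1) smult_carrier_vec[THEN iffD2, OF q(1)]] mult_vec_smult[OF XS q(1)]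
      by (simp only: z_def y_def Xp)
    then have eq: "(X k *\<^sub>v z) $ n = a * p $ n + c * y k $ n" using p yc[of k] by simp
    have "cmod (c * y k $ n) \<le> cmod c * (2 * cmod (z $ n) * C1 / s)"
      unfolding norm_mult by (rule mult_left_mono[OF yb norm_ge_zero])
    then show ?thesis unfolding C3_def eq
      using norm_triangle_ineq[of "a * p $ n" "c * y k $ n"] by linarith
  qed
  define e where "e = (unit_vec (Suc n) n :: complex vec)"
  have ec: "e \<in> carrier_vec (Suc n)" by (simp add: e_def)
  \<comment> \<open>The corner entry is the last coordinate of X_k e. Both X_k e and X_k z are
    negative with the fixed pairing \<langle>e, z\<rangle>, so the bound on the last coordinate of
    X_k z passes to X_k e.\<close>
  have "cmod (X k $$ (n,n)) \<le> 2 * C3 * cmod (herm n e z) / s" for k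
  proof -
    have "Re (herm n (X k *\<^sub>v e) (X k *\<^sub>v e)) \<le> 0"
      unfolding herm_invariant[OF XS ec ec] by (simp add: e_def herm_unit_unit)
    moreover have "Re (herm n (X k *\<^sub>v z) (X k *\<^sub>v z)) = - s"
      unfolding herm_invariant[OF XS zc zc] by (rule zz)
    ultimately have "cmod ((X k *\<^sub>v e) $ n) * s \<le> 2 * cmod ((X k *\<^sub>v z) $ n) * cmod (herm n e z)"
      using reverse_Cauchy_Schwarz[OF _ _ s, of n "X k *\<^sub>v e" "X k *\<^sub>v z"]
      unfolding herm_invariant[OF XS ec zc] by blast
    also have "\<dots> \<le> 2 * C3 * cmod (herm n e z)"
      using Xz by (intro mult_right_mono mult_left_mono) auto
    finally show ?thesis
      unfolding e_def mat_unit_vec_index[OF SU_n1_carrier[OF XS] order_refl order_refl]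
      using s by (simp add: pos_le_divide_eq)
  qed
  from discrete_bounded_sequence[OF sub disc XG this]
  obtain j k where jk: "j < k" "X j = X k" by blast
  then have "herm n (y j) q = herm n (y k) q" by (simp add: y_def)
  moreover have "((cmod m)\<^sup>2) ^ k < ((cmod m)\<^sup>2) ^ j"
    using g(4,5) jk(1) by (intro power_strict_decreasing) (auto simp: power_less_one_iff abs_square_less_1)
  ultimately have "herm n (h *\<^sub>v q) q = 0"
    unfolding yq by (simp flip: of_real_power)
  then show ?thesis
    using null_orth_multiple[OF mult_vec_carrier[OF G(1)[OF h(1)] q(1)] _ q] herm_invariant[OF G(1)[OF h(1)] q(1) q(1)] q(2) by simp
qed

text \<open>Otherwise p is an eigenvector of all of \<open>G\<close>. If all multipliers are
  unimodular, the pairings with p are bounded and at most one limit point is left. If some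
  multiplier is not, the dual eigenvector q of that element is null, discreteness makes the whole
  group fix its line too, and at most two limit points are left.\<close>

lemma no_fixed_null_line:
  assumes sub: "is_subgroup_of G n" and disc: "discrete_mats G" and ne: "nonelementary n G"
    and p: "p \<in> carrier_vec (Suc n)" "herm n p p = 0" "p \<noteq> 0\<^sub>v (Suc n)"
  shows "\<exists>g\<in>G. herm n (g *\<^sub>v p) p \<noteq> 0"
proof (rule ccontr)
  assume "\<not> ?thesis"
  then have orth: "herm n (g *\<^sub>v p) p = 0" if "g \<in> G" for g using that by blast
  note G = subgroup_facts[OF sub]
  have ev: "\<exists>c. g *\<^sub>v p = c \<cdot>\<^sub>v p" if g: "g \<in> G" for g
    using null_orth_multiple[OF mult_vec_carrier[OF G(1)[OF g] p(1)] _ p orth[OF g]]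
      herm_invariant[OF G(1)[OF g] p(1) p(1)] p(2) by simp
  let ?e = "unit_vec (Suc n) n :: complex vec"
  have hE: "herm n (g *\<^sub>v ?e) r = herm n ?e (hadj n g *\<^sub>v r)" if "g \<in> G" "r \<in> carrier_vec (Suc n)" for g r
    by (rule herm_hadj[OF SU_n1_carrier[OF G(1)[OF that(1)]] unit_vec_carrier that(2)])
  show False
  proof (cases "\<forall>g\<in>G. \<forall>c. g *\<^sub>v p = c \<cdot>\<^sub>v p \<longrightarrow> cmod c = 1")
    case True
    have "cmod (herm n (g *\<^sub>v ?e) p) * cmod (herm n (g *\<^sub>v ?e) p) \<le> cmod (herm n ?e p) * cmod (herm n ?e p)"
      if g: "g \<in> G" for g
    proof -
      obtain c where c: "hadj n g *\<^sub>v p = c \<cdot>\<^sub>v p" using ev[OF G(3)[OF g]] by blast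
      then have "cmod c = 1" using True G(3)[OF g] by blast
      then show ?thesis unfolding hE[OF g p(1)] c herm_smult_right[OF p(1)] by (simp add: norm_mult)
    qed
    from elementary_by_two_null_lines[OF G(1) ne p p this] show False .
  next
    case False
    then obtain g0 c0 where g0: "g0 \<in> G" "g0 *\<^sub>v p = c0 \<cdot>\<^sub>v p" "cmod c0 \<noteq> 1" by blast
    have pn: "p $ n \<noteq> 0" by (rule null_last_nonzero[OF p])
    have c0: "c0 \<noteq> 0"
    proof
      assume "c0 = 0"
      then have "g0 *\<^sub>v p = 0\<^sub>v (Suc n)" using g0(2) p(1) by (intro eq_vecI) auto
      then show False using mult_vec_nonzero[OF G(1)[OF g0(1)] p(1,3)] by simp
    qed
    have "\<exists>g\<in>G. \<exists>l. g *\<^sub>v p = l \<cdot>\<^sub>v p \<and> cmod l > 1"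
    proof (cases "cmod c0 > 1")
      case False
      have "c0 \<cdot>\<^sub>v (hadj n g0 *\<^sub>v p) = p"
        using hadj_vec_inverse(1)[OF G(1)[OF g0(1)] p(1)]
        unfolding g0(2) mult_vec_smult[OF hadj_SU_n1[OF G(1)[OF g0(1)]] p(1)] .
      then have "inverse c0 \<cdot>\<^sub>v (c0 \<cdot>\<^sub>v (hadj n g0 *\<^sub>v p)) = inverse c0 \<cdot>\<^sub>v p" by simp
      then have "hadj n g0 *\<^sub>v p = inverse c0 \<cdot>\<^sub>v p" using c0 by (simp add: smult_smult_assoc)
      moreover have "cmod (inverse c0) > 1"
        using False g0(3) c0 by (simp add: norm_inverse one_less_inverse_iff)
      ultimately show ?thesis using G(3)[OF g0(1)] by blast
    qed (use g0 in blast)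
    then obtain g l where g: "g \<in> G" "g *\<^sub>v p = l \<cdot>\<^sub>v p" "cmod l > 1" by blast
    have l0: "l \<noteq> 0" using g(3) by auto
    obtain q where q: "q \<in> carrier_vec (Suc n)" "q \<noteq> 0\<^sub>v (Suc n)" "g *\<^sub>v q = inverse (cnj l) \<cdot>\<^sub>v q"
      using dual_eigenvector[OF G(1)[OF g(1)] p(1) pn g(2) l0] .
    define m where "m = inverse (cnj l)"
    have m: "cmod m < 1" "m \<noteq> 0" "m * cnj l = 1" "g *\<^sub>v q = m \<cdot>\<^sub>v q"
      using l0 g(3) q(3) by (auto simp: m_def norm_inverse inverse_less_1_iff)
    \<comment> \<open>The vector q came from a vanishing determinant, which says nothing about its
      norm. Invariance multiplies \<langle>q, q\<rangle> by |m|^2 < 1, so q is null.\<close>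
    have "herm n q q = (m * cnj m) * herm n q q"
      using herm_invariant[OF G(1)[OF g(1)] q(1) q(1)] unfolding m(4) herm_smult_left[OF q(1)]
      by (simp add: herm_smult_right[OF q(1)])
    moreover have "m * cnj m \<noteq> 1"
    proof
      assume "m * cnj m = 1"
      then have "(cmod m)\<^sup>2 = 1" by (metis complex_norm_square of_real_eq_1_iff)
      then show False using m(1) norm_ge_zero[of m] by (auto simp: power2_eq_1_iff simp del: norm_ge_zero)
    qed
    ultimately have qq: "herm n q q = 0" by simp
    have pq: "herm n p q \<noteq> 0"
    proof
      assume "herm n p q = 0"
      from null_orth_multiple[OF p(1,2) q(1) qq q(2) this] obtain c where c: "p = c \<cdot>\<^sub>v q" by blast
      have "g *\<^sub>v p = m \<cdot>\<^sub>v p"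
        unfolding c mult_vec_smult[OF G(1)[OF g(1)] q(1)] m(4) by (simp add: smult_smult_assoc mult.commute)
      then have "(l \<cdot>\<^sub>v p) $ n = (m \<cdot>\<^sub>v p) $ n" using g(2) by simp
      then have "l = m" using p(1) pn by simp
      then show False using g(3) m(1) by simp
    qed
    have evq: "\<exists>b. h *\<^sub>v q = b \<cdot>\<^sub>v q" if h: "h \<in> G" for h
      using ev[OF h] discrete_fixes_dual_line[OF sub disc p(1,2) q(1) qq q(2) pq g(1,2) m(4,1,2,3) h] by blast
    have "cmod (herm n (h *\<^sub>v ?e) p) * cmod (herm n (h *\<^sub>v ?e) q) \<le> cmod (herm n ?e p) * cmod (herm n ?e q)"
      if h: "h \<in> G" for h
    proof -
      obtain a b where "hadj n h *\<^sub>v p = a \<cdot>\<^sub>v p" "hadj n h *\<^sub>v q = b \<cdot>\<^sub>v q"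
        using ev[OF G(3)[OF h]] evq[OF G(3)[OF h]] by blast
      then show ?thesis
        using herm_product_bound[OF G(1)[OF h] p(1) q(1) pq unit_vec_carrier[of "Suc n" n], of a b] by simp
    qed
    from elementary_by_two_null_lines[OF G(1) ne p q(1) qq q(2) this] show False .
  qed
qed

section \<open>Rank one limits and traces\<close>

text \<open>The columns of a limit of \<open>g\<^sub>k / |g\<^sub>k(n,n)|\<close> are null and mutually orthogonal, hence proportional.\<close>

lemma rank_one_limit:
  assumes G: "\<And>g. g \<in> G \<Longrightarrow> g \<in> SU_n1 n" and ne: "nonelementary n G"
  obtains p \<eta> g where
    "p \<in> carrier_vec (Suc n)" "herm n p p = 0" "p \<noteq> 0\<^sub>v (Suc n)"
    "\<eta> \<in> carrier_vec (Suc n)" "herm n \<eta> \<eta> = 0" "\<eta> \<noteq> 0\<^sub>v (Suc n)"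
    "\<And>k::nat. g k \<in> G"
    "\<And>i j. i \<le> n \<Longrightarrow> j \<le> n \<Longrightarrow>
      (\<lambda>k. g k $$ (i,j) / of_real (cmod (g k $$ (n,n)))) \<longlonglongrightarrow> p $ i * (sg n j * cnj (\<eta> $ j))"
proof -
  obtain g0 where g0: "\<And>k. g0 k \<in> G" "(\<lambda>k. inverse ((cmod (g0 k $$ (n,n)))\<^sup>2)) \<longlonglongrightarrow> 0"
    using nonelementary_unbounded[OF G ne] by blast
  have g0S: "g0 k \<in> SU_n1 n" for k by (rule G[OF g0(1)])
  \<comment> \<open>The divisor is the modulus of the corner entry, not the entry itself: a positive
    real factor keeps traces real, and the corner of the limit has modulus 1, so the limit is not
    zero.\<close>
  define N where "N k i = g0 k $$ i / of_real (cmod (g0 k $$ (n,n)))" for k i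
  have N_bounded: "Bseq (\<lambda>k. N k i)" if i: "i \<in> {..n} \<times> {..n}" for i
  proof (rule BseqI')
    fix k
    obtain a b where ab: "i = (a,b)" "a \<le> n" "b \<le> n" using i by auto
    have 1: "1 \<le> cmod (g0 k $$ (n,n))" by (rule SU_n1_last_entry(1)[OF g0S])
    have "cmod (g0 k $$ (a,b)) \<le> 2 * cmod (g0 k $$ (n,n))"
      using SU_n1_entry_bound[OF g0S ab(2,3), of k] 1 by linarith
    then show "norm (N k i) \<le> 2"
      using 1 unfolding N_def ab(1) norm_divide norm_of_real abs_norm_cancel by (subst pos_divide_le_eq) auto
  qed
  have "\<exists>r. strict_mono r \<and> (\<forall>i\<in>{..n} \<times> {..n}. convergent (\<lambda>k. N (r k) i))"
    by (rule finite_family_convergent_subseq[of _ N]) (simp, rule N_bounded)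
  then obtain r where r: "strict_mono r" "\<And>i. i \<in> {..n} \<times> {..n} \<Longrightarrow> convergent (\<lambda>k. N (r k) i)" by auto
  define M where "M i j = lim (\<lambda>k. N (r k) (i,j))" for i j
  have M: "(\<lambda>k. N (r k) (i,j)) \<longlonglongrightarrow> M i j" if "i \<le> n" "j \<le> n" for i j
    using r(2)[of "(i,j)"] that by (simp add: M_def convergent_LIMSEQ_iff)
  define s where "s k = cmod (g0 (r k) $$ (n,n))" for k
  have s1: "1 \<le> s k" for k unfolding s_def by (rule SU_n1_last_entry(1)[OF g0S])
  have "((\<lambda>k. inverse ((cmod (g0 k $$ (n,n)))\<^sup>2)) \<circ> r) \<longlonglongrightarrow> 0"
    using g0(2) r(1) by (rule LIMSEQ_subseq_LIMSEQ)
  then have sinv: "(\<lambda>k. inverse ((s k)\<^sup>2)) \<longlonglongrightarrow> 0" by (simp add: o_def s_def)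
  have small: "(\<lambda>k. c * of_real (inverse ((s k)\<^sup>2))) \<longlonglongrightarrow> 0" for c :: complex
    using tendsto_mult[OF tendsto_const[of c] tendsto_of_real[OF sinv, where 'a = complex]] by simp
  have Ns: "N (r k) (i,j) = g0 (r k) $$ (i,j) / of_real (s k)" for k i j by (simp add: N_def s_def)
  have herm_cols: "(\<Sum>i\<le>n. sg n i * M i a * cnj (M i b)) = 0" if ab: "a \<le> n" "b \<le> n" for a b
  proof -
    have "(\<lambda>k. \<Sum>i\<le>n. sg n i * N (r k) (i,a) * cnj (N (r k) (i,b))) \<longlonglongrightarrow> (\<Sum>i\<le>n. sg n i * M i a * cnj (M i b))"
      by (intro tendsto_intros M) (use ab in auto)
    moreover have "(\<Sum>i\<le>n. sg n i * N (r k) (i,a) * cnj (N (r k) (i,b)))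
        = herm n (unit_vec (Suc n) a) (unit_vec (Suc n) b) * of_real (inverse ((s k)\<^sup>2))" for k
    proof -
      have "herm n (unit_vec (Suc n) a) (unit_vec (Suc n) b)
          = herm n (g0 (r k) *\<^sub>v unit_vec (Suc n) a) (g0 (r k) *\<^sub>v unit_vec (Suc n) b)"
        by (rule herm_invariant[OF g0S unit_vec_carrier unit_vec_carrier, symmetric])
      also have "\<dots> = (\<Sum>i\<le>n. sg n i * g0 (r k) $$ (i,a) * cnj (g0 (r k) $$ (i,b)))"
        unfolding herm_def
        using ab by (intro sum.cong[OF refl]) (simp add: mat_unit_vec_index[OF SU_n1_carrier[OF g0S]])
      finally show ?thesis
        by (simp add: Ns sum_distrib_right sum_divide_distrib field_simps power2_eq_square)
    qed
    ultimately have "(\<lambda>k. herm n (unit_vec (Suc n) a) (unit_vec (Suc n) b) * of_real (inverse ((s k)\<^sup>2)))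
        \<longlonglongrightarrow> (\<Sum>i\<le>n. sg n i * M i a * cnj (M i b))" by simp
    then show ?thesis using LIMSEQ_unique small by blast
  qed
  \<comment> \<open>Orthogonality of the columns says nothing about the norm of the bottom row, from
    which \<eta> is built. That row is null by the corner entry of g hadj(g) = 1, the product in the
    other order.\<close>
  have herm_row: "(\<Sum>j\<le>n. sg n j * M n j * cnj (M n j)) = 0"
  proof -
    have "(\<lambda>k. \<Sum>j\<le>n. sg n j * N (r k) (n,j) * cnj (N (r k) (n,j))) \<longlonglongrightarrow> (\<Sum>j\<le>n. sg n j * M n j * cnj (M n j))"
      by (intro tendsto_intros M) auto
    moreover have "(\<Sum>j\<le>n. sg n j * N (r k) (n,j) * cnj (N (r k) (n,j))) = - 1 * of_real (inverse ((s k)\<^sup>2))" for k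
    proof -
      have "1 = (g0 (r k) * hadj n (g0 (r k))) $$ (n,n)" unfolding hadj_right_inverse[OF g0S] by simp
      also have "\<dots> = (\<Sum>j\<le>n. - (sg n j * g0 (r k) $$ (n,j) * cnj (g0 (r k) $$ (n,j))))"
        unfolding mat_mult_index[OF SU_n1_carrier[OF g0S] hadj_carrier order_refl order_refl]
        by (intro sum.cong) (auto simp: hadj_def)
      finally have "(\<Sum>j\<le>n. sg n j * g0 (r k) $$ (n,j) * cnj (g0 (r k) $$ (n,j))) = - 1"
        unfolding sum_negf by (metis minus_minus)
      from this[symmetric] show ?thesis
        by (simp add: Ns sum_distrib_right sum_divide_distrib field_simps power2_eq_square)
    qed
    ultimately have "(\<lambda>k. - 1 * of_real (inverse ((s k)\<^sup>2))) \<longlonglongrightarrow> (\<Sum>j\<le>n. sg n j * M n j * cnj (M n j))" by simp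
    then show ?thesis using LIMSEQ_unique small by blast
  qed
  have "(\<lambda>k. cmod (N (r k) (n,n))) \<longlonglongrightarrow> cmod (M n n)" by (intro tendsto_intros M) auto
  moreover have "cmod (N (r k) (n,n)) = 1" for k
    using s1[of k] by (auto simp: N_def norm_divide s_def)
  ultimately have Mnn: "M n n \<noteq> 0" by (auto simp: LIMSEQ_const_iff)
  define col where "col j = vec (Suc n) (\<lambda>i. M i j)" for j
  have colc: "col j \<in> carrier_vec (Suc n)" for j by (simp add: col_def)
  have colh: "herm n (col a) (col b) = 0" if "a \<le> n" "b \<le> n" for a b
    using herm_cols[OF that] by (simp add: herm_def col_def)
  define w where "w j = M n j / M n n" for j
  \<comment> \<open>Sign and conjugation are chosen so that the linear functional with coefficients
    \<open>w j\<close> becomes x \<mapsto> \<langle>x, \<eta>\<rangle>.\<close>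
  define \<eta> where "\<eta> = vec (Suc n) (\<lambda>j. sg n j * cnj (w j))"
  have Mw: "M i j = col n $ i * w j" if "i \<le> n" "j \<le> n" for i j
  proof -
    have "(col n $ n \<cdot>\<^sub>v col j) $ i = (col j $ n \<cdot>\<^sub>v col n) $ i"
      using null_orth_proportional[OF colc colh colc colh colh] that by simp
    then show ?thesis using that Mnn by (simp add: col_def w_def field_simps)
  qed
  have "herm n \<eta> \<eta> = (\<Sum>j\<le>n. sg n j * M n j * cnj (M n j)) / (M n n * cnj (M n n))"
    unfolding herm_def sum_divide_distrib
    by (intro sum.cong) (auto simp: \<eta>_def w_def field_simps)
  then have eta: "herm n \<eta> \<eta> = 0" using herm_row by simp
  have "\<eta> $ n = - 1" using Mnn by (simp add: \<eta>_def w_def)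
  then have eta0: "\<eta> \<noteq> 0\<^sub>v (Suc n)" by auto
  have p0: "col n \<noteq> 0\<^sub>v (Suc n)"
  proof
    assume "col n = 0\<^sub>v (Suc n)"
    then have "col n $ n = 0" by simp
    then show False using Mnn by (simp add: col_def)
  qed
  have lim: "(\<lambda>k. g0 (r k) $$ (i,j) / of_real (cmod (g0 (r k) $$ (n,n)))) \<longlonglongrightarrow> col n $ i * (sg n j * cnj (\<eta> $ j))"
    if "i \<le> n" "j \<le> n" for i j
  proof -
    have "sg n j * cnj (\<eta> $ j) = w j" using that by (simp add: \<eta>_def)
    then show ?thesis using M[OF that] Mw[OF that] by (simp add: N_def)
  qed
  have "\<eta> \<in> carrier_vec (Suc n)" by (simp add: \<eta>_def)
  from that[OF colc colh[OF order_refl order_refl] p0 this eta eta0 g0(1) lim] show ?thesis .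
qed

section \<open>Traces of products and their limits\<close>

lemma mtrace_mult:
  assumes "A \<in> carrier_mat (Suc n) (Suc n)" "B \<in> carrier_mat (Suc n) (Suc n)"
  shows "mtrace (A * B) = (\<Sum>a\<le>n. \<Sum>c\<le>n. A $$ (a,c) * B $$ (c,a))"
proof -
  have "mtrace (A * B) = (\<Sum>a\<le>n. (A * B) $$ (a,a))"
    using assms by (simp add: mtrace_def lessThan_Suc_atMost)
  then show ?thesis by (simp add: mat_mult_index[OF assms])
qed

lemma herm_quadratic:
  assumes "h \<in> carrier_mat (Suc n) (Suc n)" "x \<in> carrier_vec (Suc n)"
  shows "herm n (h *\<^sub>v x) y = (\<Sum>i\<le>n. \<Sum>j\<le>n. sg n i * cnj (y $ i) * h $$ (i,j) * x $ j)"
  unfolding herm_def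
  by (intro sum.cong refl) (simp add: mat_vec_index[OF assms] sum_distrib_left sum_distrib_right mult_ac)

text \<open>Since \<open>g\<^sub>k\<close> is asymptotic to a multiple of \<open>x \<mapsto> \<langle>x, \<eta>\<rangle> p\<close> and its inverse to the adjoint of that map,
  the product below is the limit of the rescaled traces of \<open>g\<^sub>k h g\<^sub>k\<^bsup>-1\<^esup> h'\<close>.\<close>

lemma real_trace_limit:
  assumes G: "\<And>g. g \<in> G \<Longrightarrow> g \<in> SU_n1 n" and mult: "\<And>g h. g \<in> G \<Longrightarrow> h \<in> G \<Longrightarrow> g * h \<in> G"
    and inv: "\<And>g. g \<in> G \<Longrightarrow> hadj n g \<in> G"
    and tr: "\<And>g. g \<in> G \<Longrightarrow> mtrace g \<in> \<real>"
    and p: "p \<in> carrier_vec (Suc n)" and eta: "\<eta> \<in> carrier_vec (Suc n)"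
    and g: "\<And>k::nat. g k \<in> G"
    and lim: "\<And>i j. i \<le> n \<Longrightarrow> j \<le> n \<Longrightarrow>
      (\<lambda>k. g k $$ (i,j) / of_real (cmod (g k $$ (n,n)))) \<longlonglongrightarrow> p $ i * (sg n j * cnj (\<eta> $ j))"
    and h: "h \<in> G" and h': "h' \<in> G"
  shows "herm n (h *\<^sub>v \<eta>) \<eta> * herm n (h' *\<^sub>v p) p \<in> \<real>"
proof -
  define s where "s k = complex_of_real (cmod (g k $$ (n,n)))" for k
  define w where "w j = sg n j * cnj (\<eta> $ j)" for j
  have lim': "(\<lambda>k. g k $$ (i,j) / s k) \<longlonglongrightarrow> p $ i * w j" if "i \<le> n" "j \<le> n" for i j
    using lim[OF that] by (simp add: s_def w_def)
  note gc = SU_n1_carrier[OF G[OF g]] and hc = SU_n1_carrier[OF G[OF h]] and hc' = SU_n1_carrier[OF G[OF h']]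
  have A: "(\<lambda>k. (g k * h) $$ (a,c) / s k) \<longlonglongrightarrow> (\<Sum>b\<le>n. (p $ a * w b) * h $$ (b,c))"
    if "a \<le> n" "c \<le> n" for a c
  proof -
    have eq: "(g k * h) $$ (a,c) / s k = (\<Sum>b\<le>n. (g k $$ (a,b) / s k) * h $$ (b,c))" for k
      unfolding mat_mult_index[OF gc hc that] by (simp add: sum_divide_distrib)
    have "(\<lambda>k. \<Sum>b\<le>n. (g k $$ (a,b) / s k) * h $$ (b,c)) \<longlonglongrightarrow> (\<Sum>b\<le>n. (p $ a * w b) * h $$ (b,c))"
      by (intro tendsto_intros lim') (use that in auto)
    then show ?thesis unfolding eq .
  qed
  have B: "(\<lambda>k. (hadj n (g k) * h') $$ (c,a) / s k) \<longlonglongrightarrow> (\<Sum>d\<le>n. sg n c * sg n d * cnj (p $ d * w c) * h' $$ (d,a))"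
    if "a \<le> n" "c \<le> n" for a c
  proof -
    have eq: "(hadj n (g k) * h') $$ (c,a) / s k = (\<Sum>d\<le>n. sg n c * sg n d * cnj (g k $$ (d,c) / s k) * h' $$ (d,a))" for k
      unfolding mat_mult_index[OF hadj_carrier hc' that(2,1)] sum_divide_distrib
      using that by (intro sum.cong refl) (simp add: hadj_def s_def)
    have "(\<lambda>k. \<Sum>d\<le>n. sg n c * sg n d * cnj (g k $$ (d,c) / s k) * h' $$ (d,a))
        \<longlonglongrightarrow> (\<Sum>d\<le>n. sg n c * sg n d * cnj (p $ d * w c) * h' $$ (d,a))"
      by (intro tendsto_intros lim') (use that in auto)
    then show ?thesis unfolding eq .
  qed
  define F where "F k = (\<Sum>a\<le>n. \<Sum>c\<le>n. ((g k * h) $$ (a,c) / s k) * ((hadj n (g k) * h') $$ (c,a) / s k))" for k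
  define L where "L = (\<Sum>a\<le>n. \<Sum>c\<le>n. (\<Sum>b\<le>n. (p $ a * w b) * h $$ (b,c)) * (\<Sum>d\<le>n. sg n c * sg n d * cnj (p $ d * w c) * h' $$ (d,a)))"
  have FL: "F \<longlonglongrightarrow> L" unfolding F_def L_def by (intro tendsto_intros A B) auto
  have "Im (F k) = 0" for k
  proof -
    have "F k = mtrace ((g k * h) * (hadj n (g k) * h')) / (s k * s k)"
      unfolding F_def mtrace_mult[OF mult_carrier_mat[OF gc hc] mult_carrier_mat[OF hadj_carrier hc']]
      by (simp add: sum_divide_distrib)
    moreover have "mtrace ((g k * h) * (hadj n (g k) * h')) \<in> \<real>" by (intro tr mult inv g h h')
    ultimately have "F k \<in> \<real>" by (simp add: s_def)
    then show ?thesis by (simp add: complex_is_Real_iff)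
  qed
  then have "(\<lambda>_. 0) \<longlonglongrightarrow> Im L" using tendsto_Im[OF FL] by simp
  then have "Im L = 0" by (simp add: LIMSEQ_const_iff)
  then have "L \<in> \<real>" by (simp add: complex_is_Real_iff)
  moreover have "L = herm n (h *\<^sub>v \<eta>) \<eta> * herm n (h' *\<^sub>v p) p"
  proof -
    \<comment> \<open>The fourfold sum separates: the indices b and c carry only \<eta> and h, the
      indices a and d only p and h'.\<close>
    have "L = (\<Sum>a\<le>n. \<Sum>c\<le>n. ((\<Sum>b\<le>n. w b * h $$ (b,c)) * (sg n c * cnj (w c))) * (p $ a * (\<Sum>d\<le>n. sg n d * cnj (p $ d) * h' $$ (d,a))))"
      unfolding L_def by (intro sum.cong refl) (simp add: sum_distrib_left sum_distrib_right mult_ac)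
    also have "\<dots> = (\<Sum>c\<le>n. (\<Sum>b\<le>n. w b * h $$ (b,c)) * (sg n c * cnj (w c))) * (\<Sum>a\<le>n. p $ a * (\<Sum>d\<le>n. sg n d * cnj (p $ d) * h' $$ (d,a)))"
      by (subst sum.swap) (simp add: sum_product)
    also have "(\<Sum>c\<le>n. (\<Sum>b\<le>n. w b * h $$ (b,c)) * (sg n c * cnj (w c))) = herm n (h *\<^sub>v \<eta>) \<eta>"
      unfolding herm_quadratic[OF hc eta]
      by (subst sum.swap) (simp add: w_def sum_distrib_left sum_distrib_right mult_ac)
    also have "(\<Sum>a\<le>n. p $ a * (\<Sum>d\<le>n. sg n d * cnj (p $ d) * h' $$ (d,a))) = herm n (h' *\<^sub>v p) p"
      unfolding herm_quadratic[OF hc' p]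
      by (subst sum.swap) (simp add: sum_distrib_left sum_distrib_right mult_ac)
    finally show ?thesis .
  qed
  ultimately show ?thesis by simp
qed

lemma mtrace_in_trace_field: "g \<in> G \<Longrightarrow> mtrace g \<in> trace_field G"
  by (auto simp: trace_field_def)

text \<open>Replacing g' by its inverse conjugates t = \<langle>g' p, p\<rangle>, so both \<kappa> t
  and \<kappa> cnj t are real for one fixed nonzero \<kappa>. Hence Im \<kappa> Re t = 0 and Re
  \<kappa> Im t = 0, and \<kappa>, which does not depend on g', decides the alternative for the
  whole group at once.\<close>

lemma real_or_imaginary_orbit:
  assumes sub: "is_subgroup_of G n" and disc: "discrete_mats G" and ne: "nonelementary n G"
    and tr: "trace_field G \<subseteq> \<real>"
  obtains p where "p \<in> carrier_vec (Suc n)" "herm n p p = 0" "p \<noteq> 0\<^sub>v (Suc n)"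
    "(\<forall>g\<in>G. herm n (g *\<^sub>v p) p \<in> \<real>) \<or> (\<forall>g\<in>G. Re (herm n (g *\<^sub>v p) p) = 0)"
proof -
  note G = subgroup_facts[OF sub]
  have trG: "mtrace g \<in> \<real>" if "g \<in> G" for g using mtrace_in_trace_field[OF that] tr by blast
  obtain p \<eta> g where p: "p \<in> carrier_vec (Suc n)" "herm n p p = 0" "p \<noteq> 0\<^sub>v (Suc n)"
    and eta: "\<eta> \<in> carrier_vec (Suc n)" "herm n \<eta> \<eta> = 0" "\<eta> \<noteq> 0\<^sub>v (Suc n)"
    and g: "\<And>k::nat. g k \<in> G"
    and lim: "\<And>i j. i \<le> n \<Longrightarrow> j \<le> n \<Longrightarrow>
      (\<lambda>k. g k $$ (i,j) / of_real (cmod (g k $$ (n,n)))) \<longlonglongrightarrow> p $ i * (sg n j * cnj (\<eta> $ j))"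
    using rank_one_limit[OF G(1) ne] by blast
  obtain h where h: "h \<in> G" "herm n (h *\<^sub>v \<eta>) \<eta> \<noteq> 0"
    using no_fixed_null_line[OF sub disc ne eta] by blast
  define \<kappa> where "\<kappa> = herm n (h *\<^sub>v \<eta>) \<eta>"
  have k0: "\<kappa> \<noteq> 0" using h by (simp add: \<kappa>_def)
  have real: "\<kappa> * herm n (g' *\<^sub>v p) p \<in> \<real>" if "g' \<in> G" for g'
    unfolding \<kappa>_def by (rule real_trace_limit[OF G(1,2,3) trG p(1) eta(1) g lim h(1) that])
  have real': "\<kappa> * cnj (herm n (g' *\<^sub>v p) p) \<in> \<real>" if "g' \<in> G" for g'
  proof -
    have eq: "herm n (hadj n g' *\<^sub>v p) p = cnj (herm n (g' *\<^sub>v p) p)"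
      unfolding herm_cnj herm_hadj[OF hadj_carrier p(1) p(1)] hadj_hadj[OF SU_n1_carrier[OF G(1)[OF that]]] ..
    show ?thesis using real[OF G(3)[OF that]] unfolding eq .
  qed
  have main: "Im \<kappa> * Re t = 0 \<and> Re \<kappa> * Im t = 0" if "\<kappa> * t \<in> \<real>" "\<kappa> * cnj t \<in> \<real>" for t
  proof -
    have "Re \<kappa> * Im t + Im \<kappa> * Re t = 0" "Im \<kappa> * Re t - Re \<kappa> * Im t = 0"
      using that by (simp_all add: complex_is_Real_iff)
    then show ?thesis by linarith
  qed
  have key: "Im \<kappa> * Re (herm n (g' *\<^sub>v p) p) = 0" "Re \<kappa> * Im (herm n (g' *\<^sub>v p) p) = 0" if "g' \<in> G" for g'
    using main[OF real[OF that] real'[OF that]] by auto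
  have "(\<forall>g\<in>G. herm n (g *\<^sub>v p) p \<in> \<real>) \<or> (\<forall>g\<in>G. Re (herm n (g *\<^sub>v p) p) = 0)"
  proof (cases "Re \<kappa> = 0")
    case True
    then have "Im \<kappa> \<noteq> 0" using k0 by (simp add: complex_eq_iff)
    then show ?thesis using key(1) by auto
  next
    case False
    then show ?thesis using key(2) by (auto simp: complex_is_Real_iff)
  qed
  then show ?thesis using that p by blast
qed

section \<open>Orthonormal frames\<close>

text \<open>\<open>us\<close> may be incomplete, so partial systems are covered. The negative vector
  is kept apart because extensions add only positive vectors; appended after n of them it takes the
  index n, where \<open>sg\<close> is -1.\<close>

definition frame :: "nat \<Rightarrow> complex vec list \<Rightarrow> complex vec \<Rightarrow> bool" where
  "frame n us f \<longleftrightarrow> f \<in> carrier_vec (Suc n) \<and> herm n f f = -1 \<and> set us \<subseteq> carrier_vec (Suc n)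
    \<and> (\<forall>u\<in>set us. herm n u f = 0)
    \<and> (\<forall>i<length us. \<forall>j<length us. herm n (us ! i) (us ! j) = (if i = j then 1 else 0))"

definition frame_mat :: "nat \<Rightarrow> complex vec list \<Rightarrow> complex vec \<Rightarrow> complex mat" where
  "frame_mat n us f = mat (Suc n) (Suc n) (\<lambda>(i,j). (us @ [f]) ! j $ i)"

lemma frame_mat_carrier [simp]: "frame_mat n us f \<in> carrier_mat (Suc n) (Suc n)"
  by (simp add: frame_mat_def)

lemma frame_carrier:
  assumes "frame n us f" "length us = n" "i \<le> n"
  shows "(us @ [f]) ! i \<in> carrier_vec (Suc n)"
  using assms by (auto simp: frame_def nth_append subset_iff)

lemma frame_herm:
  assumes fr: "frame n us f" "length us = n" and ij: "i \<le> n" "j \<le> n"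
  shows "herm n ((us @ [f]) ! i) ((us @ [f]) ! j) = (if i = j then sg n i else 0)"
proof -
  have *: "herm n u f = 0" "herm n f u = 0" if "u \<in> set us" for u
  proof -
    show "herm n u f = 0" using fr that by (auto simp: frame_def)
    then show "herm n f u = 0" by (metis herm_cnj complex_cnj_zero)
  qed
  show ?thesis
    using assms * by (auto simp: frame_def nth_append sg_def)
qed

lemma frame_mat_index:
  assumes "i \<le> n" "j \<le> n"
  shows "frame_mat n us f $$ (i,j) = (us @ [f]) ! j $ i"
  using assms by (simp add: frame_mat_def)

lemma hadj_frame_mat_index:
  assumes "i \<le> n" "j \<le> n"
  shows "hadj n (frame_mat n us f) $$ (i,j) = sg n i * sg n j * cnj ((us @ [f]) ! i $ j)"
  using assms by (simp add: hadj_def frame_mat_def)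

lemma hadj_frame_mat_vec:
  assumes x: "x \<in> carrier_vec (Suc n)" and i: "i \<le> n"
  shows "(hadj n (frame_mat n us f) *\<^sub>v x) $ i = sg n i * herm n x ((us @ [f]) ! i)"
  unfolding mat_vec_index[OF hadj_carrier x i] herm_def sum_distrib_left
  using i by (intro sum.cong refl) (simp add: hadj_frame_mat_index)

lemma frame_mat_isometry:
  assumes fr: "frame n us f" "length us = n"
  shows "hadj n (frame_mat n us f) * frame_mat n us f = 1\<^sub>m (Suc n)"
proof (rule eq_matI)
  fix i j assume "i < dim_row (1\<^sub>m (Suc n) :: complex mat)" "j < dim_col (1\<^sub>m (Suc n) :: complex mat)"
  then have ij: "i \<le> n" "j \<le> n" by auto
  have "(hadj n (frame_mat n us f) * frame_mat n us f) $$ (i,j)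
      = sg n i * herm n ((us @ [f]) ! j) ((us @ [f]) ! i)"
    unfolding mat_mult_index[OF hadj_carrier frame_mat_carrier ij] herm_def sum_distrib_left
    using ij by (intro sum.cong refl) (simp add: hadj_frame_mat_index frame_mat_index)
  then show "(hadj n (frame_mat n us f) * frame_mat n us f) $$ (i,j) = 1\<^sub>m (Suc n) $$ (i,j)"
    unfolding frame_herm[OF fr ij(2,1)] using ij by auto
qed (auto simp: hadj_def frame_mat_def)

lemma frame_mat_isometry':
  assumes fr: "frame n us f" "length us = n"
  shows "frame_mat n us f * hadj n (frame_mat n us f) = 1\<^sub>m (Suc n)"
  by (rule mat_mult_left_right_inverse[OF hadj_carrier frame_mat_carrier frame_mat_isometry[OF fr]])

text \<open>The adjoint of a full frame matrix is its inverse, and it sends x to its signed pairings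
  with the frame vectors.\<close>

lemma frame_complete:
  assumes fr: "frame n us f" "length us = n" and x: "x \<in> carrier_vec (Suc n)"
    and orth: "\<And>u. u \<in> set us \<Longrightarrow> herm n x u = 0" "herm n x f = 0"
  shows "x = 0\<^sub>v (Suc n)"
proof -
  let ?B = "frame_mat n us f"
  have "hadj n ?B *\<^sub>v x = 0\<^sub>v (Suc n)"
  proof (rule eq_vecI)
    fix i assume "i < dim_vec (0\<^sub>v (Suc n) :: complex vec)"
    then have i: "i \<le> n" by simp
    have "herm n x ((us @ [f]) ! i) = 0"
      using i fr(2) orth by (cases "i = n") (auto simp: nth_append)
    then show "(hadj n ?B *\<^sub>v x) $ i = 0\<^sub>v (Suc n) $ i"
      using i by (simp add: hadj_frame_mat_vec[OF x])
  qed (simp add: hadj_def)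
  moreover have "x = ?B *\<^sub>v (hadj n ?B *\<^sub>v x)"
    using assoc_mult_mat_vec[OF frame_mat_carrier hadj_carrier x, of us f ?B]
    unfolding frame_mat_isometry'[OF fr] one_mult_mat_vec[OF x] .
  moreover have "?B *\<^sub>v 0\<^sub>v (Suc n) = 0\<^sub>v (Suc n)" by (rule eq_vecI) (auto simp: frame_mat_def)
  ultimately show ?thesis by argo
qed

lemma frame_take: "frame n us f \<Longrightarrow> frame n (take k us) f"
  by (auto simp: frame_def dest: in_set_takeD)

text \<open>The first n vectors together with f already form a full frame, so a further vector
  orthogonal to them would be zero and not of norm one. This bound makes greedy extension
  terminate.\<close>

lemma frame_length:
  assumes fr: "frame n us f"
  shows "length us \<le> n"
proof (rule ccontr)
  assume "\<not> ?thesis"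
  then have len: "n < length us" by simp
  let ?u = "us ! n"
  have u: "?u \<in> set us" using len by simp
  have "?u = 0\<^sub>v (Suc n)"
  proof (rule frame_complete[OF frame_take[OF fr]])
    show "length (take n us) = n" using len by simp
    show "?u \<in> carrier_vec (Suc n)" "herm n ?u f = 0" using fr u by (auto simp: frame_def)
    fix v assume "v \<in> set (take n us)"
    then obtain j where "j < n" "v = us ! j" using len by (auto simp: in_set_conv_nth)
    then show "herm n ?u v = 0" using fr len by (auto simp: frame_def)
  qed
  moreover have "herm n ?u ?u = 1" using fr len by (auto simp: frame_def)
  ultimately show False by simp
qed

text \<open>At most n linear conditions are put on n + 1 unknowns. Padded with zero rows they form a
  square matrix with last row zero, whose adjoint kills the last unit vector, so
  \<open>adjoint_eigenvalue\<close> makes it singular.\<close>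

lemma orthogonal_vector_exists:
  assumes "length ys \<le> n"
  shows "\<exists>x\<in>carrier_vec (Suc n). x \<noteq> 0\<^sub>v (Suc n) \<and> (\<forall>y\<in>set ys. herm n x y = 0)"
proof -
  define M where "M = mat (Suc n) (Suc n) (\<lambda>(i,j). if i < length ys then sg n j * cnj (ys ! i $ j) else 0)"
  have M: "M \<in> carrier_mat (Suc n) (Suc n)" by (simp add: M_def)
  have "det M = 0"
  proof (rule adjoint_eigenvalue[OF M unit_vec_carrier])
    show "unit_vec (Suc n) n $ n \<noteq> (0::complex)" by simp
    show "hadj n M *\<^sub>v unit_vec (Suc n) n = 0\<^sub>v (Suc n)"
    proof (rule eq_vecI)
      fix i assume "i < dim_vec (0\<^sub>v (Suc n) :: complex vec)"
      then have i: "i \<le> n" by simp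
      show "(hadj n M *\<^sub>v unit_vec (Suc n) n) $ i = 0\<^sub>v (Suc n) $ i"
        unfolding mat_unit_vec_index[OF hadj_carrier i order_refl]
        using i assms by (simp add: hadj_def M_def)
    qed (simp add: hadj_def)
  qed
  then obtain x where x: "x \<in> carrier_vec (Suc n)" "x \<noteq> 0\<^sub>v (Suc n)" "M *\<^sub>v x = 0\<^sub>v (Suc n)"
    using det_0_iff_vec_prod_zero_field[OF M] by blast
  have "herm n x y = 0" if y: "y \<in> set ys" for y
  proof -
    obtain i where i: "i < length ys" "y = ys ! i" using y by (auto simp: in_set_conv_nth)
    then have i': "i \<le> n" using assms by simp
    have "herm n x y = (M *\<^sub>v x) $ i"
      unfolding mat_vec_index[OF M x(1) i'] herm_def
      using i i' by (intro sum.cong refl) (simp add: M_def)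
    then show ?thesis using x(3) i' by simp
  qed
  then show ?thesis using x by blast
qed

lemma frame_Cons:
  assumes fr: "frame n us f" and u: "u \<in> carrier_vec (Suc n)" "herm n u u = 1" "herm n u f = 0"
    and orth: "\<And>v. v \<in> set us \<Longrightarrow> herm n u v = 0"
  shows "frame n (u # us) f"
proof -
  have orth': "herm n v u = 0" if "v \<in> set us" for v
    using orth[OF that] by (metis herm_cnj complex_cnj_zero)
  have "herm n ((u # us) ! i) ((u # us) ! j) = (if i = j then 1 else 0)"
    if "i < length (u # us)" "j < length (u # us)" for i j
    using that fr u orth orth' by (cases i; cases j) (auto simp: frame_def)
  then show ?thesis using fr u unfolding frame_def by auto
qed

text \<open>A nonzero vector of X orthogonal to the current frame is orthogonal to the negative f,
  hence positive, and a real factor normalises it. Since only real multiples are needed, X may be a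
  real span or the whole space. New vectors go in front, so the given ones keep their places next to
  f.\<close>

lemma frame_extend:
  assumes "frame n us f" and X: "X \<subseteq> carrier_vec (Suc n)"
    and cone: "\<And>r x. x \<in> X \<Longrightarrow> complex_of_real r \<cdot>\<^sub>v x \<in> X"
  shows "\<exists>vs. set vs \<subseteq> X \<and> frame n (vs @ us) f \<and>
    (\<forall>x\<in>X. (\<forall>u\<in>set (vs @ us). herm n x u = 0) \<and> herm n x f = 0 \<longrightarrow> x = 0\<^sub>v (Suc n))"
  using assms(1)
proof (induction "n - length us" arbitrary: us rule: less_induct)
  case less
  show ?case
  proof (cases "\<forall>x\<in>X. (\<forall>u\<in>set us. herm n x u = 0) \<and> herm n x f = 0 \<longrightarrow> x = 0\<^sub>v (Suc n)")
    case True
    then show ?thesis using less.prems by (intro exI[of _ "[]"]) simp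
  next
    case False
    then obtain x where x: "x \<in> X" "x \<noteq> 0\<^sub>v (Suc n)" "herm n x f = 0" "\<And>u. u \<in> set us \<Longrightarrow> herm n x u = 0"
      by blast
    have xc: "x \<in> carrier_vec (Suc n)" using x X by blast
    define r where "r = Re (herm n x x)"
    have hx: "herm n x x = complex_of_real r" by (simp add: r_def herm_self)
    have r: "r > 0"
    proof (rule ccontr)
      assume "\<not> r > 0"
      then have "x = 0\<^sub>v (Suc n)"
        using orth_negative_positive[OF xc _ x(3)] less.prems by (auto simp: frame_def r_def)
      then show False using x(2) by simp
    qed
    define u where "u = complex_of_real (1 / sqrt r) \<cdot>\<^sub>v x"
    have hu: "herm n u y = complex_of_real (1 / sqrt r) * herm n x y" for y
      unfolding u_def by (rule herm_smult_left[OF xc])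
    have "herm n u u = complex_of_real (1 / sqrt r) * (cnj (complex_of_real (1 / sqrt r)) * complex_of_real r)"
      unfolding hu by (simp add: u_def herm_smult_right[OF xc] hx)
    also have "\<dots> = complex_of_real (1 / sqrt r * (1 / sqrt r * r))"
      by (simp only: of_real_mult complex_cnj_complex_of_real)
    also have "1 / sqrt r * (1 / sqrt r * r) = 1" using r by (simp add: field_simps)
    finally have uu: "herm n u u = 1" by simp
    have "u \<in> carrier_vec (Suc n)" unfolding u_def using xc by simp
    then have fr: "frame n (u # us) f"
      by (rule frame_Cons[OF less.prems _ uu]) (use x in \<open>simp_all add: hu\<close>)
    have "n - length (u # us) < n - length us" using frame_length[OF fr] by simp
    from less.hyps[OF this fr] obtain vs where vs: "set vs \<subseteq> X" "frame n (vs @ u # us) f"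
      "\<forall>x\<in>X. (\<forall>u\<in>set (vs @ u # us). herm n x u = 0) \<and> herm n x f = 0 \<longrightarrow> x = 0\<^sub>v (Suc n)" by blast
    have "u \<in> X" unfolding u_def by (rule cone[OF x(1)])
    then show ?thesis using vs by (intro exI[of _ "vs @ [u]"]) simp
  qed
qed

lemma frame_extend_full:
  assumes "frame n us f"
  shows "\<exists>vs. frame n (vs @ us) f \<and> length (vs @ us) = n"
proof -
  obtain vs where vs: "frame n (vs @ us) f"
    "\<forall>x\<in>carrier_vec (Suc n). (\<forall>u\<in>set (vs @ us). herm n x u = 0) \<and> herm n x f = 0 \<longrightarrow> x = 0\<^sub>v (Suc n)"
    using frame_extend[OF assms, of "carrier_vec (Suc n)"] by auto
  have "\<not> length (vs @ us) < n"
  proof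
    assume "length (vs @ us) < n"
    then have "length (f # vs @ us) \<le> n" by simp
    from orthogonal_vector_exists[OF this] show False using vs(2) by auto
  qed
  then show ?thesis using vs(1) frame_length[OF vs(1)] by (intro exI[of _ vs]) simp
qed

section \<open>Conjugation into frame coordinates\<close>

lemma hadj_mult:
  assumes A: "A \<in> carrier_mat (Suc n) (Suc n)" and B: "B \<in> carrier_mat (Suc n) (Suc n)"
  shows "hadj n (A * B) = hadj n B * hadj n A"
proof (rule eq_matI)
  fix i j assume "i < dim_row (hadj n B * hadj n A)" "j < dim_col (hadj n B * hadj n A)"
  then have ij: "i \<le> n" "j \<le> n" by (auto simp: hadj_def)
  show "hadj n (A * B) $$ (i,j) = (hadj n B * hadj n A) $$ (i,j)"
    unfolding mat_mult_index[OF hadj_carrier hadj_carrier ij]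
    using ij mat_mult_index[OF A B ij(2,1)]
    by (simp add: hadj_def sum_distrib_left mult_ac)
qed (auto simp: hadj_def)

lemma frame_conjugate_SU_n1:
  assumes fr: "frame n us f" "length us = n" and g: "g \<in> SU_n1 n"
  shows "hadj n (frame_mat n us f) * g * frame_mat n us f \<in> SU_n1 n"
proof -
  let ?B = "frame_mat n us f" and ?C = "hadj n (frame_mat n us f)"
  note gc = SU_n1_carrier[OF g] and Bc = frame_mat_carrier[of n us f] and Cc = hadj_carrier[of n ?B]
  have Cg: "?C * g \<in> carrier_mat (Suc n) (Suc n)" by (rule mult_carrier_mat[OF Cc gc])
  have Dc: "?C * g * ?B \<in> carrier_mat (Suc n) (Suc n)" by (rule mult_carrier_mat[OF Cg Bc])
  have "det ?C * det ?B = 1"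
    using det_mult[OF Cc Bc] unfolding frame_mat_isometry[OF fr] by simp
  moreover have "det g = 1" using g by (simp add: SU_n1_def)
  ultimately have det: "det (?C * g * ?B) = 1"
    unfolding det_mult[OF Cg Bc] det_mult[OF Cc gc] by simp
  have hg: "hadj n g * g = 1\<^sub>m (Suc n)" by (rule hadj_left_inverse[OF g])
  have "hadj n (?C * g * ?B) * (?C * g * ?B) = (?C * (hadj n g * ?B)) * ((?C * g) * ?B)"
    unfolding hadj_mult[OF Cg Bc] hadj_mult[OF Cc gc] hadj_hadj[OF Bc] ..
  also have "\<dots> = ?C * ((hadj n g * ?B) * ((?C * g) * ?B))"
    by (rule assoc_mult_mat[OF Cc mult_carrier_mat[OF hadj_carrier Bc] mult_carrier_mat[OF Cg Bc]])
  also have "(hadj n g * ?B) * ((?C * g) * ?B) = hadj n g * (?B * ((?C * g) * ?B))"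
    by (rule assoc_mult_mat[OF hadj_carrier Bc mult_carrier_mat[OF Cg Bc]])
  also have "?B * ((?C * g) * ?B) = (?B * (?C * g)) * ?B"
    by (rule assoc_mult_mat[OF Bc Cg Bc, symmetric])
  also have "?B * (?C * g) = (?B * ?C) * g"
    by (rule assoc_mult_mat[OF Bc Cc gc, symmetric])
  also have "(?B * ?C) * g = g" unfolding frame_mat_isometry'[OF fr] by (rule left_mult_one_mat[OF gc])
  also have "hadj n g * (g * ?B) = (hadj n g * g) * ?B"
    by (rule assoc_mult_mat[OF hadj_carrier gc Bc, symmetric])
  also have "(hadj n g * g) * ?B = ?B" unfolding hg by (rule left_mult_one_mat[OF Bc])
  also have "?C * ?B = 1\<^sub>m (Suc n)" by (rule frame_mat_isometry[OF fr])
  finally show ?thesis using adj_Ipq_iff[OF Dc] Dc det by (simp add: SU_n1_def)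
qed

lemma frame_conjugate_index:
  assumes fr: "frame n us f" "length us = n" and g: "g \<in> SU_n1 n" and ij: "i \<le> n" "j \<le> n"
  shows "(hadj n (frame_mat n us f) * g * frame_mat n us f) $$ (i,j)
    = sg n i * herm n (g *\<^sub>v (us @ [f]) ! j) ((us @ [f]) ! i)"
proof -
  let ?B = "frame_mat n us f" and ?e = "unit_vec (Suc n) j :: complex vec"
  note gc = SU_n1_carrier[OF g] and Bc = frame_mat_carrier[of n us f] and Cc = hadj_carrier[of n ?B]
  have Be: "?B *\<^sub>v ?e = (us @ [f]) ! j"
  proof (rule eq_vecI)
    fix l assume "l < dim_vec ((us @ [f]) ! j)"
    then have "l \<le> n" using frame_carrier[OF fr ij(2)] by simp
    then show "(?B *\<^sub>v ?e) $ l = (us @ [f]) ! j $ l"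
      unfolding mat_unit_vec_index[OF Bc \<open>l \<le> n\<close> ij(2)] using ij by (simp add: frame_mat_def)
  qed (use frame_carrier[OF fr ij(2)] in \<open>simp add: frame_mat_def\<close>)
  have "(hadj n ?B * g * ?B) $$ (i,j) = ((hadj n ?B * g * ?B) *\<^sub>v ?e) $ i"
    by (rule mat_unit_vec_index[symmetric, OF mult_carrier_mat[OF mult_carrier_mat[OF Cc gc] Bc] ij])
  also have "(hadj n ?B * g * ?B) *\<^sub>v ?e = (hadj n ?B * g) *\<^sub>v (?B *\<^sub>v ?e)"
    by (rule assoc_mult_mat_vec[OF mult_carrier_mat[OF Cc gc] Bc unit_vec_carrier])
  also have "\<dots> = hadj n ?B *\<^sub>v (g *\<^sub>v (us @ [f]) ! j)"
    unfolding Be by (rule assoc_mult_mat_vec[OF Cc gc frame_carrier[OF fr ij(2)]])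
  also have "\<dots> $ i = sg n i * herm n (g *\<^sub>v (us @ [f]) ! j) ((us @ [f]) ! i)"
    by (rule hadj_frame_mat_vec[OF mult_vec_carrier[OF g frame_carrier[OF fr ij(2)]] ij(1)])
  finally show ?thesis .
qed

lemma unimodular_root:
  assumes "cmod w = 1"
  shows "\<exists>c. cmod c = 1 \<and> c ^ Suc n = w"
proof (intro exI conjI)
  let ?c = "cis (Arg w / real (Suc n))"
  show "cmod ?c = 1" by simp
  have "?c ^ Suc n = cis (real (Suc n) * (Arg w / real (Suc n)))" by (rule DeMoivre)
  also have "\<dots> = cis (Arg w)" by (simp del: of_nat_Suc)
  also have "\<dots> = w" using assms by (cases "w = 0") (auto simp: cis_Arg sgn_div_norm)
  finally show "?c ^ Suc n = w" .
qed

text \<open>The inverse of the frame matrix preserves the form, but \<open>conj_into\<close> asks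
  for determinant one. Multiplying it by an (n+1)-th root of the unimodular number
  \<open>det\<close> of the frame matrix corrects this, and a scalar does not affect
  conjugation.\<close>

lemma frame_conjugator:
  assumes fr: "frame n us f" "length us = n"
  shows "\<exists>A\<in>SU_n1 n. \<forall>g\<in>SU_n1 n. A * g = (hadj n (frame_mat n us f) * g * frame_mat n us f) * A"
proof -
  let ?B = "frame_mat n us f" and ?C = "hadj n (frame_mat n us f)"
  note Bc = frame_mat_carrier[of n us f] and Cc = hadj_carrier[of n ?B]
  have prod: "det ?C * det ?B = 1"
    using det_mult[OF Cc Bc] unfolding frame_mat_isometry[OF fr] by simp
  have "cmod (det ?B) = 1"
    by (rule Ipq_preserving_det[OF Bc]) (simp add: adj_Ipq_iff[OF Bc] frame_mat_isometry[OF fr])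
  then obtain c where c: "cmod c = 1" "c ^ Suc n = det ?B" using unimodular_root by blast
  define A where "A = c \<cdot>\<^sub>m ?C"
  have Ac: "A \<in> carrier_mat (Suc n) (Suc n)" by (simp add: A_def)
  have "det A = c ^ Suc n * det ?C" unfolding A_def det_smult by (simp add: hadj_def)
  then have detA: "det A = 1" using c(2) prod by (simp add: mult.commute)
  have cc: "cnj c * c = 1" using c(1) by (metis complex_norm_square mult.commute of_real_1 one_power2)
  have "hadj n A = cnj c \<cdot>\<^sub>m ?B"
    by (rule eq_matI) (auto simp: A_def hadj_def frame_mat_def)
  then have "hadj n A * A = (cnj c \<cdot>\<^sub>m ?B) * (c \<cdot>\<^sub>m ?C)" by (simp add: A_def)
  also have "\<dots> = cnj c \<cdot>\<^sub>m (?B * (c \<cdot>\<^sub>m ?C))" by (rule mult_smult_assoc_mat[OF Bc smult_carrier_mat[OF Cc]])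
  also have "?B * (c \<cdot>\<^sub>m ?C) = c \<cdot>\<^sub>m (?B * ?C)" by (rule mult_smult_distrib[OF Bc Cc])
  also have "cnj c \<cdot>\<^sub>m (c \<cdot>\<^sub>m (?B * ?C)) = 1\<^sub>m (Suc n)"
    unfolding frame_mat_isometry'[OF fr] by (rule eq_matI) (auto simp: cc simp flip: mult.assoc)
  finally have "A \<in> SU_n1 n" using adj_Ipq_iff[OF Ac] Ac detA by (simp add: SU_n1_def)
  moreover have "A * g = (?C * g * ?B) * A" if g: "g \<in> SU_n1 n" for g
  proof -
    note gc = SU_n1_carrier[OF g]
    have Cg: "?C * g \<in> carrier_mat (Suc n) (Suc n)" by (rule mult_carrier_mat[OF Cc gc])
    have "(?C * g * ?B) * A = c \<cdot>\<^sub>m ((?C * g * ?B) * ?C)"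
      unfolding A_def by (rule mult_smult_distrib[OF mult_carrier_mat[OF Cg Bc] Cc])
    also have "(?C * g * ?B) * ?C = (?C * g) * (?B * ?C)" by (rule assoc_mult_mat[OF Cg Bc Cc])
    also have "\<dots> = ?C * g" unfolding frame_mat_isometry'[OF fr] by (rule right_mult_one_mat[OF Cg])
    also have "c \<cdot>\<^sub>m (?C * g) = A * g" unfolding A_def by (rule mult_smult_assoc_mat[symmetric, OF Cc gc])
    finally show ?thesis by simp
  qed
  ultimately show ?thesis by blast
qed

text \<open>With vanishing cross entries the orthogonality relations of the columns split. In the
  first k rows all signs are +1, which gives a unitary block; the shift by k puts the negative
  direction n at the last index of B.\<close>

lemma block_decomposition:
  assumes D: "D \<in> SU_n1 n" and k: "k \<le> n"
    and zero: "\<And>i j. i < k \<Longrightarrow> k \<le> j \<Longrightarrow> j \<le> n \<Longrightarrow> D $$ (i,j) = 0 \<and> D $$ (j,i) = 0"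
  defines "A \<equiv> mat k k (\<lambda>(i,j). D $$ (i,j))"
    and "B \<equiv> mat (Suc (n - k)) (Suc (n - k)) (\<lambda>(i,j). D $$ (i + k, j + k))"
  shows "D = block_diag A B" "A \<in> U k" "adj B * Ipq (n - k) * B = Ipq (n - k)" "det A * det B = 1"
proof -
  note Dc = SU_n1_carrier[OF D]
  have Ac: "A \<in> carrier_mat k k" and Bc: "B \<in> carrier_mat (Suc (n - k)) (Suc (n - k))"
    by (simp_all add: A_def B_def)
  show DAB: "D = block_diag A B"
  proof (rule eq_matI)
    fix i j assume "i < dim_row (block_diag A B)" "j < dim_col (block_diag A B)"
    then have ij: "i \<le> n" "j \<le> n" using k by (auto simp: block_diag_def A_def B_def)
    show "D $$ (i,j) = block_diag A B $$ (i,j)"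
      using ij k zero[of i j] zero[of j i] by (auto simp: block_diag_def A_def B_def)
  qed (use Dc k in \<open>auto simp: block_diag_def A_def B_def\<close>)
  have orth: "(\<Sum>l\<le>n. sg n l * cnj (D $$ (l,i)) * D $$ (l,j)) = (if i = j then sg n i else 0)"
    if "i \<le> n" "j \<le> n" for i j
    using adj_Ipq_index[OF Dc that] Ipq_index[OF that] D by (simp add: SU_n1_def)
  have split: "(\<Sum>l\<le>n. F l) = (\<Sum>l<k. F l) + (\<Sum>l\<le>n-k. F (l + k))" for F :: "nat \<Rightarrow> complex"
  proof -
    have "{..n} = {..<k} \<union> {k..n}" using k by auto
    then have "(\<Sum>l\<le>n. F l) = (\<Sum>l<k. F l) + (\<Sum>l\<in>{k..n}. F l)"
      by (simp add: sum.union_disjoint ivl_disj_int)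
    also have "(\<Sum>l\<in>{k..n}. F l) = (\<Sum>l\<le>n-k. F (l + k))"
      using k by (intro sum.reindex_bij_witness[of _ "\<lambda>l. l + k" "\<lambda>l. l - k"]) auto
    finally show ?thesis .
  qed
  show "A \<in> U k"
  proof -
    have "adj A * A = 1\<^sub>m k"
    proof (rule eq_matI)
      fix i j assume "i < dim_row (1\<^sub>m k :: complex mat)" "j < dim_col (1\<^sub>m k :: complex mat)"
      then have ij: "i < k" "j < k" by auto
      have "(adj A * A) $$ (i,j) = (\<Sum>l<k. sg n l * cnj (D $$ (l,i)) * D $$ (l,j))"
        using ij k by (auto simp: adj_def A_def scalar_prod_def atLeast0LessThan sg_def intro!: sum.cong)
      also have "\<dots> = (\<Sum>l\<le>n. sg n l * cnj (D $$ (l,i)) * D $$ (l,j))"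
        unfolding split using ij zero k by simp
      also have "\<dots> = 1\<^sub>m k $$ (i,j)"
        using orth[of i j] ij k by (auto simp: sg_def)
      finally show "(adj A * A) $$ (i,j) = 1\<^sub>m k $$ (i,j)" .
    qed (auto simp: adj_def A_def)
    then show ?thesis using Ac by (simp add: U_def)
  qed
  show "adj B * Ipq (n - k) * B = Ipq (n - k)"
  proof (rule eq_matI)
    fix i j assume "i < dim_row (Ipq (n - k) :: complex mat)" "j < dim_col (Ipq (n - k) :: complex mat)"
    then have ij: "i \<le> n - k" "j \<le> n - k" by (auto simp: Ipq_def)
    have "(adj B * Ipq (n - k) * B) $$ (i,j) = (\<Sum>l\<le>n-k. sg n (l + k) * cnj (D $$ (l + k,i + k)) * D $$ (l + k,j + k))"
      unfolding adj_Ipq_index[OF Bc ij]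
      using ij k by (intro sum.cong refl) (auto simp: B_def sg_def)
    also have "\<dots> = (\<Sum>l\<le>n. sg n l * cnj (D $$ (l,i + k)) * D $$ (l,j + k))"
      unfolding split using ij zero k by simp
    also have "\<dots> = Ipq (n - k) $$ (i,j)"
      using orth[of "i + k" "j + k"] ij k by (auto simp: Ipq_index sg_def)
    finally show "(adj B * Ipq (n - k) * B) $$ (i,j) = Ipq (n - k) $$ (i,j)" .
  qed (auto simp: adj_def B_def Ipq_def)
  have "det D = det A * det B"
    unfolding DAB block_diag_def using Ac Bc by (intro det_four_block_mat_lower_left_zero) auto
  then show "det A * det B = 1" using D by (simp add: SU_n1_def)
qed

lemma real_Ipq_preserving_in_O_m1:
  assumes B: "B \<in> carrier_mat (Suc m) (Suc m)" "adj B * Ipq m * B = Ipq m"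
    and real: "\<And>i j. i \<le> m \<Longrightarrow> j \<le> m \<Longrightarrow> B $$ (i,j) \<in> \<real>"
  shows "B \<in> O_m1 m"
proof -
  define R where "R = map_mat Re B"
  have Rc: "R \<in> carrier_mat (Suc m) (Suc m)" using B by (simp add: R_def)
  have BR: "B = map_mat complex_of_real R"
    using B(1) real by (intro eq_matI) (auto simp: R_def complex_is_Real_iff complex_eq_iff)
  have aR: "adj B = map_mat complex_of_real (transpose_mat R)"
    unfolding BR by (rule eq_matI) (use Rc in \<open>auto simp: adj_def\<close>)
  have I: "Ipq m = map_mat complex_of_real (Ipq m)" by (rule eq_matI) (auto simp: Ipq_def)
  have "map_mat complex_of_real (transpose_mat R * Ipq m * R) = adj B * Ipq m * B"
  proof -
    have "map_mat complex_of_real (transpose_mat R * Ipq m * R)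
        = map_mat complex_of_real (transpose_mat R * Ipq m) * map_mat complex_of_real R"
      by (rule of_real_hom.mat_hom_mult[OF mult_carrier_mat[OF _ Ipq_carrier] Rc]) (use Rc in simp)
    also have "map_mat complex_of_real (transpose_mat R * Ipq m) = map_mat complex_of_real (transpose_mat R) * map_mat complex_of_real (Ipq m)"
      by (rule of_real_hom.mat_hom_mult[OF _ Ipq_carrier]) (use Rc in simp)
    finally show ?thesis unfolding aR BR[symmetric] I[symmetric] .
  qed
  also have "\<dots> = map_mat complex_of_real (Ipq m)" using B(2) I by simp
  finally have "transpose_mat R * Ipq m * R = Ipq m" by (rule of_real_hom.mat_hom_inj)
  then show ?thesis using Rc BR by (auto simp: O_m1_def)
qed

text \<open>\<open>inv\<close> says that every g keeps the span of the frame vectors from position k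
  on; applied to the inverse of g it also kills the other off-diagonal block. \<open>target\<close>
  receives what is known of the two blocks, including the entries of B, so that each case only has
  to recognise its own group.\<close>

lemma frame_block_form:
  assumes sub: "is_subgroup_of G n" and fr: "frame n us f" "length us = n" and k: "k \<le> n"
    and inv: "\<And>g i j. g \<in> G \<Longrightarrow> i < k \<Longrightarrow> k \<le> j \<Longrightarrow> j \<le> n \<Longrightarrow>
      herm n (g *\<^sub>v (us @ [f]) ! j) ((us @ [f]) ! i) = 0"
    and target: "\<And>g A B. g \<in> G \<Longrightarrow> A \<in> U k \<Longrightarrow> B \<in> carrier_mat (Suc (n - k)) (Suc (n - k)) \<Longrightarrow>
      adj B * Ipq (n - k) * B = Ipq (n - k) \<Longrightarrow> det A * det B = 1 \<Longrightarrow> det (block_diag A B) = 1 \<Longrightarrow>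
      (\<And>i j. i \<le> n - k \<Longrightarrow> j \<le> n - k \<Longrightarrow>
        B $$ (i,j) = sg n (i + k) * herm n (g *\<^sub>v (us @ [f]) ! (j + k)) ((us @ [f]) ! (i + k))) \<Longrightarrow>
      block_diag A B \<in> H"
  shows "conj_into n G H"
proof -
  note G = subgroup_facts[OF sub]
  obtain C where C: "C \<in> SU_n1 n"
    "\<And>g. g \<in> SU_n1 n \<Longrightarrow> C * g = (hadj n (frame_mat n us f) * g * frame_mat n us f) * C"
    using frame_conjugator[OF fr] by blast
  have "hadj n (frame_mat n us f) * g * frame_mat n us f \<in> H" if g: "g \<in> G" for g
  proof -
    define D where "D = hadj n (frame_mat n us f) * g * frame_mat n us f"
    have DS: "D \<in> SU_n1 n" unfolding D_def by (rule frame_conjugate_SU_n1[OF fr G(1)[OF g]])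
    have ix: "D $$ (i,j) = sg n i * herm n (g *\<^sub>v (us @ [f]) ! j) ((us @ [f]) ! i)" if "i \<le> n" "j \<le> n" for i j
      unfolding D_def by (rule frame_conjugate_index[OF fr G(1)[OF g] that])
    have zero: "D $$ (i,j) = 0 \<and> D $$ (j,i) = 0" if ij: "i < k" "k \<le> j" "j \<le> n" for i j
    proof -
      have i: "i \<le> n" using ij by simp
      note bi = frame_carrier[OF fr i] and bj = frame_carrier[OF fr ij(3)]
      have "herm n (g *\<^sub>v (us @ [f]) ! i) ((us @ [f]) ! j) = cnj (herm n (hadj n g *\<^sub>v (us @ [f]) ! j) ((us @ [f]) ! i))"
        unfolding herm_cnj by (rule herm_hadj[OF SU_n1_carrier[OF G(1)[OF g]] bi bj])
      then show ?thesis using inv[OF g ij] inv[OF G(3)[OF g] ij] ix[OF i ij(3)] ix[OF ij(3) i] by simp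
    qed
    let ?A = "mat k k (\<lambda>(i,j). D $$ (i,j))"
      and ?B = "mat (Suc (n - k)) (Suc (n - k)) (\<lambda>(i,j). D $$ (i + k, j + k))"
    note bd = block_decomposition[OF DS k zero]
    have "block_diag ?A ?B \<in> H"
    proof (rule target[OF g])
      show "?A \<in> U k" "adj ?B * Ipq (n - k) * ?B = Ipq (n - k)" "det ?A * det ?B = 1"
        using bd by blast+
      show "det (block_diag ?A ?B) = 1" using bd(1) DS by (simp add: SU_n1_def)
      show "?B \<in> carrier_mat (Suc (n - k)) (Suc (n - k))" by simp
      show "?B $$ (i,j) = sg n (i + k) * herm n (g *\<^sub>v (us @ [f]) ! (j + k)) ((us @ [f]) ! (i + k))"
        if "i \<le> n - k" "j \<le> n - k" for i j
        using that k ix[of "i + k" "j + k"] by simp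
    qed
    then show ?thesis using bd(1) unfolding D_def by simp
  qed
  then show ?thesis unfolding conj_into_def using C G(1) by blast
qed

text \<open>Subtracting from x its projections onto the frame vectors changes no pairing with v. The
  coefficients are real, so the remainder stays in W; being orthogonal to the frame, it is zero by
  \<open>complete\<close>. The vector v itself may lie outside W.\<close>

lemma frame_span_orthogonal:
  assumes fr: "frame n us f" and W: "W \<subseteq> carrier_vec (Suc n)"
    and add: "\<And>x y. x \<in> W \<Longrightarrow> y \<in> W \<Longrightarrow> x + y \<in> W"
    and scale: "\<And>r x. x \<in> W \<Longrightarrow> complex_of_real r \<cdot>\<^sub>v x \<in> W"
    and real: "\<And>x y. x \<in> W \<Longrightarrow> y \<in> W \<Longrightarrow> herm n x y \<in> \<real>"
    and us: "set us \<subseteq> W" "f \<in> W"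
    and complete: "\<And>x. x \<in> W \<Longrightarrow> (\<And>u. u \<in> set us \<Longrightarrow> herm n x u = 0) \<Longrightarrow> herm n x f = 0 \<Longrightarrow> x = 0\<^sub>v (Suc n)"
    and v: "\<And>u. u \<in> set us \<Longrightarrow> herm n u v = 0" "herm n f v = 0"
    and x: "x \<in> W"
  shows "herm n x v = 0"
proof -
  have sub: "x + (- herm n x u) \<cdot>\<^sub>v u \<in> W" "x + herm n x u \<cdot>\<^sub>v u \<in> W" if xu: "x \<in> W" "u \<in> W" for x u
  proof -
    obtain r where r: "herm n x u = complex_of_real r" using real[OF xu] by (auto elim: Reals_cases)
    show "x + herm n x u \<cdot>\<^sub>v u \<in> W" unfolding r by (rule add[OF xu(1) scale[OF xu(2)]])
    have "complex_of_real (- r) \<cdot>\<^sub>v u \<in> W" by (rule scale[OF xu(2)])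
    then show "x + (- herm n x u) \<cdot>\<^sub>v u \<in> W" unfolding r by (simp add: add[OF xu(1)])
  qed
  have herm_comb: "herm n (x + c \<cdot>\<^sub>v u) y = herm n x y + c * herm n u y" if "x \<in> W" "u \<in> W" for x u c y
    using that W by (simp add: herm_add_left herm_smult_left subset_iff)
  have fc: "f \<in> W" and ff: "herm n f f = -1" using us fr by (auto simp: frame_def)
  have uf: "herm n u f = 0" "herm n f u = 0" if "u \<in> set us" for u
  proof -
    show "herm n u f = 0" using fr that by (auto simp: frame_def)
    then show "herm n f u = 0" by (metis herm_cnj complex_cnj_zero)
  qed
  have "\<exists>y\<in>W. (\<forall>i<k. herm n y (us ! i) = 0) \<and> herm n y f = 0 \<and> herm n y v = herm n x v"
    if "k \<le> length us" for k
    using that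
  proof (induction k)
    \<comment> \<open>The projection along f is removed with a plus sign because \<langle>f,
      f\<rangle> = -1.\<close>
    case 0
    show ?case
      by (rule bexI[of _ "x + herm n x f \<cdot>\<^sub>v f"]) (use x fc v(2) ff sub(2) in \<open>auto simp: herm_comb\<close>)
  next
    case (Suc k)
    then obtain y where y: "y \<in> W" "\<And>i. i < k \<Longrightarrow> herm n y (us ! i) = 0" "herm n y f = 0" "herm n y v = herm n x v"
      by auto
    have k: "us ! k \<in> set us" using Suc.prems by simp
    then have kW: "us ! k \<in> W" using us by blast
    have "herm n (y + (- herm n y (us ! k)) \<cdot>\<^sub>v us ! k) (us ! i) = 0" if "i < Suc k" for i
    proof -
      have "herm n (us ! k) (us ! i) = (if k = i then 1 else 0)"
        using fr that Suc.prems by (auto simp: frame_def)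
      then show ?thesis using that y(2)[of i] by (auto simp: herm_comb[OF y(1) kW] less_Suc_eq)
    qed
    moreover have "herm n (y + (- herm n y (us ! k)) \<cdot>\<^sub>v us ! k) f = 0"
      unfolding herm_comb[OF y(1) kW] using y(3) uf[OF k] by simp
    moreover have "herm n (y + (- herm n y (us ! k)) \<cdot>\<^sub>v us ! k) v = herm n x v"
      unfolding herm_comb[OF y(1) kW] using y(4) v(1)[OF k] by simp
    ultimately show ?case using sub(1)[OF y(1) kW] by blast
  qed
  from this[OF order_refl] obtain y where y: "y \<in> W" "\<And>i. i < length us \<Longrightarrow> herm n y (us ! i) = 0"
    "herm n y f = 0" "herm n y v = herm n x v" by blast
  have "y = 0\<^sub>v (Suc n)" using complete[OF y(1) _ y(3)] y(2) by (auto simp: in_set_conv_nth)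
  then show ?thesis using y(4) by simp
qed

text \<open>Sums and real multiples suffice, as negatives are real multiples. The inductive form
  lets reality of the form and invariance under the group be proved by rule induction from the
  generators.\<close>

inductive_set real_span :: "complex vec set \<Rightarrow> complex vec set" for S where
  base: "x \<in> S \<Longrightarrow> x \<in> real_span S"
| add: "x \<in> real_span S \<Longrightarrow> y \<in> real_span S \<Longrightarrow> x + y \<in> real_span S"
| scale: "x \<in> real_span S \<Longrightarrow> complex_of_real r \<cdot>\<^sub>v x \<in> real_span S"

lemma real_span_carrier:
  assumes "S \<subseteq> carrier_vec m"
  shows "real_span S \<subseteq> carrier_vec m"
proof
  fix x assume "x \<in> real_span S"
  then show "x \<in> carrier_vec m" by induction (use assms in auto)
qed

lemma real_span_herm_real:
  assumes S: "S \<subseteq> carrier_vec (Suc n)" "\<And>x y. x \<in> S \<Longrightarrow> y \<in> S \<Longrightarrow> herm n x y \<in> \<real>"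
    and x: "x \<in> real_span S" and y: "y \<in> real_span S"
  shows "herm n x y \<in> \<real>"
proof -
  note c = subsetD[OF real_span_carrier[OF S(1)]]
  have 1: "herm n x y \<in> \<real>" if y: "y \<in> S" for y
    using x
  proof induction
    case (base x) then show ?case using S(2) y by blast
  next
    case (add a b) then show ?case unfolding herm_add_left[OF c c, OF add.hyps] by simp
  next
    case (scale a r) then show ?case unfolding herm_smult_left[OF c, OF scale.hyps] by simp
  qed
  show ?thesis
    using y
  proof induction
    case (base y) then show ?case by (rule 1)
  next
    case (add a b) then show ?case unfolding herm_add_right[OF c c, OF add.hyps] by simp
  next
    case (scale a r) then show ?case unfolding herm_smult_right[OF c, OF scale.hyps] by simp
  qed
qed

lemma real_span_invariant:
  assumes g: "g \<in> SU_n1 n" and S: "S \<subseteq> carrier_vec (Suc n)" "\<And>x. x \<in> S \<Longrightarrow> g *\<^sub>v x \<in> S"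
    and x: "x \<in> real_span S"
  shows "g *\<^sub>v x \<in> real_span S"
  using x
proof induction
  case (base x) then show ?case by (intro real_span.base S)
next
  case (add a b)
  note c = subsetD[OF real_span_carrier[OF S(1)]]
  show ?case unfolding mult_vec_add[OF g c c, OF add.hyps] by (rule real_span.add[OF add.IH])
next
  case (scale a r)
  note c = subsetD[OF real_span_carrier[OF S(1)]]
  show ?case unfolding mult_vec_smult[OF g c, OF scale.hyps] by (rule real_span.scale[OF scale.IH])
qed

lemma inverse_sqrt2_square:
  "complex_of_real (1 / sqrt 2) * complex_of_real (1 / sqrt 2) = 1 / 2"
  "cnj (complex_of_real (1 / sqrt 2)) = complex_of_real (1 / sqrt 2)"
proof -
  have r: "1 / sqrt 2 * (1 / sqrt 2) = (1 / 2 :: real)" by simp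
  show "complex_of_real (1 / sqrt 2) * complex_of_real (1 / sqrt 2) = 1 / 2"
    unfolding of_real_mult[symmetric] r by simp
qed simp

text \<open>The vectors p + q and p - q are orthogonal with norms 2 and -2. The difference is
  written with the real multiple -1 so that closure of a real span under sums and real multiples
  applies to it.\<close>

lemma hyperbolic_pair_frame:
  assumes p: "p \<in> carrier_vec (Suc n)" "herm n p p = 0" and q: "q \<in> carrier_vec (Suc n)" "herm n q q = 0"
    and pq: "herm n p q = 1"
  defines "f1 \<equiv> complex_of_real (1 / sqrt 2) \<cdot>\<^sub>v (p + q)"
    and "f0 \<equiv> complex_of_real (1 / sqrt 2) \<cdot>\<^sub>v (p + complex_of_real (- 1) \<cdot>\<^sub>v q)"
  shows "frame n [f1] f0"
proof -
  have qp: "herm n q p = 1" using pq by (metis herm_cnj complex_cnj_one)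
  define s where "s = complex_of_real (1 / sqrt 2)"
  have s: "s * s = 1 / 2" "cnj s = s" unfolding s_def by (rule inverse_sqrt2_square)+
  have "herm n f1 f1 = 2 * (s * s)" "herm n f1 f0 = 0" "herm n f0 f0 = - 2 * (s * s)"
    unfolding f1_def f0_def s_def[symmetric] using p q pq qp s(2) by (simp_all add: herm_lin)
  then have "herm n f1 f1 = 1" "herm n f1 f0 = 0" "herm n f0 f0 = -1" by (simp_all add: s(1))
  then show ?thesis using p q by (simp add: frame_def f1_def f0_def)
qed

section \<open>The two cases\<close>

lemma det_2x2:
  fixes M :: "complex mat"
  assumes M: "M \<in> carrier_mat 2 2"
  shows "det M = M $$ (0,0) * M $$ (1,1) - M $$ (0,1) * M $$ (1,0)"
proof -
  have d: "det (mat_delete M 0 0) = M $$ (1,1)" "det (mat_delete M 1 0) = M $$ (0,1)"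
    using M det_single[of "mat_delete M 0 0"] det_single[of "mat_delete M 1 0"] by (simp_all add: mat_delete_def)
  have two: "{..<2} = {0, 1::nat}" by auto
  have "det M = (\<Sum>i<2. M $$ (i,0) * cofactor M i 0)"
    by (rule laplace_expansion_column[OF M]) simp
  also have "\<dots> = M $$ (0,0) * cofactor M 0 0 + M $$ (1,0) * cofactor M 1 0"
    unfolding two by simp
  finally show ?thesis unfolding cofactor_def d by simp
qed

text \<open>Moving g' across the form as its inverse lets a condition on the numbers \<langle>g p,
  p\<rangle> cover all pairs of orbit points.\<close>

lemma orbit_pairing:
  assumes sub: "is_subgroup_of G n" and p: "p \<in> carrier_vec (Suc n)" and g: "g \<in> G" "g' \<in> G"
  shows "herm n (g *\<^sub>v p) (g' *\<^sub>v p) = herm n ((hadj n g' * g) *\<^sub>v p) p"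
proof -
  note G = subgroup_facts[OF sub]
  have "herm n ((hadj n g' * g) *\<^sub>v p) p = herm n (hadj n g' *\<^sub>v (g *\<^sub>v p)) p"
    unfolding mult_mat_vec_assoc[OF G(1)[OF G(3)[OF g(2)]] G(1)[OF g(1)] p] ..
  also have "\<dots> = herm n (g *\<^sub>v p) (g' *\<^sub>v p)"
    unfolding herm_hadj[OF hadj_carrier mult_vec_carrier[OF G(1)[OF g(1)] p] p]
      hadj_hadj[OF SU_n1_carrier[OF G(1)[OF g(2)]]] ..
  finally show ?thesis by simp
qed

text \<open>If g p = a p + b q with a and b real, nullity reads 2 a b = 0, so g p lies on the line
  of p or of q. As q is a multiple of an orbit vector, the same holds for g q, and \<langle>p,
  q\<rangle> \<noteq> 0 keeps the two images on different lines. The pair of lines is thus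
  permuted.\<close>

lemma hyperbolic_plane_real_elementary:
  assumes sub: "is_subgroup_of G n" and ne: "nonelementary n G"
    and p: "p \<in> carrier_vec (Suc n)" "herm n p p = 0" "p \<noteq> 0\<^sub>v (Suc n)"
    and h: "h \<in> G" and q: "q = c \<cdot>\<^sub>v (h *\<^sub>v p)" "herm n p q = 1"
    and plane: "\<And>g. g \<in> G \<Longrightarrow> g *\<^sub>v p = herm n (g *\<^sub>v p) q \<cdot>\<^sub>v p + herm n (g *\<^sub>v p) p \<cdot>\<^sub>v q"
    and real: "\<And>g. g \<in> G \<Longrightarrow> herm n (g *\<^sub>v p) q \<in> \<real>" "\<And>g. g \<in> G \<Longrightarrow> herm n (g *\<^sub>v p) p \<in> \<real>"
  shows False
proof -
  note G = subgroup_facts[OF sub]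
  have hp: "h *\<^sub>v p \<in> carrier_vec (Suc n)" by (rule mult_vec_carrier[OF G(1)[OF h] p(1)])
  have qc: "q \<in> carrier_vec (Suc n)" unfolding q(1) using hp by simp
  have qq: "herm n q q = 0"
    unfolding q(1) herm_smult_left[OF hp] herm_smult_right[OF hp] herm_invariant[OF G(1)[OF h] p(1) p(1)] p(2) by simp
  have q0: "q \<noteq> 0\<^sub>v (Suc n)" using q(2) by auto
  have qp: "herm n q p = 1" using q(2) by (metis herm_cnj complex_cnj_one)
  have line: "(\<exists>a. g *\<^sub>v p = a \<cdot>\<^sub>v p) \<or> (\<exists>a. g *\<^sub>v p = a \<cdot>\<^sub>v q)" if g: "g \<in> G" for g
  proof -
    define a b where "a = herm n (g *\<^sub>v p) q" and "b = herm n (g *\<^sub>v p) p"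
    have gp: "g *\<^sub>v p = a \<cdot>\<^sub>v p + b \<cdot>\<^sub>v q" unfolding a_def b_def by (rule plane[OF g])
    have ab: "cnj a = a" "cnj b = b"
      using real[OF g] unfolding a_def b_def by (simp_all add: Reals_cnj_iff)
    have "herm n (g *\<^sub>v p) (g *\<^sub>v p) = 0"
      using herm_invariant[OF G(1)[OF g] p(1) p(1)] p(2) by simp
    then have "2 * (a * b) = 0"
      unfolding gp using p(1,2) qc qq q(2) qp ab by (simp add: herm_lin mult.commute)
    then consider "a = 0" | "b = 0" by auto
    then show ?thesis
    proof cases
      case 1 then have "g *\<^sub>v p = b \<cdot>\<^sub>v q" unfolding gp using p(1) qc by (intro eq_vecI) auto
      then show ?thesis by blast
    next
      case 2 then have "g *\<^sub>v p = a \<cdot>\<^sub>v p" unfolding gp using p(1) qc by (intro eq_vecI) auto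
      then show ?thesis by blast
    qed
  qed
  let ?e = "unit_vec (Suc n) n :: complex vec"
  have "cmod (herm n (g *\<^sub>v ?e) p) * cmod (herm n (g *\<^sub>v ?e) q) \<le> cmod (herm n ?e p) * cmod (herm n ?e q)"
    if g: "g \<in> G" for g
  proof -
    have hg: "hadj n g \<in> G" by (rule G(3)[OF g])
    have "hadj n g *\<^sub>v q = c \<cdot>\<^sub>v ((hadj n g * h) *\<^sub>v p)"
      unfolding q(1) mult_vec_smult[OF G(1)[OF hg] hp] mult_mat_vec_assoc[OF G(1)[OF hg] G(1)[OF h] p(1)] ..
    moreover obtain b' r where "(hadj n g * h) *\<^sub>v p = b' \<cdot>\<^sub>v r" and r: "r = p \<or> r = q"
      using line[OF G(2)[OF hg h]] by blast
    ultimately have gq: "hadj n g *\<^sub>v q = (c * b') \<cdot>\<^sub>v r" by (simp add: smult_smult_assoc)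
    obtain a r' where gp: "hadj n g *\<^sub>v p = a \<cdot>\<^sub>v r'" and r': "r' = p \<or> r' = q"
      using line[OF hg] by blast
    have "herm n (hadj n g *\<^sub>v p) (hadj n g *\<^sub>v q) = 1"
      unfolding herm_invariant[OF hadj_SU_n1[OF G(1)[OF g]] p(1) qc] by (rule q(2))
    then have rr: "r \<noteq> r'"
      unfolding gp gq using r r' p qc qq by (auto simp: herm_smult_left herm_smult_right)
    have pq: "herm n p q \<noteq> 0" using q(2) by simp
    have "hadj n g *\<^sub>v p = a \<cdot>\<^sub>v p \<and> hadj n g *\<^sub>v q = (c * b') \<cdot>\<^sub>v q \<or> hadj n g *\<^sub>v p = a \<cdot>\<^sub>v q \<and> hadj n g *\<^sub>v q = (c * b') \<cdot>\<^sub>v p"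
      unfolding gp gq using r r' rr by blast
    from herm_product_bound[OF G(1)[OF g] p(1) qc pq unit_vec_carrier this] show ?thesis by simp
  qed
  from elementary_by_two_null_lines[OF G(1) ne p qc qq q0 this] show False .
qed

text \<open>Write g p = a p + b q and g q = u p + v q. As c and all pairings of orbit vectors are
  imaginary, v is real and u imaginary, so 1 = \<langle>g p, g q\<rangle> = a cnj v + b cnj u = a v
  - b u. Invariance of the form is thus determinant one on the plane, and the complementary block
  then has determinant one as well.\<close>

lemma hyperbolic_plane_imaginary:
  assumes sub: "is_subgroup_of G n"
    and p: "p \<in> carrier_vec (Suc n)" "herm n p p = 0"
    and h: "h \<in> G" and q: "q = c \<cdot>\<^sub>v (h *\<^sub>v p)" "herm n p q = 1" and c: "Re c = 0"
    and plane: "\<And>g. g \<in> G \<Longrightarrow> g *\<^sub>v p = herm n (g *\<^sub>v p) q \<cdot>\<^sub>v p + herm n (g *\<^sub>v p) p \<cdot>\<^sub>v q"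
    and imag: "\<And>g. g \<in> G \<Longrightarrow> Re (herm n (g *\<^sub>v p) p) = 0"
  shows "conj_into n G (SU_SU11 n)"
proof -
  note G = subgroup_facts[OF sub]
  have hp: "h *\<^sub>v p \<in> carrier_vec (Suc n)" by (rule mult_vec_carrier[OF G(1)[OF h] p(1)])
  have qc: "q \<in> carrier_vec (Suc n)" unfolding q(1) using hp by simp
  have qq: "herm n q q = 0"
    unfolding q(1) herm_smult_left[OF hp] herm_smult_right[OF hp] herm_invariant[OF G(1)[OF h] p(1) p(1)] p(2) by simp
  have qp: "herm n q p = 1" using q(2) by (metis herm_cnj complex_cnj_one)
  have gc: "g *\<^sub>v p \<in> carrier_vec (Suc n)" "g *\<^sub>v q \<in> carrier_vec (Suc n)" if "g \<in> G" for g
    using G(1)[OF that] p(1) qc by simp_all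
  have gq: "g *\<^sub>v q = c \<cdot>\<^sub>v ((g * h) *\<^sub>v p)" if g: "g \<in> G" for g
    unfolding q(1) mult_vec_smult[OF G(1)[OF g] hp] mult_mat_vec_assoc[OF G(1)[OF g] G(1)[OF h] p(1)] ..
  have gq_herm: "herm n (g *\<^sub>v q) y = c * herm n ((g * h) *\<^sub>v p) y" if g: "g \<in> G" for g y
    unfolding gq[OF g] by (rule herm_smult_left[OF gc(1)[OF G(2)[OF g h]]])
  have herm_q: "herm n y q = cnj c * herm n y (h *\<^sub>v p)" for y
    unfolding q(1) by (rule herm_smult_right[OF hp])
  have planeq: "g *\<^sub>v q = herm n (g *\<^sub>v q) q \<cdot>\<^sub>v p + herm n (g *\<^sub>v q) p \<cdot>\<^sub>v q" if g: "g \<in> G" for g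
  proof -
    have "g *\<^sub>v q = c \<cdot>\<^sub>v (herm n ((g * h) *\<^sub>v p) q \<cdot>\<^sub>v p + herm n ((g * h) *\<^sub>v p) p \<cdot>\<^sub>v q)"
      unfolding gq[OF g] by (rule arg_cong[OF plane[OF G(2)[OF g h]]])
    also have "\<dots> = (c * herm n ((g * h) *\<^sub>v p) q) \<cdot>\<^sub>v p + (c * herm n ((g * h) *\<^sub>v p) p) \<cdot>\<^sub>v q"
      using p(1) qc by (simp add: smult_add_distrib_vec[of _ "Suc n"] smult_smult_assoc)
    finally show ?thesis unfolding gq_herm[OF g] .
  qed
  have imag': "Re (herm n (g *\<^sub>v p) (g' *\<^sub>v p)) = 0" if "g \<in> G" "g' \<in> G" for g g'
    unfolding orbit_pairing[OF sub p(1) that] by (rule imag[OF G(2)[OF G(3)[OF that(2)] that(1)]])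
  have area: "herm n (g *\<^sub>v p) q * herm n (g *\<^sub>v q) p - herm n (g *\<^sub>v p) p * herm n (g *\<^sub>v q) q = 1"
    if g: "g \<in> G" for g
  proof -
    define a b where "a = herm n (g *\<^sub>v p) q" and "b = herm n (g *\<^sub>v p) p"
    define u v where "u = herm n (g *\<^sub>v q) q" and "v = herm n (g *\<^sub>v q) p"
    have "Im v = 0"
      unfolding v_def gq_herm[OF g] using c imag[OF G(2)[OF g h]] by simp
    then have v: "cnj v = v" by (simp add: complex_eq_iff)
    have "Re u = 0"
      unfolding u_def gq_herm[OF g] herm_q using c imag'[OF G(2)[OF g h] h] by simp
    then have u: "cnj u = - u" by (simp add: complex_eq_iff)
    have gp: "g *\<^sub>v p = a \<cdot>\<^sub>v p + b \<cdot>\<^sub>v q" unfolding a_def b_def by (rule plane[OF g])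
    have gq': "g *\<^sub>v q = u \<cdot>\<^sub>v p + v \<cdot>\<^sub>v q" unfolding u_def v_def by (rule planeq[OF g])
    have "1 = herm n (g *\<^sub>v p) (g *\<^sub>v q)" using herm_invariant[OF G(1)[OF g] p(1) qc] q(2) by simp
    also have "\<dots> = a * cnj v + b * cnj u"
      unfolding gp gq' using p qc qq q(2) qp by (simp add: herm_lin)
    finally show ?thesis unfolding a_def[symmetric] b_def[symmetric] u_def[symmetric] v_def[symmetric] using u v by simp
  qed
  define s where "s = complex_of_real (1 / sqrt 2)"
  define f1 where "f1 = s \<cdot>\<^sub>v (p + q)"
  define f0 where "f0 = s \<cdot>\<^sub>v (p + complex_of_real (- 1) \<cdot>\<^sub>v q)"
  have half: "s * s = 1 / 2" "cnj s = s" unfolding s_def by (rule inverse_sqrt2_square)+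
  have s0: "s \<noteq> 0" using half(1) by auto
  have "frame n [f1] f0"
    unfolding f1_def f0_def s_def by (rule hyperbolic_pair_frame[OF p qc qq q(2)])
  then obtain vs where vs: "frame n (vs @ [f1]) f0" "length (vs @ [f1]) = n"
    using frame_extend_full by blast
  define k where "k = length vs"
  have kn: "n = Suc k" using vs(2) by (simp add: k_def)
  have nth1: "((vs @ [f1]) @ [f0]) ! i = vs ! i" if "i < k" for i
    using that by (simp add: nth_append k_def)
  have nth2: "((vs @ [f1]) @ [f0]) ! k = f1" "((vs @ [f1]) @ [f0]) ! Suc k = f0"
    by (simp_all add: nth_append k_def)
  have f_lin: "herm n f1 y = s * (herm n p y + herm n q y)" "herm n f0 y = s * (herm n p y - herm n q y)" for y
    unfolding f1_def f0_def using p qc by (simp_all add: herm_lin)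
  have f_lin': "herm n y f1 = s * (herm n y p + herm n y q)" "herm n y f0 = s * (herm n y p - herm n y q)" for y
    unfolding f1_def f0_def using p qc half(2) by (simp_all add: herm_lin)
  have gf: "herm n (g *\<^sub>v f1) y = s * (herm n (g *\<^sub>v p) y + herm n (g *\<^sub>v q) y)"
    "herm n (g *\<^sub>v f0) y = s * (herm n (g *\<^sub>v p) y - herm n (g *\<^sub>v q) y)" if g: "g \<in> G" for g y
    unfolding f1_def f0_def using p qc gc[OF g] G(1)[OF g]
    by (simp_all add: herm_lin mult_vec_smult mult_vec_add)
  have orth: "herm n p (vs ! i) = 0" "herm n q (vs ! i) = 0" if i: "i < k" for i
  proof -
    have "herm n (((vs @ [f1]) @ [f0]) ! k) (((vs @ [f1]) @ [f0]) ! i) = 0"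
      "herm n (((vs @ [f1]) @ [f0]) ! Suc k) (((vs @ [f1]) @ [f0]) ! i) = 0"
      using frame_herm[OF vs, of k i] frame_herm[OF vs, of "Suc k" i] i kn by simp_all
    then have "herm n p (vs ! i) + herm n q (vs ! i) = 0" "herm n p (vs ! i) - herm n q (vs ! i) = 0"
      using s0 unfolding nth1[OF i] nth2 f_lin by simp_all
    then show "herm n p (vs ! i) = 0" "herm n q (vs ! i) = 0" by (simp_all add: complex_eq_iff)
  qed
  have inv: "herm n (g *\<^sub>v ((vs @ [f1]) @ [f0]) ! j) (((vs @ [f1]) @ [f0]) ! i) = 0"
    if g: "g \<in> G" and i: "i < k" and j: "k \<le> j" "j \<le> n" for g i j
  proof -
    have gp: "herm n (g *\<^sub>v p) (vs ! i) = 0"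
      by (subst plane[OF g]) (use p qc orth[OF i] in \<open>simp add: herm_lin\<close>)
    have gq: "herm n (g *\<^sub>v q) (vs ! i) = 0"
      by (subst planeq[OF g]) (use p qc orth[OF i] in \<open>simp add: herm_lin\<close>)
    have "j = k \<or> j = Suc k" using j kn by auto
    then show ?thesis unfolding nth1[OF i] using nth2 gf[OF g] gp gq by auto
  qed
  show ?thesis
  proof (rule frame_block_form[OF sub vs _ inv])
    show "k \<le> n" using kn by simp
    fix g A B
    assume g: "g \<in> G" and A: "A \<in> U k" and B: "B \<in> carrier_mat (Suc (n - k)) (Suc (n - k))"
      "adj B * Ipq (n - k) * B = Ipq (n - k)" and det: "det A * det B = 1"
      and ix: "\<And>i j. i \<le> n - k \<Longrightarrow> j \<le> n - k \<Longrightarrow>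
        B $$ (i,j) = sg n (i + k) * herm n (g *\<^sub>v ((vs @ [f1]) @ [f0]) ! (j + k)) (((vs @ [f1]) @ [f0]) ! (i + k))"
    have nk: "n - k = 1" using kn by simp
    have B2: "B \<in> carrier_mat 2 2" using B(1) nk by (simp add: numeral_2_eq_2)
    have sgk: "sg n k = 1" "sg n (Suc k) = -1" using kn by (auto simp: sg_def)
    have entries: "B $$ (0,0) = herm n (g *\<^sub>v f1) f1" "B $$ (0,1) = herm n (g *\<^sub>v f0) f1"
      "B $$ (1,0) = - herm n (g *\<^sub>v f1) f0" "B $$ (1,1) = - herm n (g *\<^sub>v f0) f0"
      using ix[of 0 0] ix[of 0 1] ix[of 1 0] ix[of 1 1] nk nth2 sgk by simp_all
    define a b where "a = herm n (g *\<^sub>v p) q" and "b = herm n (g *\<^sub>v p) p"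
    define u v where "u = herm n (g *\<^sub>v q) q" and "v = herm n (g *\<^sub>v q) p"
    have ss: "s * (s * z) = z / 2" for z by (simp only: mult.assoc[symmetric] half) simp
    have e: "B $$ (0,0) = (b + a + v + u) / 2" "B $$ (0,1) = (b + a - v - u) / 2"
      "B $$ (1,0) = - (b - a + v - u) / 2" "B $$ (1,1) = - (b - a - v + u) / 2"
      unfolding entries gf[OF g] f_lin' a_def b_def u_def v_def distrib_left right_diff_distrib ss
      by (simp_all add: field_simps)
    \<comment> \<open>f1 and f0 form another basis of the plane of p and q, so the determinant of
      the block is the one found in \<open>area\<close>.\<close>
    have "det B = a * v - b * u" unfolding det_2x2[OF B2] e by (simp add: field_simps)
    also have "\<dots> = 1" unfolding a_def b_def u_def v_def by (rule area[OF g])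
    finally have detB: "det B = 1" .
    then have "B \<in> SU_n1 1" using B nk by (simp add: SU_n1_def)
    moreover have "A \<in> SU (n - 1)" using A det detB kn by (simp add: SU_def)
    ultimately show "block_diag A B \<in> SU_SU11 n" by (auto simp: SU_SU11_def)
  qed
qed

text \<open>The real span W of the orbit is invariant and the form is real on it, and it contains q
  because q is a real multiple of an orbit vector. A maximal orthonormal system is taken inside W
  and then completed in the whole space by vectors orthogonal to W. The entries of the block
  belonging to W are pairings of elements of W, hence real.\<close>

lemma real_orbit_orthogonal_form:
  assumes sub: "is_subgroup_of G n"
    and p: "p \<in> carrier_vec (Suc n)" "herm n p p = 0"
    and h: "h \<in> G" and q: "q = complex_of_real r \<cdot>\<^sub>v (h *\<^sub>v p)" "herm n p q = 1"
    and real: "\<And>g. g \<in> G \<Longrightarrow> herm n (g *\<^sub>v p) p \<in> \<real>"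
    and g: "g \<in> G" "g *\<^sub>v p \<noteq> herm n (g *\<^sub>v p) q \<cdot>\<^sub>v p + herm n (g *\<^sub>v p) p \<cdot>\<^sub>v q"
  shows "\<exists>m. 2 \<le> m \<and> m \<le> n \<and> conj_into n G (S_U_O n m)"
proof -
  note G = subgroup_facts[OF sub]
  define S where "S = (\<lambda>g. g *\<^sub>v p) ` G"
  define W where "W = real_span S"
  have S: "S \<subseteq> carrier_vec (Suc n)" using G(1) p(1) by (auto simp: S_def)
  have Wc: "W \<subseteq> carrier_vec (Suc n)" unfolding W_def by (rule real_span_carrier[OF S])
  have Sreal: "herm n x y \<in> \<real>" if xy: "x \<in> S" "y \<in> S" for x y
  proof -
    obtain g g' where gg: "g \<in> G" "g' \<in> G" "x = g *\<^sub>v p" "y = g' *\<^sub>v p" using xy by (auto simp: S_def)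
    show ?thesis unfolding gg(3,4) orbit_pairing[OF sub p(1) gg(1,2)] by (rule real[OF G(2)[OF G(3)[OF gg(2)] gg(1)]])
  qed
  have Wreal: "herm n x y \<in> \<real>" if "x \<in> W" "y \<in> W" for x y
    using real_span_herm_real[OF S Sreal] that unfolding W_def by blast
  have Sinv: "g *\<^sub>v x \<in> S" if "g \<in> G" "x \<in> S" for g x
  proof -
    obtain g' where g': "g' \<in> G" "x = g' *\<^sub>v p" using \<open>x \<in> S\<close> by (auto simp: S_def)
    have "g *\<^sub>v x = (g * g') *\<^sub>v p"
      unfolding g'(2) mult_mat_vec_assoc[OF G(1)[OF \<open>g \<in> G\<close>] G(1)[OF g'(1)] p(1)] ..
    then show ?thesis using G(2)[OF \<open>g \<in> G\<close> g'(1)] by (auto simp: S_def)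
  qed
  have Winv: "g *\<^sub>v x \<in> W" if "g \<in> G" "x \<in> W" for g x
    using real_span_invariant[OF G(1)[OF that(1)] S Sinv[OF that(1)]] that(2) unfolding W_def by blast
  have Wadd: "x + y \<in> W" if "x \<in> W" "y \<in> W" for x y using that unfolding W_def by (rule real_span.add)
  have Wscale: "complex_of_real t \<cdot>\<^sub>v x \<in> W" if "x \<in> W" for t x using that unfolding W_def by (rule real_span.scale)
  have orbitW: "g *\<^sub>v p \<in> W" if "g \<in> G" for g unfolding W_def S_def using that by (intro real_span.base) blast
  have pW: "p \<in> W" using orbitW[OF G(4)] p(1) by simp
  have qW: "q \<in> W" unfolding q(1) by (rule Wscale[OF orbitW[OF h]])
  have qc: "q \<in> carrier_vec (Suc n)" using qW Wc by blast
  have hp: "h *\<^sub>v p \<in> carrier_vec (Suc n)" by (rule mult_vec_carrier[OF G(1)[OF h] p(1)])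
  have qq: "herm n q q = 0"
    unfolding q(1) herm_smult_left[OF hp] herm_smult_right[OF hp] herm_invariant[OF G(1)[OF h] p(1) p(1)] p(2) by simp
  have qp: "herm n q p = 1" using q(2) by (metis herm_cnj complex_cnj_one)
  define f1 where "f1 = complex_of_real (1 / sqrt 2) \<cdot>\<^sub>v (p + q)"
  define f0 where "f0 = complex_of_real (1 / sqrt 2) \<cdot>\<^sub>v (p + complex_of_real (- 1) \<cdot>\<^sub>v q)"
  have fr1: "frame n [f1] f0"
    unfolding f1_def f0_def by (rule hyperbolic_pair_frame[OF p qc qq q(2)])
  have fW: "f1 \<in> W" "f0 \<in> W" unfolding f1_def f0_def by (intro Wscale Wadd pW qW)+
  obtain ws where ws: "set ws \<subseteq> W" "frame n (ws @ [f1]) f0"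
    and complete: "\<forall>x\<in>W. (\<forall>u\<in>set (ws @ [f1]). herm n x u = 0) \<and> herm n x f0 = 0 \<longrightarrow> x = 0\<^sub>v (Suc n)"
    using frame_extend[OF fr1 Wc Wscale] by blast
  have len: "length ws \<noteq> 0"
  proof
    assume "length ws = 0"
    then have ws0: "ws = []" by simp
    obtain a b where ab: "herm n (g *\<^sub>v p) q = complex_of_real a" "herm n (g *\<^sub>v p) p = complex_of_real b"
      using Wreal[OF orbitW[OF g(1)] qW] Wreal[OF orbitW[OF g(1)] pW] by (auto elim!: Reals_cases)
    \<comment> \<open>The residual of g p after projection to the plane of p and q. Its coefficients
      are real, so it lies in W; were no vector added to f1 and f0, maximality would make it
      zero.\<close>
    define x where "x = g *\<^sub>v p + (complex_of_real (- a) \<cdot>\<^sub>v p + complex_of_real (- b) \<cdot>\<^sub>v q)"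
    have gpc: "g *\<^sub>v p \<in> carrier_vec (Suc n)" using orbitW[OF g(1)] Wc by blast
    have xW: "x \<in> W" unfolding x_def by (intro Wadd Wscale orbitW g pW qW)
    have "herm n x p = 0" "herm n x q = 0"
      unfolding x_def using p qc qq q(2) qp ab gpc by (simp_all add: herm_lin)
    then have "herm n x f1 = 0" "herm n x f0 = 0"
      unfolding f1_def f0_def using p qc by (simp_all add: herm_lin)
    then have x0: "x = 0\<^sub>v (Suc n)" using complete xW ws0 by simp
    have "g *\<^sub>v p = complex_of_real a \<cdot>\<^sub>v p + complex_of_real b \<cdot>\<^sub>v q"
    proof (rule eq_vecI)
      fix i assume "i < dim_vec (complex_of_real a \<cdot>\<^sub>v p + complex_of_real b \<cdot>\<^sub>v q)"
      then have i: "i < Suc n" using qc by simp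
      then have "x $ i = 0" using x0 by simp
      moreover have "x $ i = (g *\<^sub>v p) $ i + (- complex_of_real a * p $ i + - complex_of_real b * q $ i)"
        unfolding x_def using i p(1) qc gpc by (simp del: index_mult_mat_vec)
      ultimately show "(g *\<^sub>v p) $ i = (complex_of_real a \<cdot>\<^sub>v p + complex_of_real b \<cdot>\<^sub>v q) $ i"
        using i p(1) qc by (simp add: algebra_simps del: index_mult_mat_vec)
    qed (use gpc qc in \<open>simp del: dim_mult_mat_vec\<close>)
    then show False using g(2) ab by simp
  qed
  obtain vs where vs: "frame n (vs @ (ws @ [f1])) f0" "length (vs @ (ws @ [f1])) = n"
    using frame_extend_full[OF ws(2)] by blast
  define k where "k = length vs"
  let ?b = "(vs @ (ws @ [f1])) @ [f0]"
  have kn: "k \<le> n" using vs(2) by (simp add: k_def)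
  have bW: "?b ! j \<in> W" if "k \<le> j" "j \<le> n" for j
  proof -
    have "?b ! j = ((ws @ [f1]) @ [f0]) ! (j - k)"
      using that by (simp add: nth_append k_def)
    moreover have "((ws @ [f1]) @ [f0]) ! (j - k) \<in> set ((ws @ [f1]) @ [f0])"
      using that vs(2) by (intro nth_mem) (auto simp: k_def)
    ultimately show ?thesis using ws(1) fW by auto
  qed
  have orth: "herm n x (?b ! i) = 0" if x: "x \<in> W" and i: "i < k" for x i
  proof (rule frame_span_orthogonal[OF ws(2) Wc Wadd Wscale Wreal _ fW(2) _ _ _ x])
    show "set (ws @ [f1]) \<subseteq> W" using ws fW by simp
    show "y = 0\<^sub>v (Suc n)" if "y \<in> W" "\<And>u. u \<in> set (ws @ [f1]) \<Longrightarrow> herm n y u = 0" "herm n y f0 = 0" for y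
      using complete that by blast
    have b_f0: "?b ! n = f0" using vs(2) by (metis nth_append_length)
    show "herm n f0 (?b ! i) = 0"
      using frame_herm[OF vs, of n i] i kn unfolding b_f0 by simp
    fix u assume "u \<in> set (ws @ [f1])"
    then obtain l where l: "l < length (ws @ [f1])" "u = (ws @ [f1]) ! l" by (metis in_set_conv_nth)
    have "?b ! (k + l) = u" using l by (simp add: nth_append k_def)
    then show "herm n u (?b ! i) = 0"
      using frame_herm[OF vs, of "k + l" i] i kn l(1) vs(2) by (simp add: k_def)
  qed
  show ?thesis
  proof (intro exI[of _ "n - k"] conjI)
    \<comment> \<open>The number n - k counts the positive frame vectors taken from W, namely f1 and
      the nonempty list \<open>ws\<close>.\<close>
    show "2 \<le> n - k" using len vs(2) unfolding k_def length_append by (cases ws) auto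
    show "n - k \<le> n" by simp
    show "conj_into n G (S_U_O n (n - k))"
    proof (rule frame_block_form[OF sub vs kn])
      show "herm n (g *\<^sub>v ?b ! j) (?b ! i) = 0" if "g \<in> G" "i < k" "k \<le> j" "j \<le> n" for g i j
        by (rule orth[OF Winv[OF that(1) bW[OF that(3,4)]] that(2)])
      fix g A B
      assume g: "g \<in> G" and A: "A \<in> U k" and B: "B \<in> carrier_mat (Suc (n - k)) (Suc (n - k))"
        "adj B * Ipq (n - k) * B = Ipq (n - k)" and det: "det (block_diag A B) = 1"
        and ix: "\<And>i j. i \<le> n - k \<Longrightarrow> j \<le> n - k \<Longrightarrow>
          B $$ (i,j) = sg n (i + k) * herm n (g *\<^sub>v ?b ! (j + k)) (?b ! (i + k))"
      have "B \<in> O_m1 (n - k)"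
      proof (rule real_Ipq_preserving_in_O_m1[OF B])
        fix i j assume ij: "i \<le> n - k" "j \<le> n - k"
        have "k \<le> i + k" "i + k \<le> n" "k \<le> j + k" "j + k \<le> n" using ij kn by auto
        then have "?b ! (i + k) \<in> W" "?b ! (j + k) \<in> W" by (blast intro: bW)+
        then have "herm n (g *\<^sub>v ?b ! (j + k)) (?b ! (i + k)) \<in> \<real>" by (intro Wreal Winv g)
        moreover have "sg n (i + k) \<in> \<real>" by (simp add: sg_def)
        ultimately show "B $$ (i,j) \<in> \<real>" unfolding ix[OF ij] by (rule Reals_mult[rotated])
      qed
      then show "block_diag A B \<in> S_U_O n (n - k)"
        using A det kn unfolding S_U_O_def by auto
    qed
  qed
qed

theorem theorem3p9:
  fixes n :: nat and \<Gamma> :: "complex mat set"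
  assumes "is_subgroup_of \<Gamma> n"
    and "discrete_mats \<Gamma>"
    and "nonelementary n \<Gamma>"
    and "trace_field \<Gamma> \<subseteq> \<real>"
  shows "(\<exists>m. 2 \<le> m \<and> m \<le> n \<and> conj_into n \<Gamma> (S_U_O n m)) \<or> conj_into n \<Gamma> (SU_SU11 n)"
proof -
  note sub = assms(1) and disc = assms(2) and ne = assms(3)
  note G = subgroup_facts[OF sub]
  obtain p where p: "p \<in> carrier_vec (Suc n)" "herm n p p = 0" "p \<noteq> 0\<^sub>v (Suc n)"
    and phase: "(\<forall>g\<in>\<Gamma>. herm n (g *\<^sub>v p) p \<in> \<real>) \<or> (\<forall>g\<in>\<Gamma>. Re (herm n (g *\<^sub>v p) p) = 0)"
    using real_or_imaginary_orbit[OF assms] by blast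
  obtain h where h: "h \<in> \<Gamma>" "herm n (h *\<^sub>v p) p \<noteq> 0"
    using no_fixed_null_line[OF sub disc ne p] by blast
  \<comment> \<open>This scalar normalises q to \<langle>q, p\<rangle> = 1. Like \<langle>h p,
    p\<rangle> it is real in the real case and imaginary in the imaginary case.\<close>
  define c where "c = inverse (herm n (h *\<^sub>v p) p)"
  define q where "q = c \<cdot>\<^sub>v (h *\<^sub>v p)"
  have hp: "h *\<^sub>v p \<in> carrier_vec (Suc n)" by (rule mult_vec_carrier[OF G(1)[OF h(1)] p(1)])
  have qc: "q \<in> carrier_vec (Suc n)" unfolding q_def using hp by simp
  have qq: "herm n q q = 0"
    unfolding q_def herm_smult_left[OF hp] herm_smult_right[OF hp] herm_invariant[OF G(1)[OF h(1)] p(1) p(1)] p(2) by simp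
  have qp: "herm n q p = 1" unfolding q_def herm_smult_left[OF hp] c_def using h(2) by simp
  then have pq: "herm n p q = 1" by (metis herm_cnj complex_cnj_one)
  have herm_q: "herm n (g *\<^sub>v p) q = cnj c * herm n ((hadj n h * g) *\<^sub>v p) p" if "g \<in> \<Gamma>" for g
    unfolding q_def herm_smult_right[OF hp] orbit_pairing[OF sub p(1) that h(1)] ..
  \<comment> \<open>\<langle>g p, q\<rangle> is the product of cnj c and a number \<langle>g' p,
    p\<rangle> with g' in \<Gamma>. Both factors are real or both are imaginary, so the product is
    real in either case.\<close>
  have q_real: "herm n (g *\<^sub>v p) q \<in> \<real>" if g: "g \<in> \<Gamma>" for g
  proof -
    have g': "hadj n h * g \<in> \<Gamma>" by (rule G(2)[OF G(3)[OF h(1)] g])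
    show ?thesis
      using phase
    proof
      assume *: "\<forall>g\<in>\<Gamma>. herm n (g *\<^sub>v p) p \<in> \<real>"
      then have "cnj c \<in> \<real>" using h(1) unfolding c_def by simp
      then show ?thesis unfolding herm_q[OF g] using * g' by simp
    next
      assume *: "\<forall>g\<in>\<Gamma>. Re (herm n (g *\<^sub>v p) p) = 0"
      then have "Re c = 0" using h(1) unfolding c_def by simp
      then show ?thesis unfolding herm_q[OF g] using * g' by (simp add: complex_is_Real_iff)
    qed
  qed
  show ?thesis
  proof (cases "\<forall>g\<in>\<Gamma>. g *\<^sub>v p = herm n (g *\<^sub>v p) q \<cdot>\<^sub>v p + herm n (g *\<^sub>v p) p \<cdot>\<^sub>v q")
    case True
    from phase show ?thesis
    proof
      assume *: "\<forall>g\<in>\<Gamma>. herm n (g *\<^sub>v p) p \<in> \<real>"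
      have False
        by (rule hyperbolic_plane_real_elementary[OF sub ne p h(1) q_def pq]) (use True * q_real in auto)
      then show ?thesis ..
    next
      assume *: "\<forall>g\<in>\<Gamma>. Re (herm n (g *\<^sub>v p) p) = 0"
      then have "Re c = 0" using h(1) unfolding c_def by simp
      then have "conj_into n \<Gamma> (SU_SU11 n)"
        by (intro hyperbolic_plane_imaginary[OF sub p(1,2) h(1) q_def pq]) (use True * in auto)
      then show ?thesis ..
    qed
  next
    case False
    then obtain g where g: "g \<in> \<Gamma>" "g *\<^sub>v p \<noteq> herm n (g *\<^sub>v p) q \<cdot>\<^sub>v p + herm n (g *\<^sub>v p) p \<cdot>\<^sub>v q" by blast
    have real: "\<forall>g\<in>\<Gamma>. herm n (g *\<^sub>v p) p \<in> \<real>"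
    proof (rule ccontr)
      assume "\<not> ?thesis"
      with phase have imag: "\<forall>g\<in>\<Gamma>. Re (herm n (g *\<^sub>v p) p) = 0" by blast
      define a b where "a = herm n (g *\<^sub>v p) q" and "b = herm n (g *\<^sub>v p) p"
      have gpc: "g *\<^sub>v p \<in> carrier_vec (Suc n)" by (rule mult_vec_carrier[OF G(1)[OF g(1)] p(1)])
      \<comment> \<open>The part of g p orthogonal to p and q. Nullity of g p gives \<langle>x,
        x\<rangle> = -2 Re (a cnj b), which is zero for a real and b imaginary; since x is also
        orthogonal to the negative vector p - q, it vanishes.\<close>
      define x where "x = g *\<^sub>v p - (a \<cdot>\<^sub>v p + b \<cdot>\<^sub>v q)"
      have xc: "x \<in> carrier_vec (Suc n)" unfolding x_def using gpc p qc by simp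
      have xp: "herm n x p = 0" "herm n x q = 0"
        unfolding x_def using p qc qq pq qp gpc by (simp_all add: herm_lin a_def b_def)
      have ab: "Im a = 0" "Re b = 0"
        using q_real[OF g(1)] imag g(1) by (simp_all add: a_def b_def complex_is_Real_iff)
      have xx: "Re (herm n x x) = 0"
      proof -
        have "herm n x x = herm n x (g *\<^sub>v p) - (cnj a * herm n x p + cnj b * herm n x q)"
          using p qc gpc xc by (subst (2) x_def) (simp add: herm_lin)
        also have "\<dots> = herm n x (g *\<^sub>v p)" using xp by simp
        also have "\<dots> = herm n (g *\<^sub>v p) (g *\<^sub>v p) - (a * herm n p (g *\<^sub>v p) + b * herm n q (g *\<^sub>v p))"
          unfolding x_def using p qc gpc by (simp add: herm_lin)
        also have "\<dots> = - (a * cnj b + b * cnj a)"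
          unfolding herm_invariant[OF G(1)[OF g(1)] p(1) p(1)] p(2) a_def b_def herm_cnj by simp
        finally show ?thesis using ab by simp
      qed
      let ?f = "p + complex_of_real (- 1) \<cdot>\<^sub>v q"
      have "herm n ?f ?f = - 2" using p qc qq pq qp by (simp add: herm_lin)
      moreover have "herm n x ?f = 0" using p qc xp by (simp add: herm_lin)
      ultimately have x0: "x = 0\<^sub>v (Suc n)" using xx by (intro orth_negative_positive[OF xc, of ?f]) auto
      have "g *\<^sub>v p = a \<cdot>\<^sub>v p + b \<cdot>\<^sub>v q"
      proof (rule eq_vecI)
        fix i assume "i < dim_vec (a \<cdot>\<^sub>v p + b \<cdot>\<^sub>v q)"
        then have i: "i < Suc n" using qc by simp
        then have "x $ i = 0" using x0 by simp
        then show "(g *\<^sub>v p) $ i = (a \<cdot>\<^sub>v p + b \<cdot>\<^sub>v q) $ i"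
          unfolding x_def using i p(1) qc gpc by (simp del: index_mult_mat_vec)
      qed (use gpc qc in \<open>simp del: dim_mult_mat_vec\<close>)
      then show False using g(2) by (simp add: a_def b_def)
    qed
    \<comment> \<open>Reality of c makes q a real multiple of h p, which is what puts q into the
      real span of the orbit.\<close>
    then have "c \<in> \<real>" using h(1) unfolding c_def by simp
    then obtain r where r: "c = complex_of_real r" by (auto elim: Reals_cases)
    have "\<exists>m. 2 \<le> m \<and> m \<le> n \<and> conj_into n \<Gamma> (S_U_O n m)"
      by (rule real_orbit_orthogonal_form[OF sub p(1,2) h(1) q_def[unfolded r] pq _ g]) (use real in blast)
    then show ?thesis ..
  qed
qed

end
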